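(* Let $m\in\mathbb{Z}$ be not divisible by $16$ and satisfy $m\geq 217\,942\,742\,279$. Then there exists at least one integer $n\in\left[\sqrt[4]{34\,m},\sqrt[4]{35\,m}\right]$ such that the system $$\begin{cases} m = x^2+y^2+z^2+t^2\\ n^2 = x+3y+5z\end{cases}$$ has a solution with $x,y,z,t\in\mathbb{N}$.
   Context: Here $\mathbb{N}=\{0,1,2,\ldots\}$. *)

theory Defs
  imports Complex_Main
begin

end

theory Submission
  imports
    Defs
    "HOL-Number_Theory.Number_Theory"
    "HOL-Computational_Algebra.Squarefree"
    "HOL-Library.Discrete_Functions"
begin

text \<open>Write \<open>35 m = n\<^sup>4 + A\<^sup>2 + B\<^sup>2 + C\<^sup>2\<close>. If the quaternion \<open>n\<^sup>2 + A i + B j + C k\<close> is left divisible by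
  \<open>1 - 3i - 5j\<close>, the quotient is an integral solution of the system, and \<open>n\<^sup>4 \<ge> 34 m\<close> forces \<open>x, y, z \<ge> 0\<close>
  by Cauchy-Schwarz. Rotating \<open>(A, B, C)\<close> by signed permutations and by conjugation with the left divisors of
  norm 5 and 7 yields further vectors of norm \<open>N = 35 m - n\<^sup>4\<close>. If none of them is good, \<open>(A, B, C)\<close> stays
  integral under all powers of a rotation of infinite order with denominator 5, hence is parallel to its axis,
  a signed permutation of \<open>(3, 3, 1)\<close>; then \<open>N = 19 b\<^sup>2\<close>, which has a representation of another shape as soon as \<open>b\<close> has an odd prime
  factor. For this \<open>n\<close> has to be prime to 35 and of the right parity for \<open>N\<close> to be a sum of three squares, and any
  six consecutive integers contain such an \<open>n\<close>.

  The three-square theorem follows from a lattice argument for \<open>n w\<^sup>2 = z\<^sup>2 + q v\<^sup>2\<close> and the Davenport-Cassels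
  descent. The prime occurring in \<open>q\<close> has prescribed values of finitely many real characters; its existence
  is the elementary (Mertens style) form of Dirichlet's argument, with Monsky's proof that \<open>L(1, \<chi>) \<noteq> 0\<close>.\<close>


section \<open>Real characters and their partial sums\<close>

text \<open>The factorisation 35 = 5 * 7 governs the argument. A quaternion whose norm is divisible
  by an odd prime p, but which is not itself divisible by p, has exactly one of p + 1 left divisors
  of norm p, up to right units. For p = 5 these are \<open>1 + 2e\<close> with \<open>e\<close> one
  of the six coordinate directions, for p = 7 they are \<open>2 + w\<close> with \<open>w\<close>
  one of the eight vertices of a cube. The scalar product of \<open>e\<close> and \<open>w\<close>
  is 1 or -1, and the 24 rotations of the cube permute the pairs of either sign transitively. The
  pair of \<open>1 - 3i - 5j\<close> has sign -1, so a vector can be rotated into a good one as soon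
  as its sign is -1; the obstacle is the sign 1, which may persist under every move.

  Divisibility by 16 enters through \<open>N\<close>: if 16 divides \<open>m\<close>, an odd
  \<open>n\<close> gives \<open>N\<close> congruent to 7 mod 8, and an even \<open>n\<close> gives
  \<open>N\<close> divisible by 16. The lower bound for \<open>m\<close> is, up to rounding, the
  fourth power of 12 / (35^(1/4) - 34^(1/4)): it makes the interval about 12 long, so that six
  consecutive integers fit in.\<close>

locale real_char =
  fixes M :: nat and \<chi> :: "nat \<Rightarrow> real"
  assumes modulus_pos: "M > 0"
    and mult: "\<chi> (k * l) = \<chi> k * \<chi> l"
    and period: "\<chi> (k + M) = \<chi> k"
    and coprime_val: "coprime k M \<Longrightarrow> \<chi> k = 1 \<or> \<chi> k = -1"
    and not_coprime_val: "\<not> coprime k M \<Longrightarrow> \<chi> k = 0"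
begin

lemma abs_le_1: "\<bar>\<chi> k\<bar> \<le> 1"
  using coprime_val[of k] not_coprime_val[of k] by fastforce

lemma one: "\<chi> 1 = 1"
  using mult[of 1 1] coprime_val[of 1] by auto

lemma power: "\<chi> (k ^ j) = \<chi> k ^ j"
  by (induction j) (use one mult in auto)

lemma period_mult: "\<chi> (k + j * M) = \<chi> k"
proof (induction j)
  case (Suc j)
  then show ?case using period[of "k + j * M"] by (simp add: algebra_simps)
qed simp

lemma mod: "\<chi> (k mod M) = \<chi> k"
  using period_mult[of "k mod M" "k div M"] by simp

end

locale nonprincipal_char = real_char +
  assumes nonprincipal: "\<exists>b. \<chi> b = -1"
begin

text \<open>Multiplication by \<open>b\<close> permutes the residues mod \<open>M\<close> and flips
  the sign of every term, so the sum equals its own negative.\<close>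

lemma sum_period: "(\<Sum>k<M. \<chi> k) = 0"
proof -
  obtain b where b: "\<chi> b = -1" using nonprincipal by blast
  have cb: "coprime b M" using b not_coprime_val[of b] by fastforce
  have inj: "inj_on (\<lambda>k. b * k mod M) {..<M}"
  proof (rule inj_onI)
    fix x y assume xy: "x \<in> {..<M}" "y \<in> {..<M}" "b * x mod M = b * y mod M"
    then have "[b * x = b * y] (mod M)" by (simp add: cong_def)
    then have "[x = y] (mod M)" using cb cong_mult_lcancel_nat by blast
    then show "x = y" using xy by (simp add: cong_def)
  qed
  have "(\<lambda>k. b * k mod M) ` {..<M} = {..<M}"
    by (rule card_subset_eq) (use modulus_pos card_image[OF inj] in auto)
  then have "(\<Sum>k<M. \<chi> k) = (\<Sum>k<M. \<chi> (b * k mod M))"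
    using sum.reindex[OF inj, of \<chi>] by simp
  also have "\<dots> = - (\<Sum>k<M. \<chi> k)"
    by (simp add: mod mult b sum_negf)
  finally show ?thesis by simp
qed

lemma sum_shift: "(\<Sum>k<n + M. \<chi> k) = (\<Sum>k<n. \<chi> k)"
  by (induction n) (simp_all add: sum_period period)

lemma partial_sum_bound: "\<bar>\<Sum>k<n. \<chi> k\<bar> \<le> M"
proof (induction n rule: less_induct)
  case (less n)
  show ?case
  proof (cases "n < M")
    case True
    have "\<bar>\<Sum>k<n. \<chi> k\<bar> \<le> (\<Sum>k<n. \<bar>\<chi> k\<bar>)" by (rule sum_abs)
    also have "\<dots> \<le> (\<Sum>k<n. 1)" by (intro sum_mono abs_le_1)
    finally show ?thesis using True by simp
  next
    case False
    then show ?thesis using less[of "n - M"] sum_shift[of "n - M"] modulus_pos by simp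
  qed
qed

end

section \<open>Summation by parts and the value of the L-series at 1\<close>

lemma abel_bound:
  fixes f g :: "nat \<Rightarrow> real"
  assumes dec: "\<And>n. n \<ge> a \<Longrightarrow> f (Suc n) \<le> f n" and nonneg: "\<And>n. n \<ge> a \<Longrightarrow> f n \<ge> 0"
    and bound: "\<And>n. \<bar>\<Sum>k<n. g k\<bar> \<le> K" and "a \<le> b"
  shows "\<bar>\<Sum>k=a..<b. g k * f k\<bar> \<le> 2 * K * f a"
proof -
  define T where "T n = (\<Sum>k=a..<n. g k)" for n
  \<comment> \<open>A block starting at \<open>a\<close> is a difference of two partial sums, hence
    the factor 2 in the conclusion.\<close>
  have T: "\<bar>T n\<bar> \<le> 2 * K" if "n \<ge> a" for n
  proof -
    have "(\<Sum>k<n. g k) = (\<Sum>k<a. g k) + T n"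
      unfolding T_def using that by (metis atLeast0LessThan sum.atLeastLessThan_concat zero_le)
    then show ?thesis using bound[of n] bound[of a] by linarith
  qed
  have eq: "(\<Sum>k=a..<b. g k * f k) = T b * f b + (\<Sum>k=a..<b. T (Suc k) * (f k - f (Suc k)))"
    using \<open>a \<le> b\<close>
  proof (induction b rule: dec_induct)
    case (step n)
    then show ?case by (simp add: T_def algebra_simps)
  qed (simp add: T_def)
  have tele: "(\<Sum>k=a..<b. f k - f (Suc k)) = f a - f b"
    using \<open>a \<le> b\<close> by (induction b rule: dec_induct) auto
  have "\<bar>\<Sum>k=a..<b. T (Suc k) * (f k - f (Suc k))\<bar> \<le> (\<Sum>k=a..<b. \<bar>T (Suc k) * (f k - f (Suc k))\<bar>)"
    by (rule sum_abs)
  also have "\<dots> \<le> (\<Sum>k=a..<b. 2 * K * (f k - f (Suc k)))"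
  proof (rule sum_mono)
    fix k assume "k \<in> {a..<b}"
    then show "\<bar>T (Suc k) * (f k - f (Suc k))\<bar> \<le> 2 * K * (f k - f (Suc k))"
      using T[of "Suc k"] dec[of k] by (simp add: abs_mult mult_right_mono)
  qed
  also have "\<dots> = 2 * K * (f a - f b)" by (simp add: sum_distrib_left[symmetric] tele)
  finally have 1: "\<bar>\<Sum>k=a..<b. T (Suc k) * (f k - f (Suc k))\<bar> \<le> 2 * K * (f a - f b)" .
  have 2: "\<bar>T b * f b\<bar> \<le> 2 * K * f b"
    using T[of b] nonneg[of b] \<open>a \<le> b\<close> by (simp add: abs_mult mult_right_mono)
  show ?thesis using 1 2 unfolding eq by (simp add: algebra_simps)
qed

context nonprincipal_char begin

lemma abel_bound_char:
  fixes f :: "nat \<Rightarrow> real"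
  assumes "\<And>n. n \<ge> a \<Longrightarrow> f (Suc n) \<le> f n" "\<And>n. n \<ge> a \<Longrightarrow> f n \<ge> 0" "a \<le> b"
  shows "\<bar>\<Sum>k=a..<b. \<chi> k * f k\<bar> \<le> 2 * real M * f a"
  by (rule abel_bound[of _ _ _ "real M"]) (use assms partial_sum_bound in auto)

definition L1 :: real where "L1 = lim (\<lambda>n. \<Sum>k=1..<n. \<chi> k / k)"

lemma L1_diff:
  assumes "1 \<le> m" "m \<le> n"
  shows "\<bar>(\<Sum>k=1..<n. \<chi> k / k) - (\<Sum>k=1..<m. \<chi> k / k)\<bar> \<le> 2 * real M / m"
proof -
  have "(\<Sum>k=1..<n. \<chi> k / k) - (\<Sum>k=1..<m. \<chi> k / k) = (\<Sum>k=m..<n. \<chi> k * (1 / k))"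
    using sum.atLeastLessThan_concat[of 1 m n "\<lambda>k. \<chi> k / k"] assms by simp
  moreover have "\<bar>\<Sum>k=m..<n. \<chi> k * (1 / k)\<bar> \<le> 2 * real M * (1 / m)"
    by (rule abel_bound_char) (use assms in \<open>auto simp: field_simps\<close>)
  ultimately show ?thesis by simp
qed

lemma L1_lim: "(\<lambda>n. \<Sum>k=1..<n. \<chi> k / k) \<longlonglongrightarrow> L1"
proof -
  have "Cauchy (\<lambda>n. \<Sum>k=1..<n. \<chi> k / k)"
  proof (rule metric_CauchyI)
    fix e :: real assume e: "e > 0"
    obtain n0 :: nat where n0: "2 * real M / e < n0" using reals_Archimedean2 by blast
    define m0 where "m0 = max 1 n0"
    have *: "dist (\<Sum>k=1..<n. \<chi> k / k) (\<Sum>k=1..<m. \<chi> k / k) < e" if "m0 \<le> m" "m \<le> n" for m n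
    proof -
      have "2 * real M < e * m" using n0 that e by (simp add: m0_def field_simps)
          (metis mult_left_mono of_nat_le_iff order_less_le_trans less_imp_le)
      moreover have "m \<ge> 1" using that by (simp add: m0_def)
      ultimately show ?thesis using L1_diff[of m n] that unfolding dist_real_def
        by (smt (verit) divide_less_eq of_nat_1 of_nat_le_iff)
    qed
    show "\<exists>m0. \<forall>m\<ge>m0. \<forall>n\<ge>m0. dist (\<Sum>k=1..<m. \<chi> k / k) (\<Sum>k=1..<n. \<chi> k / k) < e"
      by (intro exI[of _ m0]) (metis * dist_commute nat_le_linear)
  qed
  then show ?thesis unfolding L1_def by (simp add: Cauchy_convergent_iff convergent_LIMSEQ_iff)
qed

text \<open>The rate 1/m matters: it leaves an error proportional to \<open>mangoldt d\<close> when
  \<open>L1\<close> is factored out of a convolution sum, and Chebyshev's bound can absorb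
  that.\<close>

lemma L1_tail:
  assumes "1 \<le> m"
  shows "\<bar>L1 - (\<Sum>k=1..<m. \<chi> k / k)\<bar> \<le> 2 * real M / m"
proof (rule tendsto_upperbound)
  show "(\<lambda>n. \<bar>(\<Sum>k=1..<n. \<chi> k / k) - (\<Sum>k=1..<m. \<chi> k / k)\<bar>) \<longlonglongrightarrow> \<bar>L1 - (\<Sum>k=1..<m. \<chi> k / k)\<bar>"
    by (intro tendsto_intros L1_lim)
  show "\<forall>\<^sub>F n in sequentially. \<bar>(\<Sum>k=1..<n. \<chi> k / k) - (\<Sum>k=1..<m. \<chi> k / k)\<bar> \<le> 2 * real M / m"
    using L1_diff[OF assms] eventually_ge_at_top by (metis (mono_tags, lifting) eventually_mono)
qed simp

end

text \<open>The function ln x / x decreases only from x = e on, hence the start at 3.\<close>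

lemma ln_over_decreasing:
  assumes "n \<ge> 3"
  shows "ln (real (Suc n)) / real (Suc n) \<le> ln (real n) / real n"
proof -
  have "exp 1 \<le> real n" using exp_le assms by linarith
  then have "1 \<le> ln (real n)" using assms by (subst ln_ge_iff) auto
  moreover have "ln (real (Suc n)) - ln (real n) \<le> 1 / n"
  proof -
    have "ln (real (Suc n) / real n) \<le> real (Suc n) / real n - 1"
      by (rule ln_le_minus_one) (use assms in auto)
    then show ?thesis using assms by (simp add: ln_div field_simps)
  qed
  ultimately have "n * (ln (real (Suc n)) - ln (real n)) \<le> ln (real n)"
    using mult_left_mono[of "ln (real (Suc n)) - ln (real n)" "1 / n" n] assms by simp
  then show ?thesis using assms by (simp add: field_simps)
qed

context nonprincipal_char begin

lemma sum_ln_bounded: "\<exists>C. \<forall>n. \<bar>\<Sum>k=1..<n. \<chi> k * (ln k / k)\<bar> \<le> C"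
proof -
  define C where "C = \<bar>\<Sum>k=1..<3. \<chi> k * (ln k / k)\<bar> + 2 * real M * (ln 3 / 3) + (\<Sum>n<3. \<bar>\<Sum>k=1..<n. \<chi> k * (ln k / k)\<bar>)"
  have "\<bar>\<Sum>k=1..<n. \<chi> k * (ln k / k)\<bar> \<le> C" for n
  proof (cases "n < 3")
    case True
    then have "\<bar>\<Sum>k=1..<n. \<chi> k * (ln k / k)\<bar> \<le> (\<Sum>n<3. \<bar>\<Sum>k=1..<n. \<chi> k * (ln k / k)\<bar>)"
      by (intro member_le_sum) auto
    then show ?thesis unfolding C_def by (simp add: add_increasing)
  next
    case False
    then have "(\<Sum>k=1..<n. \<chi> k * (ln k / k)) = (\<Sum>k=1..<3. \<chi> k * (ln k / k)) + (\<Sum>k=3..<n. \<chi> k * (ln k / k))"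
      by (subst sum.atLeastLessThan_concat) auto
    moreover have "\<bar>\<Sum>k=3..<n. \<chi> k * (ln k / k)\<bar> \<le> 2 * real M * (ln (real 3) / real 3)"
      by (rule abel_bound_char) (use False ln_over_decreasing in auto)
    moreover have "(\<Sum>n<3. \<bar>\<Sum>k=1..<n. \<chi> k * (ln k / k)\<bar>) \<ge> 0" by (intro sum_nonneg) auto
    ultimately show ?thesis unfolding C_def of_nat_numeral by linarith
  qed
  then show ?thesis by blast
qed

end

section \<open>Divisor sums and Lambert series\<close>

text \<open>Both sides run over the pairs (d, k) with d * k \<le> N. This opens up every Dirichlet
  convolution below: the Lambert series, the logarithm of N!, and the logarithmic sum of a
  character.\<close>

lemma sum_divisors_swap:
  fixes f :: "nat \<Rightarrow> nat \<Rightarrow> 'a :: comm_monoid_add"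
  shows "(\<Sum>n=1..N. \<Sum>d | d dvd n. f d (n div d)) = (\<Sum>d=1..N. \<Sum>k=1..N div d. f d k)"
proof -
  have fin: "finite {d. d dvd n}" if "n \<in> {1..N}" for n :: nat using that by simp
  have "(\<Sum>n=1..N. \<Sum>d | d dvd n. f d (n div d)) = (\<Sum>(n, d)\<in>(SIGMA n:{1..N}. {d. d dvd n}). f d (n div d))"
    by (rule sum.Sigma) (use fin in auto)
  also have "\<dots> = (\<Sum>(d, k)\<in>(SIGMA d:{1..N}. {1..N div d}). f d k)"
  proof (rule sum.reindex_bij_witness[of _ "\<lambda>(d, k). (d * k, d)" "\<lambda>(n, d). (d, n div d)"])
    fix x :: "nat \<times> nat" assume x: "x \<in> (SIGMA n:{1..N}. {d. d dvd n})"
    obtain n d where [simp]: "x = (n, d)" by (cases x)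
    obtain k where n: "n = d * k" using x by auto
    have "d > 0" "k > 0" "d * k \<le> N" using x n by (auto intro!: Nat.gr0I)
    then show "(case case x of (n, d) \<Rightarrow> (d, n div d) of (d, k) \<Rightarrow> (d * k, d)) = x"
      and "(case x of (n, d) \<Rightarrow> (d, n div d)) \<in> (SIGMA d:{1..N}. {1..N div d})"
      and "(case case x of (n, d) \<Rightarrow> (d, n div d) of (d, k) \<Rightarrow> f d k) = (case x of (n, d) \<Rightarrow> f d (n div d))"
      by (auto simp: n less_eq_div_iff_mult_less_eq Suc_le_eq mult.commute intro: order_trans[of d "d * k"])
  next
    fix x :: "nat \<times> nat" assume x: "x \<in> (SIGMA d:{1..N}. {1..N div d})"
    then show "(case case x of (d, k) \<Rightarrow> (d * k, d) of (n, d) \<Rightarrow> (d, n div d)) = x"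
      and "(case x of (d, k) \<Rightarrow> (d * k, d)) \<in> (SIGMA n:{1..N}. {d. d dvd n})"
      by (auto simp: less_eq_div_iff_mult_less_eq Suc_le_eq mult.commute)
  qed
  also have "\<dots> = (\<Sum>d=1..N. \<Sum>k=1..N div d. f d k)"
    by (rule sum.Sigma[symmetric]) auto
  finally show ?thesis .
qed

context real_char begin

lemma divisor_sum_prime_power:
  assumes "prime p" "\<not> p dvd n" "n > 0"
  shows "(\<Sum>d | d dvd p ^ k * n. \<chi> d) = (\<Sum>i\<le>k. \<chi> p ^ i) * (\<Sum>d | d dvd n. \<chi> d)"
proof -
  have cop: "coprime (p ^ i) d" if "d dvd n" for d i
    using assms that by (meson coprime_power_left_iff dvd_trans prime_imp_coprime)
  have "(\<Sum>i\<le>k. \<chi> p ^ i) * (\<Sum>d | d dvd n. \<chi> d) = (\<Sum>x\<in>{..k} \<times> {d. d dvd n}. \<chi> (p ^ fst x * snd x))"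
    by (simp add: sum_product sum.cartesian_product mult power case_prod_unfold)
  also have "\<dots> = (\<Sum>d | d dvd p ^ k * n. \<chi> d)"
  proof (rule sum.reindex_bij_betw[of "\<lambda>x. p ^ fst x * snd x"], unfold bij_betw_def, intro conjI)
    show "inj_on (\<lambda>x. p ^ fst x * snd x) ({..k} \<times> {d. d dvd n})"
    proof (rule inj_onI)
      fix x y assume xy: "x \<in> {..k} \<times> {d. d dvd n}" "y \<in> {..k} \<times> {d. d dvd n}" "p ^ fst x * snd x = p ^ fst y * snd y"
      have nd: "\<not> p dvd snd x" "\<not> p dvd snd y" using xy assms dvd_trans by auto
      then have "multiplicity p (p ^ fst x * snd x) = fst x" "multiplicity p (p ^ fst y * snd y) = fst y"
        using assms by (auto intro!: multiplicity_eqI)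
      then have "fst x = fst y" using xy by simp
      then show "x = y" using xy assms by (auto simp: prod_eq_iff)
    qed
    show "(\<lambda>x. p ^ fst x * snd x) ` ({..k} \<times> {d. d dvd n}) = {d. d dvd p ^ k * n}"
    proof (intro equalityI subsetI)
      fix d assume "d \<in> {d. d dvd p ^ k * n}"
      then obtain a b where ab: "d = a * b" "a dvd p ^ k" "b dvd n" using division_decomp by blast
      then obtain i where "i \<le> k" "a = p ^ i" using assms divides_primepow_nat by blast
      then show "d \<in> (\<lambda>x. p ^ fst x * snd x) ` ({..k} \<times> {d. d dvd n})"
        using ab by (intro image_eqI[of _ _ "(i, b)"]) auto
    qed (auto intro!: mult_dvd_mono le_imp_power_dvd)
  qed
  finally show ?thesis by simp
qed

lemma geometric_nonneg:
  "(\<Sum>i\<le>k. \<chi> p ^ i) \<ge> 0" "even k \<Longrightarrow> (\<Sum>i\<le>k. \<chi> p ^ i) \<ge> 1"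
proof -
  have "\<chi> p = 1 \<or> \<chi> p = -1 \<or> \<chi> p = 0" using coprime_val[of p] not_coprime_val[of p] by blast
  moreover have "(\<Sum>i\<le>k. (-1 :: real) ^ i) = (if even k then 1 else 0)"
    by (induction k) auto
  moreover have "(\<Sum>i\<le>k. (0 :: real) ^ i) = 1" by (induction k) auto
  ultimately show "(\<Sum>i\<le>k. \<chi> p ^ i) \<ge> 0" "even k \<Longrightarrow> (\<Sum>i\<le>k. \<chi> p ^ i) \<ge> 1" by auto
qed

text \<open>The divisor sum of \<chi> is multiplicative. Its factor at a prime power p^k is 1 +
  \<chi>(p) + ... + \<chi>(p)^k, which is never negative and is at least 1 for even k; squares have
  only even exponents. Each induction step splits off one prime with its full power.\<close>

lemma divisor_sum_nonneg:
  "n > 0 \<Longrightarrow> (\<Sum>d | d dvd n. \<chi> d) \<ge> 0 \<and> (\<forall>j. n = j\<^sup>2 \<longrightarrow> (\<Sum>d | d dvd n. \<chi> d) \<ge> 1)"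
proof (induction n rule: less_induct)
  case (less n)
  show ?case
  proof (cases "n = 1")
    case True
    have "(\<Sum>d | d dvd (1 :: nat). \<chi> d) = 1" using one by simp
    with True show ?thesis by (metis order_refl zero_le_one)
  next
    case False
    then obtain p where p: "prime p" "p dvd n" using prime_factor_nat by blast
    define k where "k = multiplicity p n"
    obtain n' where n': "n = p ^ k * n'" "\<not> p dvd n'"
      using multiplicity_decompose'[of n p] less.prems p unfolding k_def by (metis not_prime_unit gr_implies_not0)
    have k: "k > 0" using p less.prems unfolding k_def by (simp add: prime_multiplicity_gt_zero_iff)
    have n'0: "n' > 0" using n' less.prems by (auto intro: Nat.gr0I)
    have "n' < n"
    proof -
      have "p ^ k > 1" using p k prime_gt_1_nat one_less_power by blast
      then show ?thesis using n' n'0 by simp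
    qed
    then have IH: "(\<Sum>d | d dvd n'. \<chi> d) \<ge> 0" "\<And>j. n' = j\<^sup>2 \<Longrightarrow> (\<Sum>d | d dvd n'. \<chi> d) \<ge> 1"
      using less.IH[of n'] n'0 by auto
    have eq: "(\<Sum>d | d dvd n. \<chi> d) = (\<Sum>i\<le>k. \<chi> p ^ i) * (\<Sum>d | d dvd n'. \<chi> d)"
      unfolding n'(1) using divisor_sum_prime_power[OF p(1) n'(2) n'0] .
    have "(\<Sum>d | d dvd n. \<chi> d) \<ge> 1" if j: "n = j\<^sup>2" for j
    proof -
      have j0: "j > 0" using j less.prems by (auto intro: Nat.gr0I)
      define l where "l = multiplicity p j"
      obtain j' where j': "j = p ^ l * j'" "\<not> p dvd j'"
        using multiplicity_decompose'[of j p] j0 p unfolding l_def by (metis not_prime_unit gr_implies_not0)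
      have "k = 2 * l" unfolding k_def l_def j using p j0 by (simp add: prime_elem_multiplicity_power_distrib)
      then have "n' = j'\<^sup>2" using j j' n' p(1) prime_gt_0_nat[OF p(1)]
        by (simp add: power_mult_distrib power_mult[symmetric] mult.commute)
      then have "(\<Sum>d | d dvd n'. \<chi> d) \<ge> 1" using IH by blast
      moreover have "(\<Sum>i\<le>k. \<chi> p ^ i) \<ge> 1" using geometric_nonneg(2) \<open>k = 2 * l\<close> by simp
      ultimately show ?thesis unfolding eq using mult_mono[of 1 _ 1] by fastforce
    qed
    then show ?thesis unfolding eq using IH(1) geometric_nonneg(1) by auto
  qed
qed

end

section \<open>Monsky's decreasing weights and the nonvanishing of the L-value\<close>

lemma geometric_ge:
  fixes y :: real
  assumes "y > 0"
  shows "(\<Sum>i<n. (y\<^sup>2) ^ i) \<ge> n * y ^ (n - 1)"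
proof (induction n rule: less_induct)
  case (less n)
  consider "n = 0" | "n = 1" | k where "n = k + 2"
    by (metis One_nat_def add_2_eq_Suc' not0_implies_Suc)
  then show ?case
  proof cases
    case 3
    \<comment> \<open>The two outer terms contribute at least twice their geometric mean; the inner
      ones are y^2 times a sum of k terms, to which the induction hypothesis applies.\<close>
    have "(\<Sum>i<k + 2. (y\<^sup>2) ^ i) = 1 + y\<^sup>2 * (\<Sum>i<k. (y\<^sup>2) ^ i) + (y\<^sup>2) ^ (k + 1)"
    proof -
      have "(\<Sum>i<Suc k. (y\<^sup>2) ^ i) = 1 + y\<^sup>2 * (\<Sum>i<k. (y\<^sup>2) ^ i)"
        by (subst sum.lessThan_Suc_shift) (simp add: sum_distrib_left)
      then show ?thesis by simp
    qed
    moreover have "y\<^sup>2 * (\<Sum>i<k. (y\<^sup>2) ^ i) \<ge> y\<^sup>2 * (k * y ^ (k - 1))"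
      using less[of k] 3 by (intro mult_left_mono) auto
    moreover have "y\<^sup>2 * (k * y ^ (k - 1)) = k * y ^ (k + 1)"
      by (cases k) (auto simp: power2_eq_square)
    moreover have "1 + (y\<^sup>2) ^ (k + 1) \<ge> 2 * y ^ (k + 1)"
      using sum_squares_bound[of 1 "y ^ (k + 1)"] by (simp add: power2_eq_square power_mult_distrib mult_ac)
    moreover have "n * y ^ (n - 1) = k * y ^ (k + 1) + 2 * y ^ (k + 1)"
      using 3 by (simp add: algebra_simps)
    ultimately have "n * y ^ (n - 1) \<le> (\<Sum>i<k + 2. (y\<^sup>2) ^ i)" by linarith
    then show ?thesis unfolding 3 .
  qed auto
qed

text \<open>For x = y^2 the two sums are at least n y^(n-1) and (n+1) y^n. Their product carries
  y^(2n-1), and the missing factor y is at most 1.\<close>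

lemma geometric_product_ge:
  fixes x :: real
  assumes "0 < x" "x < 1"
  shows "(\<Sum>i<n. x ^ i) * (\<Sum>i<Suc n. x ^ i) \<ge> n * Suc n * x ^ n"
proof -
  define y where "y = sqrt x"
  have y: "y > 0" "y\<^sup>2 = x" "y \<le> 1" using assms by (auto simp: y_def)
  have "x ^ n = y ^ (2 * n)" using y by (simp add: power_mult)
  also have "\<dots> \<le> y ^ ((n - 1) + n)" using y by (intro power_decreasing) auto
  finally have "n * Suc n * x ^ n \<le> n * Suc n * y ^ ((n - 1) + n)" by (intro mult_left_mono) auto
  also have "\<dots> = (n * y ^ (n - 1)) * (Suc n * y ^ (Suc n - 1))" by (simp add: power_add algebra_simps)
  also have "\<dots> \<le> (\<Sum>i<n. x ^ i) * (\<Sum>i<Suc n. x ^ i)"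
    using geometric_ge[OF y(1), of n] geometric_ge[OF y(1), of "Suc n"] y assms
    by (intro mult_mono) (auto intro!: sum_nonneg simp del: sum.lessThan_Suc)
  finally show ?thesis .
qed

text \<open>Summed against \<chi> over all n, the first part yields \<open>L1 / (1 - x)\<close> and
  the second the Lambert series of \<chi>. Neither part has a bound uniform in x, but the difference
  decreases in n and starts with the value 1, so summation by parts gives one.\<close>

definition monsky :: "real \<Rightarrow> nat \<Rightarrow> real" where
  "monsky x n = 1 / (n * (1 - x)) - x ^ n / (1 - x ^ n)"

lemma monsky_geometric:
  assumes "0 < x" "x < 1" "n \<ge> 1"
  shows "monsky x n * (1 - x) = 1 / n - x ^ n / (\<Sum>i<n. x ^ i)"
proof -
  define S where "S = (\<Sum>i<n. x ^ i)"
  have "S > 0" using assms unfolding S_def by (intro sum_pos) (auto simp: lessThan_empty_iff)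
  moreover have geo: "1 - x ^ n = (1 - x) * S" unfolding S_def by (rule one_diff_power_eq)
  ultimately show ?thesis using assms
    unfolding monsky_def S_def[symmetric] geo left_diff_distrib[of _ _ "1 - x"] by simp
qed

lemma monsky_nonneg:
  assumes "0 < x" "x < 1" "n \<ge> 1"
  shows "monsky x n \<ge> 0"
proof -
  have "(\<Sum>i<n. x ^ i) \<ge> (\<Sum>i<n. x ^ n)"
    using assms by (intro sum_mono power_decreasing) auto
  moreover have "(\<Sum>i<n. x ^ i) > 0" using assms by (intro sum_pos) (auto simp: lessThan_empty_iff)
  ultimately have "monsky x n * (1 - x) \<ge> 0"
    using assms by (subst monsky_geometric) (auto simp: field_simps)
  then show ?thesis using assms by (simp add: zero_le_mult_iff)
qed

text \<open>With S_n for the geometric sum of n terms, the decrement times 1 - x equals 1 / (n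
  (n+1)) - x^n / (S_n S_(n+1)), so the claim is exactly \<open>geometric_product_ge\<close>.\<close>

lemma monsky_decreasing:
  assumes "0 < x" "x < 1" "n \<ge> 1"
  shows "monsky x (Suc n) \<le> monsky x n"
proof -
  define S where "S = (\<Sum>i<n. x ^ i)"
  have S: "S > 0" using assms unfolding S_def by (intro sum_pos) (auto simp: lessThan_empty_iff)
  have prod: "S * (S + x ^ n) \<ge> n * Suc n * x ^ n"
    using geometric_product_ge[OF assms(1,2), of n] by (simp add: S_def)
  have geo: "1 - x ^ n = (1 - x) * S" unfolding S_def by (rule one_diff_power_eq)
  have "(monsky x n - monsky x (Suc n)) * (1 - x) = (1 / n - x ^ n / S) - (1 / Suc n - x ^ Suc n / (S + x ^ n))"
    using monsky_geometric[OF assms] monsky_geometric[OF assms(1,2), of "Suc n"]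
    by (simp add: S_def algebra_simps)
  also have "\<dots> = 1 / (n * Suc n) - x ^ n * (S + x ^ n - x * S) / (S * (S + x ^ n))"
  proof -
    have "1 / n - 1 / Suc n = 1 / (n * Suc n)" using assms by (simp add: field_simps)
    moreover have "X / S - x * X / (S + X) = X * (S + X - x * S) / (S * (S + X))" if "X > 0" for X
    proof -
      have "S \<noteq> 0" "S + X \<noteq> 0" using S that by auto
      then show ?thesis by (simp add: field_simps)
    qed
    from this[of "x ^ n"] have "x ^ n / S - x ^ Suc n / (S + x ^ n) = x ^ n * (S + x ^ n - x * S) / (S * (S + x ^ n))"
      using assms by simp
    ultimately show ?thesis by linarith
  qed
  also have "S + x ^ n - x * S = 1" using geo by (simp add: algebra_simps)
  also have "1 / (n * Suc n) - x ^ n * 1 / (S * (S + x ^ n)) \<ge> 0"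
  proof -
    have "S * (S + x ^ n) > 0" using S assms by (simp add: add_pos_pos)
    moreover have "real (n * Suc n) > 0" using assms by (subst of_nat_0_less_iff) simp
    ultimately show ?thesis using prod by (simp add: divide_le_eq le_divide_eq mult.commute)
  qed
  finally show ?thesis using assms by (simp add: zero_le_mult_iff)
qed

context nonprincipal_char begin

lemma monsky_bound:
  assumes "0 < x" "x < 1"
  shows "\<bar>\<Sum>k=1..<n. \<chi> k * monsky x k\<bar> \<le> 2 * real M"
proof (cases "n \<ge> 1")
  case True
  have "monsky x 1 = 1" using assms by (simp add: monsky_def divide_simps)
  moreover have "\<bar>\<Sum>k=1..<n. \<chi> k * monsky x k\<bar> \<le> 2 * real M * monsky x 1"
    by (rule abel_bound_char) (use assms True monsky_decreasing monsky_nonneg in auto)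
  ultimately show ?thesis by simp
qed simp

text \<open>Expanded into geometric series, the right-hand side becomes a power series in x with the
  divisor sums of \<chi> as coefficients, which are nonnegative and at least 1 at squares. Cutting
  the N geometric series at d * k \<le> N costs at most x^N / (1 - x) for each d, which is the
  subtracted term.\<close>

lemma lambert_lower_bound:
  assumes x: "0 < x" "x < 1" and "J\<^sup>2 \<le> N"
  shows "(\<Sum>j=1..J. x ^ j\<^sup>2) - N * x ^ N / (1 - x) \<le> (\<Sum>n=1..N. \<chi> n * (x ^ n / (1 - x ^ n)))"
proof -
  have "(\<Sum>j=1..J. x ^ j\<^sup>2) = (\<Sum>n\<in>(\<lambda>j. j\<^sup>2) ` {1..J}. x ^ n)"
    by (subst sum.reindex) (auto simp: inj_on_def)
  also have "\<dots> \<le> (\<Sum>n\<in>(\<lambda>j. j\<^sup>2) ` {1..J}. (\<Sum>d | d dvd n. \<chi> d) * x ^ n)"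
  proof (rule sum_mono)
    fix n assume "n \<in> (\<lambda>j. j\<^sup>2) ` {1..J}"
    then obtain j where j: "n = j\<^sup>2" "j \<ge> 1" by auto
    then have "n > 0" by simp
    then have "(\<Sum>d | d dvd n. \<chi> d) \<ge> 1" using divisor_sum_nonneg j(1) by blast
    then show "x ^ n \<le> (\<Sum>d | d dvd n. \<chi> d) * x ^ n" using x by simp
  qed
  also have "\<dots> \<le> (\<Sum>n=1..N. (\<Sum>d | d dvd n. \<chi> d) * x ^ n)"
  proof (rule sum_mono2)
    show "(\<lambda>j. j\<^sup>2) ` {1..J} \<subseteq> {1..N}"
    proof
      fix n assume "n \<in> (\<lambda>j. j\<^sup>2) ` {1..J}"
      then obtain j where "n = j\<^sup>2" "j \<ge> 1" "j \<le> J" by auto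
      moreover have "j\<^sup>2 \<le> N" using order_trans[OF power_mono[OF \<open>j \<le> J\<close>, of 2] assms(3)] by simp
      ultimately show "n \<in> {1..N}" by simp
    qed
  qed (use x divisor_sum_nonneg in auto)
  also have "\<dots> = (\<Sum>n=1..N. \<Sum>d | d dvd n. \<chi> d * x ^ (d * (n div d)))"
    by (intro sum.cong refl) (auto simp: sum_distrib_right intro!: sum.cong)
  also have "\<dots> = (\<Sum>d=1..N. \<Sum>k=1..N div d. \<chi> d * x ^ (d * k))"
    by (rule sum_divisors_swap)
  also have "\<dots> \<le> (\<Sum>d=1..N. \<chi> d * (x ^ d / (1 - x ^ d)) + x ^ N / (1 - x))"
  proof (rule sum_mono)
    fix d assume d: "d \<in> {1..N}"
    define y where "y = x ^ d"
    have y: "0 < y" "y < 1" "y \<le> x"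
      using x d power_decreasing[of 1 d x] unfolding y_def by (auto simp: power_less_one_iff)
    define m where "m = N div d"
    have "(\<Sum>k=1..m. y ^ k) * (1 - y) = y - y ^ (m + 1)"
    proof (induction m)
      case (Suc m)
      have "(\<Sum>k=1..Suc m. y ^ k) * (1 - y) = (\<Sum>k=1..m. y ^ k) * (1 - y) + y ^ Suc m * (1 - y)"
        by (simp add: distrib_right)
      also have "\<dots> = y - y ^ (Suc m + 1)" unfolding Suc by (simp add: right_diff_distrib)
      finally show ?case .
    qed simp
    then have "(\<Sum>k=1..m. y ^ k) = y / (1 - y) - y ^ (m + 1) / (1 - y)"
      using y by (simp add: diff_divide_distrib[symmetric] eq_divide_eq)
    moreover have "y ^ (m + 1) \<le> x ^ N"
    proof -
      have "N \<le> d * (m + 1)"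
        using d dividend_less_times_div[of d N] unfolding m_def by simp
      then show ?thesis unfolding y_def power_mult[symmetric] using x by (intro power_decreasing) auto
    qed
    then have "0 \<le> y ^ (m + 1) / (1 - y)" "y ^ (m + 1) / (1 - y) \<le> x ^ N / (1 - x)"
      using y x by (auto intro!: frac_le)
    moreover have "(\<Sum>k=1..m. \<chi> d * x ^ (d * k)) = \<chi> d * (\<Sum>k=1..m. y ^ k)"
      by (simp add: sum_distrib_left y_def power_mult)
    moreover have "\<bar>\<chi> d * (y ^ (m + 1) / (1 - y))\<bar> \<le> x ^ N / (1 - x)"
      using calculation(2,3) abs_le_1[of d] mult_mono[of "\<bar>\<chi> d\<bar>" 1 "y ^ (m + 1) / (1 - y)" "x ^ N / (1 - x)"]
      using y by (simp add: abs_mult)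
    ultimately show "(\<Sum>k=1..N div d. \<chi> d * x ^ (d * k)) \<le> \<chi> d * (x ^ d / (1 - x ^ d)) + x ^ N / (1 - x)"
      unfolding m_def[symmetric] y_def[symmetric] by (simp only: right_diff_distrib)
  qed
  also have "\<dots> = (\<Sum>d=1..N. \<chi> d * (x ^ d / (1 - x ^ d))) + N * x ^ N / (1 - x)"
    by (simp add: sum.distrib)
  finally show ?thesis by simp
qed

text \<open>If the $L$-value vanished, \<open>monsky_bound\<close> would bound the Lambert series
  $\sum \chi(n) x^n / (1 - x^n)$ uniformly in $x < 1$, whereas it dominates $\sum x^{j^2}$.\<close>
lemma L1_nonzero: "L1 \<noteq> 0"
proof
  assume L0: "L1 = 0"
  \<comment> \<open>All \<open>J\<close> terms tend to 1 as x tends to 1, so any \<open>J\<close>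
    beyond \<open>2 * M\<close> contradicts the uniform bound.\<close>
  define J where "J = 2 * M + 2"
  have bound: "(\<Sum>j=1..J. x ^ j\<^sup>2) \<le> 2 * real M" if x: "0 < x" "x < 1" for x :: real
  proof (rule tendsto_le[OF sequentially_bot])
    show "(\<lambda>N. (\<Sum>k=1..<Suc N. \<chi> k / k) / (1 - x) + 2 * real M + (N * x ^ N) / (1 - x)) \<longlonglongrightarrow> 2 * real M"
    proof -
      have "(\<lambda>N. (\<Sum>k=1..<Suc N. \<chi> k / k) / (1 - x) + 2 * real M + (N * x ^ N) / (1 - x))
          \<longlonglongrightarrow> L1 / (1 - x) + 2 * real M + 0 / (1 - x)"
        by (intro tendsto_intros LIMSEQ_Suc[OF L1_lim] powser_times_n_limit_0) (use x in auto)
      then show ?thesis using L0 by simp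
    qed
    show "\<forall>\<^sub>F N in sequentially. (\<Sum>j=1..J. x ^ j\<^sup>2)
        \<le> (\<Sum>k=1..<Suc N. \<chi> k / k) / (1 - x) + 2 * real M + (N * x ^ N) / (1 - x)"
      using eventually_ge_at_top[of "J\<^sup>2"]
    proof eventually_elim
      case (elim N)
      have "(\<Sum>k=1..<Suc N. \<chi> k * monsky x k)
          = (\<Sum>k=1..<Suc N. \<chi> k / k / (1 - x) - \<chi> k * (x ^ k / (1 - x ^ k)))"
        by (intro sum.cong refl) (simp add: monsky_def right_diff_distrib)
      also have "\<dots> = (\<Sum>k=1..<Suc N. \<chi> k / k) / (1 - x) - (\<Sum>k=1..N. \<chi> k * (x ^ k / (1 - x ^ k)))"
        by (simp add: sum_subtractf sum_divide_distrib atLeastLessThanSuc_atLeastAtMost)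
      finally show ?case
        using monsky_bound[OF x, of "Suc N"] lambert_lower_bound[OF x elim] by linarith
    qed
  qed simp
  have "((\<lambda>x :: real. \<Sum>j=1..J. x ^ j\<^sup>2) \<longlongrightarrow> (\<Sum>j=1..J. 1 ^ j\<^sup>2)) (at_left 1)"
    by (intro tendsto_intros)
  moreover have "\<forall>\<^sub>F x :: real in at_left 1. (\<Sum>j=1..J. x ^ j\<^sup>2) \<le> 2 * real M"
    using eventually_at_left_real[OF zero_less_one] by eventually_elim (use bound in auto)
  ultimately have "(\<Sum>j=1..J. (1 :: real) ^ j\<^sup>2) \<le> 2 * real M"
    by (rule tendsto_upperbound) simp
  then show False by (simp add: J_def)
qed

end

section \<open>Sums of the von Mangoldt function\<close>

lemma ln_fact_eq_mangoldt:
  "ln (fact N :: real) = (\<Sum>d=1..N. mangoldt d * real (N div d))"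
proof -
  have "ln (fact N :: real) = (\<Sum>n=1..N. ln n)"
    by (induction N) (auto simp: ln_mult)
  also have "\<dots> = (\<Sum>n=1..N. \<Sum>d | d dvd n. mangoldt d)"
    by (intro sum.cong refl) (auto simp: mangoldt_sum)
  also have "\<dots> = (\<Sum>d=1..N. \<Sum>k=1..N div d. mangoldt d)"
    by (rule sum_divisors_swap)
  finally show ?thesis by (simp add: mult.commute)
qed

text \<open>Chebyshev's argument: floor(2N/d) - 2 floor(N/d) is never negative and is at least 1 for
  N < d \<le> 2N, while the sum weighted by it is the logarithm of the central binomial coefficient,
  which is at most 4^N.\<close>

lemma mangoldt_sum_dyadic: "(\<Sum>d=N+1..2*N. mangoldt d) \<le> N * ln (4 :: real)"
proof -
  have "(\<Sum>d=N+1..2*N. mangoldt d) \<le> (\<Sum>d=N+1..2*N. mangoldt d * (real (2 * N div d) - 2 * real (N div d)))"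
  proof (rule sum_mono)
    fix d assume "d \<in> {N+1..2*N}"
    then have "2 * N div d \<ge> 1" "N div d = 0" by (auto simp: less_eq_div_iff_mult_less_eq)
    then show "mangoldt d \<le> mangoldt d * (real (2 * N div d) - 2 * real (N div d))"
      using mangoldt_nonneg[of d] by (simp add: mult_le_cancel_left1)
  qed
  also have "\<dots> \<le> (\<Sum>d=1..2*N. mangoldt d * (real (2 * N div d) - 2 * real (N div d)))"
  proof (rule sum_mono2)
    fix d :: nat
    have "2 * (N div d) \<le> 2 * N div d" by (cases "d = 0") (auto simp: less_eq_div_iff_mult_less_eq)
    then have "real (2 * (N div d)) \<le> real (2 * N div d)" by (rule of_nat_mono)
    then show "0 \<le> mangoldt d * (real (2 * N div d) - 2 * real (N div d))"
      using mangoldt_nonneg[of d] by simp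
  qed auto
  also have "\<dots> = ln (fact (2 * N)) - 2 * (\<Sum>d=1..2*N. mangoldt d * real (N div d))"
    unfolding ln_fact_eq_mangoldt by (simp add: right_diff_distrib sum_subtractf sum_distrib_left mult_ac)
  also have "(\<Sum>d=1..2*N. mangoldt d * real (N div d)) = (\<Sum>d=1..N. mangoldt d * (real (N div d)))"
    by (rule sum.mono_neutral_right) auto
  also have "\<dots> = ln (fact N)" by (rule ln_fact_eq_mangoldt[symmetric])
  also have "ln (fact (2 * N)) = ln (fact N * fact N * real (2 * N choose N))"
    using binomial_fact_lemma[of N "2 * N"] by (metis (no_types, lifting) add_diff_cancel_right' le_add2 mult_2 of_nat_fact of_nat_mult)
  also have "\<dots> = 2 * ln (fact N) + ln (real (2 * N choose N))"
    by (subst ln_mult) (auto simp: ln_mult)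
  also have "ln (real (2 * N choose N)) \<le> ln (4 ^ N)"
  proof (subst ln_le_cancel_iff)
    have "2 * N choose N \<le> 2 ^ (2 * N)" by (rule binomial_le_pow2)
    then have "real (2 * N choose N) \<le> real (2 ^ (2 * N))" by (rule of_nat_mono)
    then show "real (2 * N choose N) \<le> 4 ^ N" by (simp add: power_mult)
  qed auto
  finally show ?thesis by (simp add: ln_realpow)
qed

lemma chebyshev_upper: "(\<Sum>d=1..N. mangoldt d) \<le> 4 * real N"
proof (induction N rule: less_induct)
  case (less N)
  have ln4: "ln (4 :: real) \<le> 2"
    using ln_realpow[of 2 2] ln_2_less_1 by simp
  show ?case
  proof (cases "N \<le> 1")
    case True
    then consider "N = 0" | "N = 1" by linarith
    then show ?thesis by cases auto
  next
    case False
    \<comment> \<open>Halving rounds up, and the induction closes through 4 j + j ln 4 \<le> 6 j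
      \<le> 4 N; for N = 2 j - 1 the last inequality uses j \<ge> 2.\<close>
    define j where "j = (N + 1) div 2"
    have j: "j < N" "N \<le> 2 * j" "2 * j \<le> N + 1" "j \<ge> 1" "N = 2 * j \<or> j \<ge> 2" using False unfolding j_def by auto
    have "(\<Sum>d=1..N. mangoldt d) \<le> (\<Sum>d=1..2*j. mangoldt d :: real)"
      by (rule sum_mono2) (use j in \<open>auto intro: mangoldt_nonneg\<close>)
    also have "\<dots> = (\<Sum>d=1..j. mangoldt d) + (\<Sum>d=j+1..2*j. mangoldt d)"
      using sum.ub_add_nat[of 1 j mangoldt j] by (simp add: mult_2)
    also have "\<dots> \<le> 4 * real j + j * ln 4" using less[OF j(1)] mangoldt_sum_dyadic[of j] by linarith
    also have "\<dots> \<le> 4 * real N"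
    proof -
      have "real j * ln (4 :: real) \<le> real j * 2" using ln4 by (rule mult_left_mono) simp
      then show ?thesis using j by linarith
    qed
    finally show ?thesis .
  qed
qed

text \<open>Compare ln N! \<ge> N ln N - N with the expansion of ln N! over d, where the integer
  part of N/d is at most N/d.\<close>

lemma mertens_lower:
  assumes "N \<ge> 1"
  shows "ln N - 1 \<le> (\<Sum>d=1..N. mangoldt d / d)"
proof -
  have "N * ln N - N \<le> ln (fact N :: real)"
    using assms
  proof (induction N rule: dec_induct)
    case (step n)
    have "ln (real (Suc n) / n) \<le> real (Suc n) / n - 1"
      by (rule ln_le_minus_one) (use step in auto)
    then have "n * (ln (real (Suc n)) - ln n) \<le> n * (1 / n)"
      using step by (intro mult_left_mono) (auto simp: ln_div field_simps)
    then have "n * ln (real (Suc n)) \<le> n * ln n + 1" using step by (simp add: algebra_simps)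
    moreover have "ln (fact (Suc n) :: real) = ln (real (Suc n)) + ln (fact n)"
      by (simp add: ln_mult)
    ultimately show ?case using step.IH by (simp add: algebra_simps)
  qed simp
  also have "\<dots> \<le> (\<Sum>d=1..N. N * (mangoldt d / d))"
    unfolding ln_fact_eq_mangoldt
  proof (rule sum_mono)
    fix d assume d: "d \<in> {1..N}"
    have "real ((N div d) * d) \<le> real N" by (intro of_nat_mono) simp
    then have "real (N div d) \<le> N / d" using d by (simp add: field_simps)
    then have "mangoldt d * real (N div d) \<le> mangoldt d * (N / d)"
      by (rule mult_left_mono) (rule mangoldt_nonneg)
    then show "mangoldt d * real (N div d) \<le> N * (mangoldt d / d)" by (simp add: mult.commute)
  qed
  also have "\<dots> = N * (\<Sum>d=1..N. mangoldt d / d)" by (simp add: sum_distrib_left)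
  finally have "N * (ln N - 1) \<le> N * (\<Sum>d=1..N. mangoldt d / d)" by (simp add: right_diff_distrib)
  then show ?thesis using assms by simp
qed

lemma mangoldt_nonzeroE:
  assumes "mangoldt n \<noteq> (0 :: real)"
  obtains p k where "prime p" "k > 0" "n = p ^ k"
  using assms by (auto simp: mangoldt_def primepow_def split: if_splits)

text \<open>Only powers of primes dividing \<open>M\<close> contribute, and for each such prime the
  series of ln p / p^k over k \<ge> 1 is at most ln p.\<close>

lemma mangoldt_sum_not_coprime_bounded:
  assumes "M > 0"
  shows "\<exists>C. \<forall>N. (\<Sum>n | n \<in> {1..N} \<and> \<not> coprime n M. mangoldt n / n) \<le> (C :: real)"
proof (intro exI allI)
  fix N :: nat
  define A where "A = prime_factors M \<times> {1..N}"
  have fin: "finite A" unfolding A_def by (intro finite_cartesian_product) auto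
  have "(\<Sum>n | n \<in> {1..N} \<and> \<not> coprime n M. mangoldt n / n)
      = (\<Sum>n | n \<in> {1..N} \<and> \<not> coprime n M \<and> mangoldt n \<noteq> (0 :: real). mangoldt n / real n)"
    by (rule sum.mono_neutral_right) auto
  also have "\<dots> \<le> (\<Sum>n\<in>(\<lambda>(p, k). p ^ k) ` A. mangoldt n / n)"
  proof (rule sum_mono2)
    show "{n \<in> {1..N}. \<not> coprime n M \<and> mangoldt n \<noteq> (0 :: real)} \<subseteq> (\<lambda>(p, k). p ^ k) ` A"
    proof safe
      fix n assume n: "n \<in> {1..N}" "\<not> coprime n M" "mangoldt n \<noteq> (0 :: real)"
      then obtain p k where pk: "prime p" "k > 0" "n = p ^ k" using mangoldt_nonzeroE by blast
      have "p dvd M" using n(2) pk coprime_power_left_iff prime_imp_coprime by blast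
      moreover have "k \<le> N"
      proof -
        have "p ^ k \<le> N" using n(1) pk(3) by simp
        then show ?thesis
          using less_exp[of k] power_mono[OF prime_ge_2_nat[OF pk(1)], of k] by linarith
      qed
      ultimately show "n \<in> (\<lambda>(p, k). p ^ k) ` A"
        unfolding A_def using pk assms by (intro image_eqI[of _ _ "(p, k)"]) (auto simp: prime_factors_dvd)
    qed
  qed (use fin mangoldt_nonneg in auto)
  also have "\<dots> \<le> (\<Sum>x\<in>A. mangoldt (fst x ^ snd x) / (fst x ^ snd x))"
    using sum_image_le[OF fin, of "\<lambda>n. mangoldt n / real n" "\<lambda>(p, k). p ^ k"] mangoldt_nonneg
    by (simp add: case_prod_unfold o_def)
  also have "\<dots> = (\<Sum>p\<in>prime_factors M. \<Sum>k=1..N. mangoldt (p ^ k) / p ^ k)"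
    unfolding A_def by (simp add: sum.cartesian_product case_prod_unfold)
  also have "\<dots> \<le> (\<Sum>p\<in>prime_factors M. ln p)"
  proof (rule sum_mono)
    fix p assume "p \<in> prime_factors M"
    then have p: "prime p" by auto
    then have p2: "p \<ge> 2" by (rule prime_ge_2_nat)
    have "(\<Sum>k=1..N. mangoldt (p ^ k) / p ^ k) \<le> (\<Sum>k=1..N. ln p * (1 / 2) ^ k)"
    proof (rule sum_mono)
      fix k assume "k \<in> {1..N}"
      then have "mangoldt (p ^ k) / p ^ k = ln p / p ^ k" using p by simp
      also have "\<dots> \<le> ln p / 2 ^ k" using p2 by (intro divide_left_mono) (auto intro!: power_mono)
      finally show "mangoldt (p ^ k) / p ^ k \<le> ln p * (1 / 2) ^ k" by (simp add: power_divide)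
    qed
    also have "\<dots> = ln p * (\<Sum>k=1..N. (1 / 2) ^ k)" by (simp add: sum_distrib_left)
    also have "(\<Sum>k=1..N. (1 / 2 :: real) ^ k) = 1 - (1 / 2) ^ N" by (induction N) auto
    also have "ln p * (1 - (1 / 2) ^ N) \<le> ln p"
      using p2 by (simp add: mult_le_cancel_left2)
    finally show "(\<Sum>k=1..N. mangoldt (p ^ k) / p ^ k) \<le> ln p" .
  qed
  finally show "(\<Sum>n | n \<in> {1..N} \<and> \<not> coprime n M. mangoldt n / n) \<le> (\<Sum>p\<in>prime_factors M. ln (real p))" .
qed

text \<open>Real characters are 1 at squares prime to the modulus, so squares carry no information
  and their total weight has to be bounded. With s = sqrt j, the estimate ln(j^2) = 4 ln s \<le> 4 s
  bounds the j-th term by 4 / s^3, which is telescoped against 8 / sqrt(j - 1) - 8 / sqrt j.\<close>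

lemma mangoldt_sum_squares_bounded:
  "(\<Sum>n | n \<in> {1..N} \<and> (\<exists>j. n = j\<^sup>2). mangoldt n / n) \<le> (8 :: real)"
proof -
  have "(\<Sum>n | n \<in> {1..N} \<and> (\<exists>j. n = j\<^sup>2). mangoldt n / n) \<le> (\<Sum>n\<in>(\<lambda>j. j\<^sup>2) ` {1..N}. mangoldt n / real n)"
  proof (rule sum_mono2)
    show "{n \<in> {1..N}. \<exists>j. n = j\<^sup>2} \<subseteq> (\<lambda>j. j\<^sup>2) ` {1..N}"
    proof safe
      fix j assume "j\<^sup>2 \<in> {1..N}"
      moreover have "j \<le> j\<^sup>2" by (simp add: power2_eq_square)
      moreover have "j \<noteq> 0" using calculation(1) by (cases "j = 0") auto
      ultimately show "j\<^sup>2 \<in> (\<lambda>j. j\<^sup>2) ` {1..N}" by (intro imageI) auto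
    qed
  qed (use mangoldt_nonneg in auto)
  also have "\<dots> \<le> (\<Sum>j=1..N. mangoldt (j\<^sup>2) / (real j)\<^sup>2)"
    using sum_image_le[of "{1..N}" "\<lambda>n. mangoldt n / real n" "\<lambda>j. j\<^sup>2"] mangoldt_nonneg by (simp add: o_def)
  also have "\<dots> \<le> (if N = 0 then 0 else 8 - 8 / sqrt N)"
  proof (induction N)
    case (Suc N)
    show ?case
    proof (cases "N = 0")
      case False
      define r s where "r = sqrt N" and "s = sqrt (Suc N)"
      have rs: "0 < r" "r \<le> s" "s\<^sup>2 = r\<^sup>2 + 1" "s\<^sup>2 = Suc N" using False by (auto simp: r_def s_def)
      have s4: "(real (Suc N))\<^sup>2 = s ^ 4" using power_mult[of s 2 2] rs(4) by simp
      have "mangoldt ((Suc N)\<^sup>2) \<le> ln (real ((Suc N)\<^sup>2))" by (rule mangoldt_le) simp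
      also have "real ((Suc N)\<^sup>2) = s ^ 4" using s4 by simp
      also have "ln (s ^ 4) = 4 * ln s" using rs by (simp add: ln_realpow)
      also have "ln s \<le> s" using rs ln_bound[of s] by simp
      finally have "mangoldt ((Suc N)\<^sup>2) / (real (Suc N))\<^sup>2 \<le> 4 * s / s ^ 4"
        unfolding s4 using rs by (simp add: divide_right_mono)
      also have "\<dots> = 4 / s ^ 3" using rs by (simp add: field_simps power4_eq_xxxx power3_eq_cube)
      also have "\<dots> \<le> 8 / r - 8 / s"
      proof -
        have s_pos: "0 < s" and s0: "0 \<le> s" using rs(1,2) by simp_all
        have "(s - r) * (s + r) = 1" using rs by (simp add: algebra_simps power2_eq_square)
        moreover have "(s - r) * (s + r) \<le> (s - r) * (2 * s)" using rs by (intro mult_left_mono) auto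
        ultimately have "1 \<le> 2 * s * (s - r)" by (simp add: mult.commute mult.left_commute)
        moreover have "r * 4 \<le> s * 4" using rs by simp
        ultimately have "(s * 4) * 1 \<le> (s * 4) * (2 * s * (s - r))" using rs by (intro mult_left_mono) auto
        then have "4 * r \<le> 8 * s\<^sup>2 * (s - r)" using \<open>r * 4 \<le> s * 4\<close> by (simp add: power2_eq_square algebra_simps)
        then have "4 * (r * s) \<le> (8 * s - 8 * r) * s ^ 3" using mult_right_mono[of "4 * r" "8 * s\<^sup>2 * (s - r)" s, OF _ s0]
          by (simp add: power2_eq_square power3_eq_cube algebra_simps)
        then have "4 / s ^ 3 \<le> (8 * s - 8 * r) / (r * s)"
          using rs(1) s_pos by (subst frac_le_eq) (auto simp: divide_le_0_iff)
        also have "\<dots> = 8 / r - 8 / s" using rs(1) s_pos by (simp add: diff_divide_distrib)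
        finally show ?thesis .
      qed
      finally have "mangoldt ((Suc N)\<^sup>2) / (real (Suc N))\<^sup>2 \<le> 8 / r - 8 / s" .
      then show ?thesis using Suc False by (simp add: r_def s_def)
    qed simp
  qed simp
  also have "\<dots> \<le> 8" by simp
  finally show ?thesis .
qed

section \<open>Primes with prescribed values of real characters\<close>

text \<open>Since ln n is the divisor sum of \<open>mangoldt\<close>, the bounded sum of \<chi>(n)
  ln n / n becomes a sum over d of \<chi>(d) mangoldt(d) / d times a partial sum of the L-series of
  length N div d. That partial sum is \<open>L1\<close> up to 2 M d / N, and Chebyshev's bound makes
  the total error at most 8 M. Division by \<open>L1\<close> is possible because \<open>L1\<close>
  is nonzero.\<close>

lemma (in nonprincipal_char) mangoldt_sum_bounded:
  "\<exists>C. \<forall>N. \<bar>\<Sum>n=1..N. \<chi> n * (mangoldt n / n)\<bar> \<le> C"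
proof -
  obtain C where C: "\<And>n. \<bar>\<Sum>k=1..<n. \<chi> k * (ln k / k)\<bar> \<le> C" using sum_ln_bounded by blast
  have "\<bar>\<Sum>n=1..N. \<chi> n * (mangoldt n / n)\<bar> \<le> (C + 8 * real M) / \<bar>L1\<bar>" for N
  proof (cases "N = 0")
    case True
    have "C \<ge> 0" using C[of 0] by simp
    then show ?thesis using True by simp
  next
    case False
    define F where "F m = (\<Sum>k=1..<m. \<chi> k / k)" for m :: nat
    define S where "S = (\<Sum>n=1..N. \<chi> n * (mangoldt n / n))"
    have "(\<Sum>k=1..<Suc N. \<chi> k * (ln k / k))
        = (\<Sum>n=1..N. \<Sum>d | d dvd n. \<chi> d * (mangoldt d / d) * (\<chi> (n div d) / real (n div d)))"
      unfolding atLeastLessThanSuc_atLeastAtMost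
    proof (rule sum.cong[OF refl])
      fix n assume n: "n \<in> {1..N}"
      then have "\<chi> n * (ln n / n) = \<chi> n / n * (\<Sum>d | d dvd n. mangoldt d)" by (simp add: mangoldt_sum)
      also have "\<dots> = (\<Sum>d | d dvd n. \<chi> d * (mangoldt d / d) * (\<chi> (n div d) / real (n div d)))"
        unfolding sum_distrib_left
      proof (rule sum.cong[OF refl])
        fix d assume "d \<in> {d. d dvd n}"
        then obtain k where k: "n = d * k" by auto
        then have "d > 0" using n by (auto intro: Nat.gr0I)
        then show "\<chi> n / n * mangoldt d = \<chi> d * (mangoldt d / d) * (\<chi> (n div d) / real (n div d))"
          unfolding k by (simp add: mult)
      qed
      finally show "\<chi> n * (ln n / n) = (\<Sum>d | d dvd n. \<chi> d * (mangoldt d / d) * (\<chi> (n div d) / real (n div d)))" .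
    qed
    also have "\<dots> = (\<Sum>d=1..N. \<Sum>k=1..N div d. \<chi> d * (mangoldt d / d) * (\<chi> k / k))"
      by (rule sum_divisors_swap)
    also have "\<dots> = (\<Sum>d=1..N. \<chi> d * (mangoldt d / d) * F (Suc (N div d)))"
      by (simp add: F_def sum_distrib_left atLeastLessThanSuc_atLeastAtMost)
    finally have eq: "(\<Sum>k=1..<Suc N. \<chi> k * (ln k / k)) = (\<Sum>d=1..N. \<chi> d * (mangoldt d / d) * F (Suc (N div d)))" .
    have "S * L1 - (\<Sum>k=1..<Suc N. \<chi> k * (ln k / k))
        = (\<Sum>d=1..N. \<chi> d * (mangoldt d / d) * (L1 - F (Suc (N div d))))"
      unfolding eq S_def by (simp add: sum_distrib_right sum_subtractf right_diff_distrib)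
    also have "\<bar>\<dots>\<bar> \<le> (\<Sum>d=1..N. \<bar>\<chi> d * (mangoldt d / d) * (L1 - F (Suc (N div d)))\<bar>)"
      by (rule sum_abs)
    also have "\<dots> \<le> (\<Sum>d=1..N. 2 * real M / N * mangoldt d)"
    proof (rule sum_mono)
      fix d assume d: "d \<in> {1..N}"
      have "N \<le> d * Suc (N div d)"
        using d dividend_less_times_div[of d N] by simp
      then have "real N \<le> real d * Suc (N div d)" by (metis of_nat_le_iff of_nat_mult)
      then have "2 * real M * N \<le> 2 * real M * (real d * Suc (N div d))" by (intro mult_left_mono) auto
      then have "2 * real M / Suc (N div d) \<le> 2 * real M * d / N"
        using False by (simp add: field_simps del: of_nat_Suc)
      moreover have "\<bar>L1 - F (Suc (N div d))\<bar> \<le> 2 * real M / Suc (N div d)"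
        unfolding F_def by (rule L1_tail) simp
      ultimately have "\<bar>L1 - F (Suc (N div d))\<bar> \<le> 2 * real M * d / N" by linarith
      then have "\<bar>\<chi> d\<bar> * (mangoldt d / d) * \<bar>L1 - F (Suc (N div d))\<bar> \<le> 1 * (mangoldt d / d) * (2 * real M * d / N)"
        using abs_le_1[of d] mangoldt_nonneg[of d] by (intro mult_mono) auto
      then show "\<bar>\<chi> d * (mangoldt d / d) * (L1 - F (Suc (N div d)))\<bar> \<le> 2 * real M / N * mangoldt d"
        using d by (simp add: abs_mult mult_ac)
    qed
    also have "\<dots> = 2 * real M / N * (\<Sum>d=1..N. mangoldt d)" by (simp add: sum_distrib_left)
    also have "\<dots> \<le> 2 * real M / N * (4 * real N)"
      by (intro mult_left_mono chebyshev_upper) auto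
    also have "\<dots> = 8 * real M" using False by simp
    finally have "\<bar>S * L1\<bar> \<le> C + 8 * real M" using C[of "Suc N"] by linarith
    then show ?thesis unfolding S_def[symmetric] using L1_nonzero by (simp add: abs_mult pos_le_divide_eq)
  qed
  then show ?thesis by blast
qed

lemma principal_mangoldt_sum_lower:
  assumes "M > 0"
  shows "\<exists>C. \<forall>N\<ge>1. ln (real N) - C \<le> (\<Sum>n=1..N. of_bool (coprime n M) * (mangoldt n / n))"
proof -
  obtain C where C: "\<And>N. (\<Sum>n | n \<in> {1..N} \<and> \<not> coprime n M. mangoldt n / n) \<le> (C :: real)"
    using mangoldt_sum_not_coprime_bounded[OF assms] by blast
  have "ln (real N) - (C + 1) \<le> (\<Sum>n=1..N. of_bool (coprime n M) * (mangoldt n / n))" if "N \<ge> 1" for N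
  proof -
    have "(\<Sum>n=1..N. mangoldt n / n) = (\<Sum>n=1..N. of_bool (coprime n M) * (mangoldt n / n))
        + (\<Sum>n=1..N. of_bool (\<not> coprime n M) * (mangoldt n / real n))"
      by (auto simp: sum.distrib[symmetric] of_bool_def intro!: sum.cong)
    also have "(\<Sum>n=1..N. of_bool (\<not> coprime n M) * (mangoldt n / real n)) = (\<Sum>n | n \<in> {1..N} \<and> \<not> coprime n M. mangoldt n / n)"
      by (rule sum.mono_neutral_cong_right) auto
    finally show ?thesis using mertens_lower[OF that] C[of N] by linarith
  qed
  then show ?thesis by blast
qed

lemma real_char_principal:
  assumes "M > 0"
  shows "real_char M (\<lambda>n. of_bool (coprime n M))"
proof -
  have "coprime (k + M) M \<longleftrightarrow> coprime k M" for k by (metis coprime_iff_gcd_eq_1 gcd_add1)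
  then show ?thesis using assms by unfold_locales auto
qed

lemma real_char_mult:
  assumes "real_char M \<chi>" "real_char M \<psi>"
  shows "real_char M (\<lambda>n. \<chi> n * \<psi> n)"
proof -
  interpret c: real_char M \<chi> by fact
  interpret d: real_char M \<psi> by fact
  show ?thesis
  proof
    fix k assume "coprime k M"
    then show "\<chi> k * \<psi> k = 1 \<or> \<chi> k * \<psi> k = -1" using c.coprime_val[of k] d.coprime_val[of k] by auto
  qed (auto simp: c.modulus_pos c.mult d.mult c.period d.period c.not_coprime_val)
qed

lemma real_char_prod:
  assumes "M > 0" "finite S" "\<And>i. i \<in> S \<Longrightarrow> real_char M (\<chi> i)"
  shows "real_char M (\<lambda>n. of_bool (coprime n M) * (\<Prod>i\<in>S. \<chi> i n))"
  using assms(2,3)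
proof (induction S rule: finite_induct)
  case (insert i S)
  have 1: "real_char M (\<chi> i)" by (rule insert.prems) simp
  have 2: "real_char M (\<lambda>n. of_bool (coprime n M) * (\<Prod>i\<in>S. \<chi> i n))"
    by (rule insert.IH, rule insert.prems) simp
  show ?case using real_char_mult[OF 1 2] insert.hyps by (simp add: mult.left_commute)
qed (simp add: real_char_principal assms(1))

text \<open>A one-sided bound spares deciding which products of characters are principal: if -1 is a
  value, the sum is bounded, and otherwise no term is negative.\<close>

lemma real_char_mangoldt_lower:
  assumes "real_char M \<chi>" "coprime a M"
  shows "\<exists>C. \<forall>N. - C \<le> \<chi> a * (\<Sum>n=1..N. \<chi> n * (mangoldt n / n))"
proof (cases "\<exists>b. \<chi> b = -1")
  case True
  then interpret nonprincipal_char M \<chi> by (intro nonprincipal_char.intro nonprincipal_char_axioms.intro assms)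
  obtain C where C: "\<And>N. \<bar>\<Sum>n=1..N. \<chi> n * (mangoldt n / n)\<bar> \<le> C" using mangoldt_sum_bounded by blast
  have "- C \<le> \<chi> a * (\<Sum>n=1..N. \<chi> n * (mangoldt n / n))" for N
    using C[of N] coprime_val[OF assms(2)] by (auto simp: abs_le_iff)
  then show ?thesis by blast
next
  case False
  interpret real_char M \<chi> by fact
  have "\<chi> n \<ge> 0" for n using coprime_val[of n] not_coprime_val[of n] False by fastforce
  then have "0 \<le> \<chi> a * (\<Sum>n=1..N. \<chi> n * (mangoldt n / n))" for N
    by (intro mult_nonneg_nonneg sum_nonneg) (auto simp: mangoldt_nonneg)
  then show ?thesis by (intro exI[of _ 0]) simp
qed

text \<open>The product of the factors 1 + \<chi>_i(a) \<chi>_i(n) vanishes unless no \<chi>_i(n) is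
  opposite to \<chi>_i(a). Expanded over the subsets of \<open>I\<close> it is a sum of real
  characters: the empty subset contributes about ln N to the sum against mangoldt(n) / n, and all
  others are bounded below. If no prime qualified, only squares would survive, with a bounded sum.
  Prescribing values instead of a residue class keeps complex characters out.\<close>

theorem exists_prime_with_real_char_values:
  fixes \<chi> :: "'i \<Rightarrow> nat \<Rightarrow> real"
  assumes M: "M > 0" and fin: "finite I" and char: "\<And>i. i \<in> I \<Longrightarrow> real_char M (\<chi> i)"
    and a: "coprime a M"
  shows "\<exists>p. prime p \<and> coprime p M \<and> (\<forall>i\<in>I. \<chi> i p = \<chi> i a)"
proof (rule ccontr)
  assume no: "\<not> ?thesis"
  define X where "X S n = of_bool (coprime n M) * (\<Prod>i\<in>S. \<chi> i n)" for S n
  have X_char: "real_char M (X S)" if "S \<subseteq> I" for S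
    unfolding X_def using that fin char M by (intro real_char_prod) (auto intro: finite_subset)
  define G where "G n = of_bool (coprime n M) * (\<Prod>i\<in>I. 1 + \<chi> i a * \<chi> i n)" for n
  have G: "G n = (\<Sum>S\<in>Pow I. X S a * X S n)" for n
    unfolding G_def X_def using a prod_add[OF fin, of "\<lambda>i. 1" "\<lambda>i. \<chi> i a * \<chi> i n"]
    by (subst add.commute, subst prod_add[OF fin]) (simp add: sum_distrib_left prod.distrib)
  \<comment> \<open>A prime power that is not a square has an odd exponent, so a real character
    takes there the value it takes at the prime.\<close>
  have G_zero: "G n = 0" if n: "mangoldt n \<noteq> (0 :: real)" "\<nexists>j. n = j\<^sup>2" for n
  proof (cases "coprime n M")
    case True
    obtain p k where pk: "prime p" "k > 0" "n = p ^ k" using mangoldt_nonzeroE[OF n(1)] .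
    have "odd k" using n(2) pk(3) by (metis evenE mult.commute power_mult)
    have cp: "coprime p M" using True pk by simp
    then obtain i where i: "i \<in> I" "\<chi> i p \<noteq> \<chi> i a" using no pk(1) by blast
    interpret real_char M "\<chi> i" using char i(1) .
    have "\<chi> i n = \<chi> i p"
      using pk(3) power[of p k] coprime_val[OF cp] \<open>odd k\<close> by auto
    then have "1 + \<chi> i a * \<chi> i n = 0" using i(2) coprime_val[OF cp] coprime_val[OF a] by auto
    then have "(\<Prod>i\<in>I. 1 + \<chi> i a * \<chi> i n) = 0" using fin i(1) by (intro prod_zero) auto
    then show ?thesis unfolding G_def by simp
  qed (simp add: G_def)
  have G_le: "G n \<le> 2 ^ card I" for n
  proof -
    have "X S a * X S n \<le> 1" if "S \<in> Pow I" for S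
    proof -
      interpret real_char M "X S" using X_char that by blast
      show ?thesis using mult_mono[OF abs_le_1[of a] abs_le_1[of n]] by (simp add: abs_mult[symmetric])
    qed
    then have "G n \<le> (\<Sum>S\<in>Pow I. 1)" unfolding G by (intro sum_mono) auto
    then show ?thesis using fin by (simp add: card_Pow)
  qed
  have upper: "(\<Sum>n=1..N. G n * (mangoldt n / n)) \<le> 2 ^ card I * 8" for N
  proof -
    have "(\<Sum>n=1..N. G n * (mangoldt n / n)) = (\<Sum>n | n \<in> {1..N} \<and> (\<exists>j. n = j\<^sup>2). G n * (mangoldt n / n))"
      by (rule sum.mono_neutral_right) (use G_zero in fastforce)+
    also have "\<dots> \<le> (\<Sum>n | n \<in> {1..N} \<and> (\<exists>j. n = j\<^sup>2). 2 ^ card I * (mangoldt n / n))"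
      by (intro sum_mono mult_right_mono G_le) (simp add: mangoldt_nonneg)
    also have "\<dots> = 2 ^ card I * (\<Sum>n | n \<in> {1..N} \<and> (\<exists>j. n = j\<^sup>2). mangoldt n / n)"
      by (simp add: sum_distrib_left)
    also have "\<dots> \<le> 2 ^ card I * 8" by (intro mult_left_mono mangoldt_sum_squares_bounded) simp
    finally show ?thesis .
  qed
  have "\<forall>S\<in>Pow I. \<exists>C. \<forall>N. - C \<le> X S a * (\<Sum>n=1..N. X S n * (mangoldt n / n))"
    using real_char_mangoldt_lower[OF X_char a] by blast
  then obtain C where C: "\<And>S N. S \<in> Pow I \<Longrightarrow> - C S \<le> X S a * (\<Sum>n=1..N. X S n * (mangoldt n / n))"
    by (metis bchoice)
  obtain C0 where C0: "\<And>N. N \<ge> 1 \<Longrightarrow> ln (real N) - C0 \<le> (\<Sum>n=1..N. of_bool (coprime n M) * (mangoldt n / n))"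
    using principal_mangoldt_sum_lower[OF M] by blast
  have lower: "ln N - C0 - (\<Sum>S\<in>Pow I - {{}}. C S) \<le> 2 ^ card I * 8" if "N \<ge> 1" for N :: nat
  proof -
    have "(\<Sum>n=1..N. G n * (mangoldt n / n)) = (\<Sum>S\<in>Pow I. X S a * (\<Sum>n=1..N. X S n * (mangoldt n / n)))"
      unfolding G sum_distrib_right sum_distrib_left by (subst sum.swap) (simp add: mult.assoc)
    also have "\<dots> = X {} a * (\<Sum>n=1..N. X {} n * (mangoldt n / n))
        + (\<Sum>S\<in>Pow I - {{}}. X S a * (\<Sum>n=1..N. X S n * (mangoldt n / n)))"
      using fin by (intro sum.remove) auto
    finally have "(\<Sum>n=1..N. G n * (mangoldt n / n)) = X {} a * (\<Sum>n=1..N. X {} n * (mangoldt n / n))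
        + (\<Sum>S\<in>Pow I - {{}}. X S a * (\<Sum>n=1..N. X S n * (mangoldt n / n)))" .
    moreover have "X {} a * (\<Sum>n=1..N. X {} n * (mangoldt n / n)) \<ge> ln N - C0"
      unfolding X_def using a C0[OF that] by simp
    moreover have "(\<Sum>S\<in>Pow I - {{}}. X S a * (\<Sum>n=1..N. X S n * (mangoldt n / n))) \<ge> (\<Sum>S\<in>Pow I - {{}}. - C S)"
      by (intro sum_mono C) auto
    ultimately show ?thesis using upper[of N] by (simp add: sum_negf)
  qed
  define B where "B = 2 ^ card I * 8 + C0 + (\<Sum>S\<in>Pow I - {{}}. C S)"
  obtain N :: nat where N: "exp (B + 1) < N" using reals_Archimedean2 by blast
  have "real N > 0" using N exp_gt_zero[of "B + 1"] by linarith
  then have "B + 1 < ln N" using N by (metis exp_less_cancel_iff exp_ln)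
  moreover have "N \<ge> 1" using \<open>real N > 0\<close> by simp
  ultimately show False using lower[of N] unfolding B_def by linarith
qed

section \<open>Legendre symbols\<close>

definition chi4 :: "nat \<Rightarrow> int" where
  "chi4 n = (if n mod 4 = 1 then 1 else if n mod 4 = 3 then -1 else 0)"

definition chi8 :: "nat \<Rightarrow> int" where
  "chi8 n = (if n mod 8 = 1 \<or> n mod 8 = 7 then 1 else if n mod 8 = 3 \<or> n mod 8 = 5 then -1 else 0)"

lemma mod4_cases: "n mod 4 = 0 \<or> n mod 4 = 1 \<or> n mod 4 = 2 \<or> n mod 4 = 3" for n :: nat
  by linarith

lemma mod8_cases: "n mod 8 = 0 \<or> n mod 8 = 1 \<or> n mod 8 = 2 \<or> n mod 8 = 3
    \<or> n mod 8 = 4 \<or> n mod 8 = 5 \<or> n mod 8 = 6 \<or> n mod 8 = 7" for n :: nat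
  by linarith

lemma chi4_mult: "chi4 (k * l) = chi4 k * chi4 l"
  unfolding chi4_def mod_mult_eq[of k 4 l, symmetric]
  using mod4_cases[of k] mod4_cases[of l] by (elim disjE) simp_all

lemma chi8_mult: "chi8 (k * l) = chi8 k * chi8 l"
  unfolding chi8_def mod_mult_eq[of k 8 l, symmetric]
  using mod8_cases[of k] mod8_cases[of l] by (elim disjE) simp_all

lemma coprime_8_iff: "coprime n 8 \<longleftrightarrow> odd (n :: nat)"
  using coprime_power_right_iff[of n 2 3] coprime_right_2_iff_odd[of n] by simp

lemma real_char_chi4: "real_char 8 (\<lambda>n. of_int (chi4 n))"
proof
  fix k :: nat
  have "(k + 8) mod 4 = k mod 4" by presburger
  then show "real_of_int (chi4 (k + 8)) = real_of_int (chi4 k)" by (simp add: chi4_def)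
  show "coprime k 8 \<Longrightarrow> real_of_int (chi4 k) = 1 \<or> real_of_int (chi4 k) = -1"
    unfolding coprime_8_iff chi4_def using mod4_cases[of k] by (auto elim: oddE) presburger+
  show "\<not> coprime k 8 \<Longrightarrow> real_of_int (chi4 k) = 0"
    unfolding coprime_8_iff chi4_def by (simp, presburger)
qed (auto simp: chi4_mult)

lemma real_char_chi8: "real_char 8 (\<lambda>n. of_int (chi8 n))"
proof
  fix k :: nat
  show "real_of_int (chi8 (k + 8)) = real_of_int (chi8 k)" by (simp add: chi8_def)
  show "coprime k 8 \<Longrightarrow> real_of_int (chi8 k) = 1 \<or> real_of_int (chi8 k) = -1"
    unfolding coprime_8_iff chi8_def by (simp, presburger)
  show "\<not> coprime k 8 \<Longrightarrow> real_of_int (chi8 k) = 0"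
    unfolding coprime_8_iff chi8_def by (simp, presburger)
qed (auto simp: chi8_mult)

lemma Legendre_values: "Legendre a p = 0 \<or> Legendre a p = 1 \<or> Legendre a p = -1"
  by (simp add: Legendre_def)

lemma Legendre_cong:
  assumes "[a = b] (mod p)"
  shows "Legendre a p = Legendre b p"
proof -
  have "[a = 0] (mod p) \<longleftrightarrow> [b = 0] (mod p)" using assms by (simp add: cong_def)
  moreover have "QuadRes p a \<longleftrightarrow> QuadRes p b" using assms by (simp add: QuadRes_def cong_def)
  ultimately show ?thesis by (simp add: Legendre_def)
qed

lemma sign_eq_of_cong:
  fixes x y :: int
  assumes "[x = y] (mod p)" "x = 0 \<or> x = 1 \<or> x = -1" "y = 0 \<or> y = 1 \<or> y = -1" "2 < p"
  shows "x = y"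
proof (rule ccontr)
  assume "x \<noteq> y"
  moreover have "p dvd \<bar>x - y\<bar>" using assms(1) by (simp add: cong_iff_dvd_diff)
  ultimately have "p \<le> \<bar>x - y\<bar>" by (intro zdvd_imp_le) auto
  moreover have "\<bar>x - y\<bar> \<le> 2" using assms(2,3) by (elim disjE) simp_all
  ultimately show False using assms(4) by simp
qed

lemma Legendre_mult:
  assumes "prime p" "2 < p"
  shows "Legendre (a * b) (int p) = Legendre a (int p) * Legendre b (int p)"
proof (rule sign_eq_of_cong[of _ _ "int p"])
  have "[Legendre a p * Legendre b p = a ^ ((p - 1) div 2) * b ^ ((p - 1) div 2)] (mod p)"
    by (intro cong_mult euler_criterion assms)
  then show "[Legendre (a * b) p = Legendre a p * Legendre b p] (mod int p)"
    using euler_criterion[OF assms, of "a * b"] by (metis cong_sym cong_trans power_mult_distrib)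
  show "Legendre a p * Legendre b p = 0 \<or> Legendre a p * Legendre b p = 1 \<or> Legendre a p * Legendre b p = -1"
    using Legendre_values[of a p] Legendre_values[of b p] by auto
qed (use assms Legendre_values in auto)

lemma Legendre_one: "prime p \<Longrightarrow> Legendre 1 (int p) = 1"
proof -
  assume "prime p"
  then have "\<not> [1 = 0] (mod int p)"
    by (metis cong_0_iff not_prime_unit of_nat_dvd_iff of_nat_1)
  then show ?thesis unfolding Legendre_def QuadRes_def by (metis cong_refl one_power2)
qed

lemma Legendre_prod:
  assumes "prime p" "2 < p" "finite S"
  shows "Legendre (\<Prod>i\<in>S. f i) (int p) = (\<Prod>i\<in>S. Legendre (f i) (int p))"
  using assms(3) by (induction S rule: finite_induct) (simp_all add: Legendre_mult Legendre_one assms(1,2))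

lemma Legendre_eq_0_iff: "Legendre a p = 0 \<longleftrightarrow> p dvd a"
  by (simp add: Legendre_def cong_0_iff)

lemma QuadRes_of_Legendre: "Legendre a p = 1 \<Longrightarrow> QuadRes p a"
  by (auto simp: Legendre_def split: if_splits)

lemma real_char_Legendre:
  assumes "prime p" "2 < p"
  shows "real_char p (\<lambda>n. of_int (Legendre (int n) (int p)))"
proof
  fix k l :: nat
  have "[int (k + p) = int k] (mod int p)" by (simp add: cong_def)
  then show "real_of_int (Legendre (int (k + p)) (int p)) = real_of_int (Legendre (int k) (int p))"
    using Legendre_cong by presburger
  have "coprime k p \<longleftrightarrow> \<not> p dvd k"
    using assms(1) by (metis coprime_absorb_right coprime_commute not_prime_unit prime_imp_coprime)
  then show "coprime k p \<Longrightarrow> real_of_int (Legendre (int k) (int p)) = 1 \<or> real_of_int (Legendre (int k) (int p)) = -1"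
    and "\<not> coprime k p \<Longrightarrow> real_of_int (Legendre (int k) (int p)) = 0"
    using Legendre_values[of k p] Legendre_eq_0_iff[of k p] by auto
qed (use assms Legendre_mult in auto)

lemma Legendre_minus_one:
  assumes "prime p" "2 < p"
  shows "Legendre (-1) (int p) = chi4 p"
proof (rule sign_eq_of_cong[of _ _ "int p"])
  have "odd p" using assms prime_odd_nat by auto
  have "(-1 :: int) ^ ((p - 1) div 2) = chi4 p"
  proof (cases "p mod 4 = 1")
    case True
    then have "even ((p - 1) div 2)" by presburger
    then show ?thesis using True by (simp add: chi4_def)
  next
    case False
    then have "odd ((p - 1) div 2)" "p mod 4 = 3" using \<open>odd p\<close> by presburger+
    then show ?thesis by (simp add: chi4_def)
  qed
  then show "[Legendre (-1) p = chi4 p] (mod int p)" using euler_criterion[OF assms, of "-1"] by simp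
qed (use assms Legendre_values in \<open>auto simp: chi4_def\<close>)

text \<open>In Gauss's lemma for the multiplier 2 no product exceeds p, so \<open>E\<close> consists
  of the numbers 2x with (p-1)/4 < x \<le> (p-1)/2; the parity of their number depends on p mod
  8.\<close>

lemma Legendre_two:
  assumes "prime p" "2 < p"
  shows "Legendre 2 (int p) = chi8 p"
proof -
  have odd: "odd p" using assms prime_odd_nat by auto
  have "\<not> int p dvd 2" using assms zdvd_imp_le[of "int p" 2] by auto
  then interpret GAUSS p 2 using assms by unfold_locales (auto simp: cong_0_iff)
  have inj: "inj_on (\<lambda>x. 2 * x mod int p) A"
  proof (rule inj_onI)
    fix x y assume "x \<in> A" "y \<in> A" "2 * x mod int p = 2 * y mod int p"
    then show "x = y" unfolding A_def by auto
  qed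
  have "E = (\<lambda>x. 2 * x) ` {(int p - 1) div 4 + 1 .. (int p - 1) div 2}"
  proof (intro equalityI subsetI)
    fix y assume "y \<in> E"
    then obtain x where x: "0 < x" "x \<le> (int p - 1) div 2" "y = 2 * x mod int p" "(int p - 1) div 2 < y"
      unfolding E_def C_def B_def A_def by (auto simp: mult.commute)
    then have "y = 2 * x" by auto
    then show "y \<in> (\<lambda>x. 2 * x) ` {(int p - 1) div 4 + 1 .. (int p - 1) div 2}"
      using x by (intro image_eqI[of _ _ x]) auto
  next
    fix y assume "y \<in> (\<lambda>x. 2 * x) ` {(int p - 1) div 4 + 1 .. (int p - 1) div 2}"
    then obtain x where x: "(int p - 1) div 4 + 1 \<le> x" "x \<le> (int p - 1) div 2" "y = 2 * x" by auto
    then have "x \<in> A" "y = x * 2 mod int p" "(int p - 1) div 2 < y"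
      unfolding A_def using assms by auto
    then show "y \<in> E" unfolding E_def C_def B_def by auto
  qed
  then have "card E = card {(int p - 1) div 4 + 1 .. (int p - 1) div 2}"
    by (simp add: card_image inj_on_def)
  moreover have "(int p - 1) div 4 \<le> (int p - 1) div 2" using assms by auto
  ultimately have card: "int (card E) = (int p - 1) div 2 - (int p - 1) div 4" by simp
  have "(-1 :: int) ^ card E = chi8 p"
  proof -
    define j where "j = p div 8"
    have "p = 8 * j + p mod 8" unfolding j_def by simp
    moreover have "p mod 8 = 1 \<or> p mod 8 = 3 \<or> p mod 8 = 5 \<or> p mod 8 = 7" using odd by presburger
    ultimately consider "p = 8 * j + 1" | "p = 8 * j + 3" | "p = 8 * j + 5" | "p = 8 * j + 7" by metis
    then show ?thesis
    proof cases
      case 1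
      then have "card E = 2 * j" using card by simp
      with 1 show ?thesis by (simp add: chi8_def)
    next
      case 2
      then have "card E = 2 * j + 1" using card by simp
      with 2 show ?thesis by (simp add: chi8_def)
    next
      case 3
      then have "card E = 2 * j + 1" using card by simp
      with 3 show ?thesis by (simp add: chi8_def)
    next
      case 4
      then have "card E = 2 * j + 2" using card by simp
      with 4 show ?thesis by (simp add: chi8_def)
    qed
  qed
  then show ?thesis using gauss_lemma by simp
qed

lemma QuadRes_mult:
  assumes "coprime m n" "QuadRes m c" "QuadRes n c"
  shows "QuadRes (m * n) c"
proof -
  obtain x y where "[x\<^sup>2 = c] (mod m)" "[y\<^sup>2 = c] (mod n)" using assms unfolding QuadRes_def by blast
  moreover obtain z where "[z = x] (mod m)" "[z = y] (mod n)"
    using binary_chinese_remainder_int[OF assms(1)] by blast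
  ultimately have "[z\<^sup>2 = c] (mod m)" "[z\<^sup>2 = c] (mod n)"
    by (meson cong_pow cong_trans)+
  then have "[z\<^sup>2 = c] (mod m * n)" using assms(1) by (rule coprime_cong_mult)
  then show ?thesis unfolding QuadRes_def by blast
qed

lemma QuadRes_two: "QuadRes 2 c"
proof -
  have "[c\<^sup>2 = c] (mod 2)" unfolding cong_def by (metis even_power pos2 odd_iff_mod_2_eq_one even_iff_mod_2_eq_zero)
  then show ?thesis unfolding QuadRes_def by blast
qed

lemma QuadRes_prod_primes:
  assumes "finite P" "\<And>p. p \<in> P \<Longrightarrow> prime p" "\<And>p. p \<in> P \<Longrightarrow> QuadRes (int p) c"
  shows "QuadRes (int (\<Prod>P)) c"
  using assms
proof (induction P rule: finite_induct)
  case empty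
  then show ?case by (auto simp: QuadRes_def)
next
  case (insert p P)
  have "coprime p (\<Prod>P)"
    using insert by (intro prod_coprime_right) (metis insertCI primes_coprime)
  then have "coprime (int p) (int (\<Prod>P))" by (simp only: coprime_int_iff)
  then have "QuadRes (int p * int (\<Prod>P)) c" using insert by (intro QuadRes_mult) auto
  then show ?case using insert by simp
qed

lemma prod_prime_factors_squarefree:
  assumes "squarefree (k :: nat)"
  shows "\<Prod>(prime_factors k) = k"
proof -
  have "k > 0" using assms by (metis gr0I not_squarefree_0)
  then have "(\<Prod>p\<in>prime_factors k. p ^ multiplicity p k) = k" using prime_factorization_nat by metis
  moreover have "multiplicity p k = 1" if "p \<in> prime_factors k" for p
    using assms that \<open>k > 0\<close> squarefree_factorial_semiring'[of k] by auto
  ultimately show ?thesis by simp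
qed

lemma chi4_1: "chi4 (Suc 0) = 1" and chi8_1: "chi8 (Suc 0) = 1"
  by (simp_all add: chi4_def chi8_def)

lemma chi4_prod: "finite S \<Longrightarrow> chi4 (\<Prod>S) = (\<Prod>i\<in>S. chi4 i)"
  by (induction S rule: finite_induct) (simp_all add: chi4_mult chi4_1)

lemma chi8_prod: "finite S \<Longrightarrow> chi8 (\<Prod>S) = (\<Prod>i\<in>S. chi8 i)"
  by (induction S rule: finite_induct) (simp_all add: chi8_mult chi8_1)

text \<open>Multiplication by the principal character brings characters of different moduli to a
  common one.\<close>

lemma real_char_lift:
  assumes "real_char m \<chi>" "m dvd M" "M > 0"
  shows "real_char M (\<lambda>n. of_bool (coprime n M) * \<chi> n)"
proof -
  interpret c: real_char m \<chi> by fact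
  interpret p: real_char M "\<lambda>n. of_bool (coprime n M)" using assms(3) by (rule real_char_principal)
  obtain j where M: "M = j * m" using assms(2) by (metis dvd_def mult.commute)
  show ?thesis
  proof
    fix k
    show "of_bool (coprime (k + M) M) * \<chi> (k + M) = of_bool (coprime k M) * \<chi> k"
    proof -
      have "\<chi> (k + M) = \<chi> k" unfolding M by (rule c.period_mult)
      then show ?thesis by (simp only: p.period)
    qed
    assume "coprime k M"
    then have "coprime k m" unfolding M by simp
    then show "of_bool (coprime k M) * \<chi> k = 1 \<or> of_bool (coprime k M) * \<chi> k = -1"
      using c.coprime_val[of k] \<open>coprime k M\<close> by (simp only: of_bool_eq mult_1)
  next
    fix k l
    show "of_bool (coprime (k * l) M) * \<chi> (k * l)
        = of_bool (coprime k M) * \<chi> k * (of_bool (coprime l M) * \<chi> l)"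
      by (simp only: p.mult c.mult mult_ac)
  qed (use assms(3) in \<open>simp_all only: of_bool_eq mult_zero_left\<close>)
qed

section \<open>Ternary quadratic forms\<close>

text \<open>The Chinese remainder theorem yields a number that is \<open>r\<close> mod 8 and -e mod
  \<open>k\<close>, so the prescribed values are consistent; \<open>e * (k - 1)\<close> is -e mod
  \<open>k\<close> written within the naturals. The labels 4 and 8 stand for \<open>chi4\<close> and
  \<open>chi8\<close> and cannot collide with a prime dividing the odd number \<open>k\<close>. As
  \<open>r\<close> is 1 or 5, these two characters recover it.\<close>

lemma exists_auxiliary_prime:
  fixes k e r :: nat
  assumes k: "odd k" "squarefree k" and e: "e = 1 \<or> e = 2" and r: "r = 1 \<or> r = 5"
  shows "\<exists>p. prime p \<and> p mod 8 = r \<and> coprime p (8 * k) \<and>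
    (\<forall>i\<in>prime_factors k. Legendre (int p) (int i) = Legendre (- int e) (int i))"
proof -
  define M where "M = 8 * k"
  have "k > 0" using k by (auto intro: Nat.gr0I)
  then have M: "M > 0" by (simp add: M_def)
  have "coprime 8 k" using k(1) coprime_8_iff[of k] by (simp add: coprime_commute)
  then obtain a where a: "[a = r] (mod 8)" "[a = e * (k - 1)] (mod k)"
    using binary_chinese_remainder_nat by blast
  have a8: "a mod 8 = r" using a(1) r by (auto simp: cong_def)
  have "odd a" using a8 r by presburger
  have ek: "coprime e k" using e k(1) by auto
  have "coprime (k - 1) k" using coprime_diff_one_left_nat[OF \<open>k > 0\<close>] .
  then have "coprime (e * (k - 1)) k" using ek by simp
  then have "coprime a k" using a(2) cong_imp_coprime cong_sym by blast
  then have aM: "coprime a M" unfolding M_def using coprime_8_iff[of a] \<open>odd a\<close> by simp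
  define \<psi> where "\<psi> i n = (if i = 4 then chi4 n else if i = 8 then chi8 n else Legendre (int n) (int i))" for i n :: nat
  have pf: "prime i" "2 < i" "i dvd k" if "i \<in> prime_factors k" for i
  proof -
    show "prime i" "i dvd k" using that by auto
    then have "odd i" using k(1) dvd_trans by blast
    then show "2 < i" using \<open>prime i\<close> prime_ge_2_nat[of i] by (cases "i = 2") auto
  qed
  have neq: "i \<noteq> 4" "i \<noteq> 8" if "i \<in> prime_factors k" for i
    using pf[OF that] k(1) dvd_trans[of 2 4 k] dvd_trans[of 2 8 k] by auto
  have "\<exists>p. prime p \<and> coprime p M \<and> (\<forall>i\<in>insert 4 (insert 8 (prime_factors k)).
      of_bool (coprime p M) * real_of_int (\<psi> i p) = of_bool (coprime a M) * real_of_int (\<psi> i a))"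
  proof (rule exists_prime_with_real_char_values[OF M _ _ aM])
    fix i assume "i \<in> insert 4 (insert 8 (prime_factors k))"
    then consider "i = 4" | "i = 8" | "i \<in> prime_factors k" by blast
    then show "real_char M (\<lambda>n. of_bool (coprime n M) * real_of_int (\<psi> i n))"
    proof cases
      case 1
      then show ?thesis using real_char_lift[OF real_char_chi4 _ M] by (simp add: \<psi>_def M_def)
    next
      case 2
      then show ?thesis using real_char_lift[OF real_char_chi8 _ M] by (simp add: \<psi>_def M_def)
    next
      case 3
      then show ?thesis using real_char_lift[OF real_char_Legendre[OF pf(1,2)[OF 3]] _ M] pf(3)[OF 3] neq[OF 3]
        by (simp add: \<psi>_def M_def)
    qed
  qed simp
  then obtain p where p: "prime p" "coprime p M"
    and "\<And>i. i \<in> insert 4 (insert 8 (prime_factors k)) \<Longrightarrow>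
      of_bool (coprime p M) * real_of_int (\<psi> i p) = of_bool (coprime a M) * real_of_int (\<psi> i a)" by blast
  then have eq: "\<psi> i p = \<psi> i a" if "i \<in> insert 4 (insert 8 (prime_factors k))" for i
    using that aM by fastforce
  have "chi4 p = chi4 a" "chi8 p = chi8 a" using eq[of 4] eq[of 8] by (simp_all add: \<psi>_def)
  moreover have "a mod 4 = 1" using a8 r by presburger
  ultimately have "chi4 p = 1" "chi8 p = (if r = 1 then 1 else -1)" using a8 r by (auto simp: chi4_def chi8_def)
  then have "p mod 4 = 1" "(p mod 8 = 1 \<or> p mod 8 = 7) = (r = 1)"
    by (auto simp: chi4_def chi8_def split: if_splits)
  then have "p mod 8 = r" using r by presburger
  moreover have "Legendre (int p) (int i) = Legendre (- int e) (int i)" if i: "i \<in> prime_factors k" for i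
  proof -
    have "Legendre (int p) (int i) = Legendre (int a) (int i)" using eq[of i] i neq[OF i] by (simp add: \<psi>_def)
    moreover have "[int a = - int e] (mod int i)"
    proof -
      have "[int a = int (e * (k - 1))] (mod int k)" using a(2) by (simp only: cong_int_iff)
      moreover have "int (e * (k - 1)) = - int e + int e * int k"
        using \<open>k > 0\<close> by (simp add: of_nat_diff algebra_simps)
      moreover have "[- int e + int e * int k = - int e] (mod int k)" by (simp add: cong_iff_dvd_diff)
      ultimately have "[int a = - int e] (mod int k)" by (metis cong_trans)
      moreover have "int i dvd int k" using pf(3)[OF i] by simp
      ultimately show ?thesis by (rule cong_dvd_modulus)
    qed
    ultimately show ?thesis using Legendre_cong by simp
  qed
  ultimately show ?thesis using p unfolding M_def by blast
qed

text \<open>At an odd prime i dividing \<open>n\<close>, the number -e p is a square because p and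
  -e have the same symbol. At p, reciprocity with p = 1 mod 4 turns the symbol of the odd part
  \<open>k\<close> into the product of the symbols of -e, that is \<open>chi4 k\<close> or
  \<open>chi4 k * chi8 k\<close>, and an even \<open>n\<close> adds the factor
  \<open>chi8 p\<close>. Taking \<open>e = 2\<close> repairs the sign for n = 3 mod 8, and
  \<open>r = 5\<close> repairs it for n = 2k with k = 3 mod 4. For n = 7 mod 8 neither value of
  \<open>e\<close> would help.\<close>

lemma local_solvability_data:
  fixes n :: nat
  assumes n: "squarefree n" "n mod 8 = 1 \<or> n mod 8 = 2 \<or> n mod 8 = 3 \<or> n mod 8 = 5 \<or> n mod 8 = 6"
  shows "\<exists>p e. prime p \<and> p mod 4 = 1 \<and> (e = 1 \<or> e = 2) \<and> coprime n (e * p) \<and>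
    QuadRes (int (e * p)) (int n) \<and> QuadRes (int n) (- int (e * p))"
proof -
  define k where "k = (if even n then n div 2 else n)"
  define e :: nat where "e = (if n mod 8 = 3 then 2 else 1)"
  define r :: nat where "r = (if even n \<and> k mod 4 = 3 then 5 else 1)"
  have odd: "odd k" unfolding k_def using n(2) by (auto, presburger+)
  have "k dvd n" unfolding k_def by auto
  then have sq: "squarefree k" using n(1) squarefree_mono by blast
  have e: "e = 1 \<or> e = 2" and r: "r = 1 \<or> r = 5" unfolding e_def r_def by auto
  obtain p where p: "prime p" "p mod 8 = r" "coprime p (8 * k)"
    and leg: "\<And>i. i \<in> prime_factors k \<Longrightarrow> Legendre (int p) (int i) = Legendre (- int e) (int i)"
    using exists_auxiliary_prime[OF odd sq e r] by blast
  have p4: "p mod 4 = 1" using p(2) r by presburger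
  have p2: "2 < p" using p4 prime_ge_2_nat[OF p(1)] by (cases "p = 2") auto
  have "coprime p k" using p(3) by simp
  moreover have "odd p" using p4 by presburger
  ultimately have pk: "coprime p k" "odd p" by simp_all
  have pf: "prime i" "2 < i" "i \<noteq> p" "i dvd k" if "i \<in> prime_factors k" for i
  proof -
    show "prime i" "i dvd k" using that by auto
    then have "odd i" using odd dvd_trans by blast
    then show "2 < i" using \<open>prime i\<close> prime_ge_2_nat[of i] by (cases "i = 2") auto
    show "i \<noteq> p" using pk(1) \<open>i dvd k\<close> p(1) by (metis coprime_absorb_left not_prime_unit)
  qed
  have k_prod: "\<Prod>(prime_factors k) = k" using sq by (rule prod_prime_factors_squarefree)
  have nonzero: "Legendre (int p) (int i) \<noteq> 0" if "i \<in> prime_factors k" for i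
    using pf[OF that] p(1) primes_dvd_imp_eq by (auto simp: Legendre_eq_0_iff)
  have "QuadRes (int i) (- int (e * p))" if i: "i \<in> prime_factors k" for i
  proof (rule QuadRes_of_Legendre)
    have "Legendre (- int (e * p)) (int i) = Legendre (- int e) (int i) * Legendre (int p) (int i)"
      using Legendre_mult[OF pf(1,2)[OF i], of "- int e" "int p"] by simp
    then show "Legendre (- int (e * p)) (int i) = 1"
      using leg[OF i] nonzero[OF i] Legendre_values[of p i] by auto
  qed
  then have "QuadRes (int (\<Prod>(prime_factors k))) (- int (e * p))"
    using pf(1) by (intro QuadRes_prod_primes) auto
  then have "QuadRes (int k) (- int (e * p))" unfolding k_prod .
  moreover have nk: "int n = (if even n then 2 * int k else int k)" unfolding k_def by auto
  ultimately have Q1: "QuadRes (int n) (- int (e * p))"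
    using QuadRes_mult[OF _ QuadRes_two, of "int k"] odd by (auto split: if_splits)
  have leg': "Legendre (int i) (int p) = Legendre (- int e) (int i)" if i: "i \<in> prime_factors k" for i
  proof -
    have "even ((p - 1) div 2)" using p4 by presburger
    then have "Legendre (int i) (int p) * Legendre (int p) (int i) = 1"
      using Quadratic_Reciprocity[OF pf(1,2)[OF i] p(1) p2 pf(3)[OF i]] by simp
    then show ?thesis using leg[OF i] Legendre_values[of p i] by auto
  qed
  have "Legendre (\<Prod>i\<in>prime_factors k. int i) (int p) = (\<Prod>i\<in>prime_factors k. Legendre (int i) (int p))"
    by (rule Legendre_prod[OF p(1) p2]) simp
  also have "\<dots> = (\<Prod>i\<in>prime_factors k. Legendre (- int e) (int i))"
    by (rule prod.cong[OF refl]) (rule leg')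
  finally have "Legendre (\<Prod>i\<in>prime_factors k. int i) (int p) = (\<Prod>i\<in>prime_factors k. Legendre (- int e) (int i))" .
  moreover have "(\<Prod>i\<in>prime_factors k. int i) = int k" using arg_cong[OF k_prod, of int] by simp
  moreover have "(\<Prod>i\<in>prime_factors k. Legendre (- int e) (int i)) = (if e = 1 then chi4 k else chi4 k * chi8 k)"
  proof -
    have 1: "Legendre (-1) (int i) = chi4 i" and 2: "Legendre (-2) (int i) = chi4 i * chi8 i" if "i \<in> prime_factors k" for i
      using Legendre_mult[OF pf(1,2)[OF that], of "-1" 2] Legendre_minus_one[OF pf(1,2)[OF that]]
        Legendre_two[OF pf(1,2)[OF that]] by simp_all
    have "(\<Prod>i\<in>prime_factors k. Legendre (-1) (int i)) = (\<Prod>i\<in>prime_factors k. chi4 i)"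
      by (rule prod.cong[OF refl]) (rule 1)
    then have "(\<Prod>i\<in>prime_factors k. Legendre (-1) (int i)) = chi4 k"
      using chi4_prod[of "prime_factors k"] k_prod by simp
    moreover have "(\<Prod>i\<in>prime_factors k. Legendre (-2) (int i)) = (\<Prod>i\<in>prime_factors k. chi4 i * chi8 i)"
      by (rule prod.cong[OF refl]) (rule 2)
    then have "(\<Prod>i\<in>prime_factors k. Legendre (-2) (int i)) = chi4 k * chi8 k"
      using chi4_prod[of "prime_factors k"] chi8_prod[of "prime_factors k"] k_prod by (simp add: prod.distrib)
    ultimately show ?thesis using e by auto
  qed
  ultimately have Lk: "Legendre (int k) (int p) = (if e = 1 then chi4 k else chi4 k * chi8 k)" by simp
  have "Legendre (int n) (int p) = 1"
  proof (cases "even n")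
    case True
    then have "e = 1" unfolding e_def by (auto, presburger)
    have "Legendre (int n) (int p) = chi8 p * chi4 k"
      using True nk Legendre_mult[OF p(1) p2, of 2 "int k"] Legendre_two[OF p(1) p2] Lk \<open>e = 1\<close> by simp
    moreover have "k mod 4 = 1 \<or> k mod 4 = 3" using odd by presburger
    ultimately show ?thesis using True p(2) unfolding r_def by (auto simp: chi4_def chi8_def)
  next
    case False
    then have kn: "k = n" unfolding k_def by simp
    have "n mod 8 = 3 \<or> n mod 8 = 1 \<or> n mod 8 = 5" using n(2) False by presburger
    then consider "n mod 8 = 3" | "n mod 8 = 1 \<or> n mod 8 = 5" by blast
    then show ?thesis
    proof cases
      case 1
      then have "n mod 4 = 3" by presburger
      then show ?thesis using Lk 1 unfolding kn e_def by (simp add: chi4_def chi8_def)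
    next
      case 2
      then have "n mod 4 = 1" "e = 1" unfolding e_def by (presburger, auto)
      then show ?thesis using Lk unfolding kn by (simp add: chi4_def)
    qed
  qed
  then have "QuadRes (int p) (int n)" by (rule QuadRes_of_Legendre)
  then have Q2: "QuadRes (int (e * p)) (int n)"
    using e pk(2) QuadRes_mult[OF _ QuadRes_two, of "int p"] by auto
  have "coprime n (e * p)"
  proof -
    have "coprime n e"
    proof (cases "n mod 8 = 3")
      case True
      then have "odd n" by presburger
      then show ?thesis using True by (simp add: e_def)
    qed (simp add: e_def)
    moreover have "coprime n p" using nk pk
    proof -
      have "n = k \<or> n = 2 * k" unfolding k_def by auto
      then show ?thesis using pk by (auto simp: coprime_commute)
    qed
    ultimately show ?thesis by simp
  qed
  then show ?thesis using p(1) p4 e Q1 Q2 by blast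
qed

section \<open>Small lattice vectors by the pigeonhole principle\<close>

lemma less_floor_sqrt_square: "x < (floor_sqrt x + 1)\<^sup>2"
  by (metis Suc_eq_plus1 Suc_floor_sqrt_power2_gt)

lemma floor_sqrt_diff_square_le:
  assumes "i \<in> {0..floor_sqrt m}" "j \<in> {0..floor_sqrt m}"
  shows "(int i - int j)\<^sup>2 \<le> int m"
proof -
  have "\<bar>int i - int j\<bar> \<le> int (floor_sqrt m)" using assms by auto
  then have "\<bar>int i - int j\<bar>\<^sup>2 \<le> (int (floor_sqrt m))\<^sup>2" by (intro power_mono) auto
  also have "\<dots> = int ((floor_sqrt m)\<^sup>2)" by simp
  also have "\<dots> \<le> int m" by (intro of_nat_mono) simp
  finally show ?thesis by simp
qed

lemma thue:
  fixes q :: nat and r :: int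
  assumes "q > 0"
  shows "\<exists>w z :: int. (w, z) \<noteq> (0, 0) \<and> w\<^sup>2 \<le> int q \<and> z\<^sup>2 \<le> int q \<and> [z = r * w] (mod int q)"
proof -
  define a where "a = floor_sqrt q"
  define S where "S = {0..a} \<times> {0..a}"
  define f where "f = (\<lambda>(w, z). (int z - r * int w) mod int q)"
  have "card S = (a + 1)\<^sup>2" unfolding S_def by (simp add: power2_eq_square)
  moreover have "q < (a + 1)\<^sup>2" unfolding a_def by (rule less_floor_sqrt_square)
  moreover have "f ` S \<subseteq> {0..<int q}" using assms unfolding f_def by auto
  then have "card (f ` S) \<le> card {0..<int q}" by (intro card_mono) auto
  ultimately have "card (f ` S) < card S" by simp
  then have "\<not> inj_on f S" by (rule pigeonhole)
  then obtain x y where xy: "x \<in> S" "y \<in> S" "x \<noteq> y" "f x = f y" unfolding inj_on_def by blast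
  obtain w z w' z' where x: "x = (w, z)" and y: "y = (w', z')" by (metis prod.exhaust)
  have "[int z - r * int w = int z' - r * int w'] (mod int q)"
    using xy(4) unfolding x y f_def by (auto simp: cong_def)
  then have "[int z - int z' = r * (int w - int w')] (mod int q)"
    by (auto simp: cong_iff_dvd_diff algebra_simps)
  moreover have "(int w - int w', int z - int z') \<noteq> (0, 0)" using xy(3) unfolding x y by auto
  moreover have "(int w - int w')\<^sup>2 \<le> int q" "(int z - int z')\<^sup>2 \<le> int q"
    using xy(1,2) unfolding x y S_def a_def by (auto intro!: floor_sqrt_diff_square_le)
  ultimately show ?thesis by blast
qed

text \<open>The congruences cut out a lattice of index at most n q, and the box with sides sqrt q,
  sqrt (n q) and sqrt n has volume exactly n q. The number of integral points is larger, since each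
  side contributes its floor plus 1.\<close>

lemma small_lattice_vector:
  fixes n q :: nat and r s :: int
  assumes "n > 0" "q > 0"
  shows "\<exists>w z v :: int. (w, z, v) \<noteq> (0, 0, 0) \<and> w\<^sup>2 \<le> int q \<and> z\<^sup>2 \<le> int (n * q) \<and> v\<^sup>2 \<le> int n \<and>
    [z = r * w] (mod int q) \<and> [z = s * v] (mod int n)"
proof -
  define a b c where "a = floor_sqrt q" and "b = floor_sqrt (n * q)" and "c = floor_sqrt n"
  define S where "S = {0..a} \<times> {0..b} \<times> {0..c}"
  define f where "f = (\<lambda>(w, z, v). ((int z - r * int w) mod int q, (int z - s * int v) mod int n))"
  have sq: "x < (floor_sqrt x + 1)\<^sup>2" for x by (rule less_floor_sqrt_square)
  have "(n * q)\<^sup>2 = q * (n * q) * n" by (simp add: power2_eq_square)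
  also have "\<dots> < (a + 1)\<^sup>2 * (b + 1)\<^sup>2 * (c + 1)\<^sup>2"
    using assms sq[of q] sq[of "n * q"] sq[of n] unfolding a_def b_def c_def
    by (intro mult_strict_mono) auto
  also have "\<dots> = ((a + 1) * (b + 1) * (c + 1))\<^sup>2" by (simp only: power_mult_distrib)
  finally have "n * q < (a + 1) * (b + 1) * (c + 1)" by (rule power_less_imp_less_base) simp
  moreover have "card S = (a + 1) * (b + 1) * (c + 1)" unfolding S_def by (simp add: algebra_simps)
  moreover have "card ({0..<int q} \<times> {0..<int n}) = q * n" by simp
  moreover have "f ` S \<subseteq> {0..<int q} \<times> {0..<int n}" using assms unfolding f_def by auto
  then have "card (f ` S) \<le> card ({0..<int q} \<times> {0..<int n})" by (intro card_mono) auto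
  ultimately have "card (f ` S) < card S" by (simp add: mult.commute)
  then have "\<not> inj_on f S" by (rule pigeonhole)
  then obtain x y where xy: "x \<in> S" "y \<in> S" "x \<noteq> y" "f x = f y" unfolding inj_on_def by blast
  obtain w z v w' z' v' where x: "x = (w, z, v)" and y: "y = (w', z', v')" by (metis prod_cases3)
  have "[int z - r * int w = int z' - r * int w'] (mod int q)" "[int z - s * int v = int z' - s * int v'] (mod int n)"
    using xy(4) unfolding x y f_def by (auto simp: cong_def)
  then have "[int z - int z' = r * (int w - int w')] (mod int q)" "[int z - int z' = s * (int v - int v')] (mod int n)"
    by (auto simp: cong_iff_dvd_diff algebra_simps)
  moreover have "(int w - int w', int z - int z', int v - int v') \<noteq> (0, 0, 0)" using xy(3) unfolding x y by auto
  moreover have "(int w - int w')\<^sup>2 \<le> int q" "(int z - int z')\<^sup>2 \<le> int (n * q)" "(int v - int v')\<^sup>2 \<le> int n"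
    using xy(1,2) unfolding x y S_def a_def b_def c_def by (auto intro!: floor_sqrt_diff_square_le simp del: of_nat_mult)
  ultimately show ?thesis by blast
qed

text \<open>On the lattice, V = n w^2 - z^2 - q v^2 is a multiple of n q, and since neither q nor n
  q is a square, it lies strictly between -2 n q and n q. Thus V is 0, which is the claim, or -n q;
  then z^2 + q v^2 = n (w^2 + q), and multiplying by w^2 + q and composing the two forms x^2 + q y^2
  gives a solution.\<close>

lemma ternary_form_isotropic:
  fixes n q :: nat
  assumes "n > 0" "q > 0" "coprime n q" "QuadRes (int q) (int n)" "QuadRes (int n) (- int q)"
    and q: "\<And>w :: int. w\<^sup>2 \<noteq> int q" and nq: "\<And>z :: int. z\<^sup>2 \<noteq> int (n * q)"
  shows "\<exists>w z v :: int. w \<noteq> 0 \<and> int n * w\<^sup>2 = z\<^sup>2 + int q * v\<^sup>2"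
proof -
  obtain r s where r: "[r\<^sup>2 = int n] (mod int q)" and s: "[s\<^sup>2 = - int q] (mod int n)"
    using assms(4,5) unfolding QuadRes_def by blast
  obtain w z v where nz: "(w, z, v) \<noteq> (0, 0, 0)" and wb: "w\<^sup>2 \<le> int q" and zb: "z\<^sup>2 \<le> int (n * q)" and vb: "v\<^sup>2 \<le> int n"
    and zw: "[z = r * w] (mod int q)" and zv: "[z = s * v] (mod int n)"
    using small_lattice_vector[OF assms(1,2), of r s] by blast
  define V where "V = int n * w\<^sup>2 - z\<^sup>2 - int q * v\<^sup>2"
  have "[z\<^sup>2 = int n * w\<^sup>2] (mod int q)"
    using cong_trans[OF cong_pow[OF zw, of 2]] cong_scalar_right[OF r, of "w\<^sup>2"] by (simp add: power_mult_distrib)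
  then have "int q dvd int n * w\<^sup>2 - z\<^sup>2" by (metis cong_iff_dvd_diff cong_sym)
  then have "int q dvd V" unfolding V_def by simp
  have "[z\<^sup>2 = - int q * v\<^sup>2] (mod int n)"
    using cong_trans[OF cong_pow[OF zv, of 2]] cong_scalar_right[OF s, of "v\<^sup>2"] by (simp add: power_mult_distrib)
  then have "int n dvd z\<^sup>2 - (- int q * v\<^sup>2)" by (simp only: cong_iff_dvd_diff)
  then have "int n dvd z\<^sup>2 + int q * v\<^sup>2" by simp
  then have "int n dvd int n * w\<^sup>2 - (z\<^sup>2 + int q * v\<^sup>2)" by (intro dvd_diff) simp_all
  then have "int n dvd V" unfolding V_def by (simp add: algebra_simps)
  have "coprime (int n) (int q)" using assms(3) by simp
  with \<open>int n dvd V\<close> \<open>int q dvd V\<close> have "int n * int q dvd V" by (rule divides_mult)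
  then obtain j where j: "V = int n * int q * j" by blast
  have nonneg: "0 \<le> z\<^sup>2" "0 \<le> int q * v\<^sup>2" "0 \<le> int n * w\<^sup>2" by simp_all
  have "w\<^sup>2 < int q" using wb q[of w] by linarith
  then have "int n * w\<^sup>2 < int n * int q" using assms(1) by simp
  then have "V < int n * int q * 1" unfolding V_def using nonneg by linarith
  then have "j < 1" unfolding j using assms(1,2) by (subst (asm) mult_less_cancel_left_pos) auto
  have "z\<^sup>2 < int n * int q" using zb nq[of z] unfolding of_nat_mult by linarith
  moreover have "int q * v\<^sup>2 \<le> int n * int q" using mult_left_mono[OF vb, of "int q"] by (simp add: mult.commute)
  ultimately have "V > int n * int q * (-2)" unfolding V_def using nonneg by linarith
  then have "j > -2" unfolding j using assms(1,2) by (subst (asm) mult_less_cancel_left_pos) auto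
  then consider "j = 0" | "j = -1" using \<open>j < 1\<close> by linarith
  then show ?thesis
  proof cases
    case 1
    then have eq: "int n * w\<^sup>2 = z\<^sup>2 + int q * v\<^sup>2" using j unfolding V_def by simp
    have "w \<noteq> 0"
    proof
      assume "w = 0"
      then have "z\<^sup>2 + int q * v\<^sup>2 = 0" using eq by simp
      then have "z\<^sup>2 = 0" "int q * v\<^sup>2 = 0" using nonneg by linarith+
      then have "z = 0 \<and> v = 0" using assms(2) by simp
      then show False using nz \<open>w = 0\<close> by simp
    qed
    then show ?thesis using eq by blast
  next
    case 2
    then have eq: "z\<^sup>2 + int q * v\<^sup>2 = int n * (w\<^sup>2 + int q)" using j unfolding V_def by (simp add: algebra_simps)
    have "int n * (w\<^sup>2 + int q)\<^sup>2 = (z\<^sup>2 + int q * v\<^sup>2) * (w\<^sup>2 + int q)" unfolding eq by (simp add: power2_eq_square)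
    also have "\<dots> = (z * w + int q * v)\<^sup>2 + int q * (z - v * w)\<^sup>2" by (simp add: power2_eq_square algebra_simps)
    finally have "int n * (w\<^sup>2 + int q)\<^sup>2 = (z * w + int q * v)\<^sup>2 + int q * (z - v * w)\<^sup>2" .
    moreover have "w\<^sup>2 + int q \<noteq> 0" using assms(2) zero_le_power2[of w] by linarith
    ultimately show ?thesis by blast
  qed
qed

section \<open>Sums of three squares\<close>

lemma prime_sum_two_squares:
  fixes p :: nat
  assumes p: "prime p" "p mod 4 = 1"
  shows "\<exists>c d :: int. int p = c\<^sup>2 + d\<^sup>2"
proof -
  have p2: "2 < p" using p prime_ge_2_nat[OF p(1)] by (cases "p = 2") auto
  have "QuadRes (int p) (-1)"
    by (rule QuadRes_of_Legendre) (simp add: Legendre_minus_one[OF p(1) p2] chi4_def p(2))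
  then obtain r where r: "[r\<^sup>2 = -1] (mod int p)" unfolding QuadRes_def by blast
  obtain w z where nz: "(w, z) \<noteq> (0, 0)" and wb: "w\<^sup>2 \<le> int p" and zb: "z\<^sup>2 \<le> int p"
    and zw: "[z = r * w] (mod int p)"
    using thue[of p r] p2 by auto
  have nonsquare: "u\<^sup>2 \<noteq> int p" for u
  proof
    assume u: "u\<^sup>2 = int p"
    have "prime (u\<^sup>2)" unfolding u using p(1) by simp
    then show False by (simp add: prime_power_iff)
  qed
  have "[z\<^sup>2 = - (w\<^sup>2)] (mod int p)"
    using cong_trans[OF cong_pow[OF zw, of 2]] cong_scalar_right[OF r, of "w\<^sup>2"] by (simp add: power_mult_distrib)
  then have "int p dvd w\<^sup>2 + z\<^sup>2" by (simp add: cong_iff_dvd_diff add.commute)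
  then obtain j where j: "w\<^sup>2 + z\<^sup>2 = int p * j" by blast
  have "w\<^sup>2 < int p" using wb nonsquare[of w] by linarith
  moreover have "z\<^sup>2 < int p" using zb nonsquare[of z] by linarith
  ultimately have "int p * j < int p * 2" using j by linarith
  then have "j < 2" using p2 by simp
  have "w\<^sup>2 + z\<^sup>2 > 0" using nz by (auto simp: sum_power2_gt_zero_iff)
  then have "j > 0" using j p2 by (simp add: zero_less_mult_iff)
  then have "j = 1" using \<open>j < 2\<close> by simp
  then show ?thesis using j by (metis mult_1_right)
qed

text \<open>The descent step reflects the rational point \<open>(x, y, z) / t\<close> in the nearest integral point.\<close>
lemma davenport_cassels:
  fixes n :: int
  assumes "t > 0" "n * (int t)\<^sup>2 = x\<^sup>2 + y\<^sup>2 + z\<^sup>2"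
  shows "\<exists>a b c :: int. n = a\<^sup>2 + b\<^sup>2 + c\<^sup>2"
  using assms
proof (induction t arbitrary: x y z rule: less_induct)
  case (less t)
  define T where "T = int t"
  have T: "T > 0" using less.prems(1) unfolding T_def by simp
  have near: "\<exists>k. \<bar>2 * (u - T * k)\<bar> \<le> T" for u
  proof
    define k where "k = (2 * u + T) div (2 * T)"
    have "2 * u + T = 2 * T * k + (2 * u + T) mod (2 * T)" unfolding k_def by simp
    moreover have "0 \<le> (2 * u + T) mod (2 * T)" "(2 * u + T) mod (2 * T) < 2 * T" using T by simp_all
    ultimately show "\<bar>2 * (u - T * k)\<bar> \<le> T" by (simp add: algebra_simps abs_le_iff)
  qed
  obtain k l m where klm: "\<bar>2 * (x - T * k)\<bar> \<le> T" "\<bar>2 * (y - T * l)\<bar> \<le> T" "\<bar>2 * (z - T * m)\<bar> \<le> T"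
    using near by metis
  define R where "R = (x - T * k)\<^sup>2 + (y - T * l)\<^sup>2 + (z - T * m)\<^sup>2"
  have eq: "n * T\<^sup>2 = x\<^sup>2 + y\<^sup>2 + z\<^sup>2" using less.prems(2) unfolding T_def .
  show ?case
  proof (cases "R = 0")
    case True
    then have "x = T * k" "y = T * l" "z = T * m"
      unfolding R_def by (smt (verit) power2_less_eq_zero_iff zero_le_power2 zero_eq_power2)+
    then have "T\<^sup>2 * n = T\<^sup>2 * (k\<^sup>2 + l\<^sup>2 + m\<^sup>2)" using eq by (simp add: power_mult_distrib algebra_simps)
    then have "n = k\<^sup>2 + l\<^sup>2 + m\<^sup>2" using T by simp
    then show ?thesis by blast
  next
    case False
    \<comment> \<open>The line through (x, y, z) / T and the lattice point (k, l, m) meets the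
      sphere of squared radius n a second time in the point (a x + b k, a y + b l, a z + b m) /
      t'.\<close>
    define a where "a = k\<^sup>2 + l\<^sup>2 + m\<^sup>2 - n"
    define b where "b = 2 * (n * T - (x * k + y * l + z * m))"
    define t' where "t' = a * T + b"
    have Tt': "T * t' = R"
    proof -
      have "T * t' = (n * T\<^sup>2) + T\<^sup>2 * (k\<^sup>2 + l\<^sup>2 + m\<^sup>2) - 2 * T * (x * k + y * l + z * m)"
        unfolding t'_def a_def b_def by (simp add: power2_eq_square algebra_simps)
      then show ?thesis unfolding eq R_def by (simp add: power2_eq_square algebra_simps)
    qed
    have "R > 0" using False unfolding R_def by (smt (verit) zero_le_power2)
    then have "t' > 0" using Tt' T by (metis zero_less_mult_pos)
    have sqb: "4 * u\<^sup>2 \<le> T\<^sup>2" if "\<bar>2 * u\<bar> \<le> T" for u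
      using power_mono[OF that, of 2] by (simp add: power_mult_distrib)
    \<comment> \<open>Three coordinates of size at most T / 2 give R \<le> (3/4) T^2, so the new
      denominator t' = R / T is smaller than T.\<close>
    have "4 * R \<le> 3 * T\<^sup>2" unfolding R_def using sqb[OF klm(1)] sqb[OF klm(2)] sqb[OF klm(3)] by simp
    then have "T * (4 * t') \<le> T * (3 * T)" using Tt' by (simp add: power2_eq_square)
    then have "4 * t' \<le> 3 * T" using T by simp
    then have "t' < T" using T by simp
    have "n * t'\<^sup>2 = (a * x + b * k)\<^sup>2 + (a * y + b * l)\<^sup>2 + (a * z + b * m)\<^sup>2"
    proof -
      have "(a * x + b * k)\<^sup>2 + (a * y + b * l)\<^sup>2 + (a * z + b * m)\<^sup>2
          = a\<^sup>2 * (x\<^sup>2 + y\<^sup>2 + z\<^sup>2) + 2 * a * b * (x * k + y * l + z * m) + b\<^sup>2 * (k\<^sup>2 + l\<^sup>2 + m\<^sup>2)"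
        by (simp add: power2_eq_square algebra_simps)
      also have "\<dots> = a\<^sup>2 * (n * T\<^sup>2) + a * b * (2 * n * T - b) + b\<^sup>2 * (a + n)"
        unfolding eq by (simp add: a_def b_def algebra_simps)
      also have "\<dots> = n * t'\<^sup>2" unfolding t'_def by (simp add: power2_eq_square algebra_simps)
      finally show ?thesis by simp
    qed
    then have "n * (int (nat t'))\<^sup>2 = (a * x + b * k)\<^sup>2 + (a * y + b * l)\<^sup>2 + (a * z + b * m)\<^sup>2"
      using \<open>t' > 0\<close> by simp
    moreover have "nat t' < t" "nat t' > 0" using \<open>t' < T\<close> \<open>t' > 0\<close> unfolding T_def by simp_all
    ultimately show ?thesis using less.IH by blast
  qed
qed

text \<open>The number q = e p is a sum of two squares, as p = 1 mod 4 and 2 = 1 + 1, so n w^2 = z^2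
  + q v^2 writes \<open>n\<close> as a sum of three rational squares and the descent applies.
  Neither q nor n q is a square because p divides each exactly once.\<close>

lemma squarefree_sum_three_squares:
  fixes n :: nat
  assumes n: "squarefree n" "n mod 8 = 1 \<or> n mod 8 = 2 \<or> n mod 8 = 3 \<or> n mod 8 = 5 \<or> n mod 8 = 6"
  shows "\<exists>a b c :: int. int n = a\<^sup>2 + b\<^sup>2 + c\<^sup>2"
proof -
  obtain p e where p: "prime p" "p mod 4 = 1" and e: "e = 1 \<or> e = 2" and cop: "coprime n (e * p)"
    and Q: "QuadRes (int (e * p)) (int n)" "QuadRes (int n) (- int (e * p))"
    using local_solvability_data[OF n] by blast
  have p2: "2 < p" using p prime_ge_2_nat[OF p(1)] by (cases "p = 2") auto
  have n0: "n > 0" using n(2) by (auto intro: Nat.gr0I)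
  have np: "\<not> p dvd n" using cop p(1) by (metis coprime_common_divisor_nat coprime_mult_right_iff dvd_refl not_prime_1)
  have pe: "\<not> p dvd e" using e p2 by (auto dest: dvd_imp_le)
  have nonsquare: "w\<^sup>2 \<noteq> int (m * p)" if "\<not> p dvd m" for w :: int and m
  proof
    assume w: "w\<^sup>2 = int (m * p)"
    have pi: "prime (int p)" using p(1) by simp
    have "int p dvd w\<^sup>2" unfolding w by simp
    then have "int p dvd w" using pi prime_dvd_power by blast
    then have "(int p)\<^sup>2 dvd int (m * p)" unfolding w[symmetric] by simp
    then have "int p * int p dvd int m * int p" by (simp add: power2_eq_square)
    then have "int p dvd int m" using p2 by simp
    then show False using that by simp
  qed
  have "\<not> p dvd n * e" using np pe p(1) prime_dvd_mult_iff by blast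
  obtain w z v :: int where wzv: "w \<noteq> 0" "int n * w\<^sup>2 = z\<^sup>2 + int (e * p) * v\<^sup>2"
    using ternary_form_isotropic[OF n0 _ cop Q] nonsquare[OF pe] nonsquare[OF \<open>\<not> p dvd n * e\<close>] e p2
    by (metis mult.assoc mult_pos_pos gr0I not_less_zero zero_neq_one zero_neq_numeral)
  obtain c0 d0 where cd0: "int p = c0\<^sup>2 + d0\<^sup>2" using prime_sum_two_squares[OF p] by blast
  have "\<exists>c d. int (e * p) = c\<^sup>2 + d\<^sup>2"
  proof (cases "e = 1")
    case True
    then show ?thesis using cd0 by auto
  next
    case False
    then have "int (e * p) = (c0 + d0)\<^sup>2 + (c0 - d0)\<^sup>2" using e cd0 by (simp add: power2_eq_square algebra_simps)
    then show ?thesis by blast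
  qed
  then obtain c d where cd: "int (e * p) = c\<^sup>2 + d\<^sup>2" by blast
  have "int n * (int (nat \<bar>w\<bar>))\<^sup>2 = z\<^sup>2 + (c * v)\<^sup>2 + (d * v)\<^sup>2"
    using wzv(2) unfolding cd by (simp add: power_mult_distrib algebra_simps)
  then show ?thesis using davenport_cassels[of "nat \<bar>w\<bar>" "int n"] wzv(1) by simp
qed

theorem sum_three_squares:
  fixes n :: nat
  assumes n: "n mod 8 = 1 \<or> n mod 8 = 2 \<or> n mod 8 = 3 \<or> n mod 8 = 5 \<or> n mod 8 = 6"
  shows "\<exists>a b c :: int. int n = a\<^sup>2 + b\<^sup>2 + c\<^sup>2"
proof -
  define m s where "m = squarefree_part n" and "s = square_part n"
  have nms: "n = m * s\<^sup>2" unfolding m_def s_def by (rule squarefree_decompose)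
  have "odd s"
  proof
    assume "even s"
    then obtain j where "s = 2 * j" by blast
    then have "n = 4 * (m * j\<^sup>2)" using nms by (simp add: power_mult_distrib)
    then show False using n by presburger
  qed
  then have "s\<^sup>2 mod 8 = 1"
  proof -
    have "(s mod 8)\<^sup>2 mod 8 = 1"
      using mod8_cases[of s] \<open>odd s\<close> by (elim disjE) (presburger | simp)+
    then show ?thesis by (simp add: power_mod)
  qed
  then have "n mod 8 = m mod 8" using nms mod_mult_right_eq[of m "s\<^sup>2" 8] by simp
  then obtain a b c :: int where "int m = a\<^sup>2 + b\<^sup>2 + c\<^sup>2"
    using squarefree_sum_three_squares[of m] n unfolding m_def by auto
  then have "int n = (a * s)\<^sup>2 + (b * s)\<^sup>2 + (c * s)\<^sup>2"
    unfolding nms by (simp add: power_mult_distrib algebra_simps)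
  then show ?thesis by blast
qed

section \<open>Divisors of norm 5 and 7\<close>

type_synonym vec = "int \<times> int \<times> int"

definition axes :: "vec set" where
  "axes = {(1,0,0), (-1,0,0), (0,1,0), (0,-1,0), (0,0,1), (0,0,-1)}"

definition corners :: "vec set" where
  "corners = {(1,1,1), (1,1,-1), (1,-1,1), (1,-1,-1), (-1,1,1), (-1,1,-1), (-1,-1,1), (-1,-1,-1)}"

text \<open>\<open>div5 a e v\<close> and \<open>div7 a w v\<close> express that the quaternion \<open>a + v\<close> is left divisible by
  \<open>1 + 2e\<close> and by \<open>2 + w\<close>, respectively.\<close>
fun div5 :: "int \<Rightarrow> vec \<Rightarrow> vec \<Rightarrow> bool" where
  "div5 a (e1, e2, e3) (A, B, C) \<longleftrightarrow>
    5 dvd a + 2 * (e1 * A + e2 * B + e3 * C) \<and>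
    5 dvd A - 2 * a * e1 - 2 * (e2 * C - e3 * B) \<and>
    5 dvd B - 2 * a * e2 - 2 * (e3 * A - e1 * C) \<and>
    5 dvd C - 2 * a * e3 - 2 * (e1 * B - e2 * A)"

fun div7 :: "int \<Rightarrow> vec \<Rightarrow> vec \<Rightarrow> bool" where
  "div7 a (w1, w2, w3) (A, B, C) \<longleftrightarrow>
    7 dvd 2 * a + (w1 * A + w2 * B + w3 * C) \<and>
    7 dvd 2 * A - a * w1 - (w2 * C - w3 * B) \<and>
    7 dvd 2 * B - a * w2 - (w3 * A - w1 * C) \<and>
    7 dvd 2 * C - a * w3 - (w1 * B - w2 * A)"

lemma div5_mod: "div5 (a mod 5) e (A mod 5, B mod 5, C mod 5) = div5 a e (A, B, C)"
  by (cases e, hypsubst, unfold div5.simps, intro conj_cong cong_dvd_iff cong_add cong_diff cong_mult cong_refl)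
    simp_all

lemma div7_mod: "div7 (a mod 7) w (A mod 7, B mod 7, C mod 7) = div7 a w (A, B, C)"
  by (cases w, hypsubst, unfold div7.simps, intro conj_cong cong_dvd_iff cong_add cong_diff cong_mult cong_refl)
    simp_all

text \<open>Divisibility depends only on residues mod 5, so a finite evaluation replaces the ideal
  theory of quaternions.\<close>

lemma div5_residues:
  "\<forall>a\<in>set [1..4]. \<forall>A\<in>set [0..4]. \<forall>B\<in>set [0..4]. \<forall>C\<in>set [0..4].
    (a\<^sup>2 + A\<^sup>2 + B\<^sup>2 + C\<^sup>2) mod 5 = 0 \<longrightarrow>
    (\<exists>e\<in>set [(1,0,0), (-1,0,0), (0,1,0), (0,-1,0), (0,0,1), (0,0,-1)]. div5 a e (A, B, C))"
  by code_simp

lemma div7_residues: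
  "\<forall>a\<in>set [1..6]. \<forall>A\<in>set [0..6]. \<forall>B\<in>set [0..6]. \<forall>C\<in>set [0..6].
    (a\<^sup>2 + A\<^sup>2 + B\<^sup>2 + C\<^sup>2) mod 7 = 0 \<longrightarrow>
    (\<exists>w\<in>set [(1,1,1), (1,1,-1), (1,-1,1), (1,-1,-1), (-1,1,1), (-1,1,-1), (-1,-1,1), (-1,-1,-1)].
      div7 a w (A, B, C))"
  by code_simp

lemma div5_exists:
  assumes "\<not> 5 dvd a" "5 dvd a\<^sup>2 + A\<^sup>2 + B\<^sup>2 + C\<^sup>2"
  shows "\<exists>e\<in>axes. div5 a e (A, B, C)"
proof -
  have "a mod 5 \<noteq> 0" using assms(1) by (simp add: dvd_eq_mod_eq_0)
  moreover have "0 \<le> a mod 5" "a mod 5 < 5" by simp_all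
  ultimately have "1 \<le> a mod 5 \<and> a mod 5 \<le> 4" by linarith
  then have "a mod 5 \<in> set [1..4]" by simp
  moreover have "x mod 5 \<in> set [0..4]" for x :: int using pos_mod_bound[of 5 x] by simp
  moreover have "[(a mod 5)\<^sup>2 + (A mod 5)\<^sup>2 + (B mod 5)\<^sup>2 + (C mod 5)\<^sup>2 = a\<^sup>2 + A\<^sup>2 + B\<^sup>2 + C\<^sup>2] (mod 5)"
    by (intro cong_add cong_pow) simp_all
  then have "((a mod 5)\<^sup>2 + (A mod 5)\<^sup>2 + (B mod 5)\<^sup>2 + (C mod 5)\<^sup>2) mod 5 = 0"
    using assms(2) by (simp only: cong_def dvd_eq_mod_eq_0)
  ultimately have "\<exists>e\<in>axes. div5 (a mod 5) e (A mod 5, B mod 5, C mod 5)"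
    using div5_residues unfolding axes_def by (simp only: list.set)
  then show ?thesis by (simp only: div5_mod)
qed

lemma div7_exists:
  assumes "\<not> 7 dvd a" "7 dvd a\<^sup>2 + A\<^sup>2 + B\<^sup>2 + C\<^sup>2"
  shows "\<exists>w\<in>corners. div7 a w (A, B, C)"
proof -
  have "a mod 7 \<noteq> 0" using assms(1) by (simp add: dvd_eq_mod_eq_0)
  moreover have "0 \<le> a mod 7" "a mod 7 < 7" by simp_all
  ultimately have "1 \<le> a mod 7 \<and> a mod 7 \<le> 6" by linarith
  then have "a mod 7 \<in> set [1..6]" by simp
  moreover have "x mod 7 \<in> set [0..6]" for x :: int using pos_mod_bound[of 7 x] by simp
  moreover have "[(a mod 7)\<^sup>2 + (A mod 7)\<^sup>2 + (B mod 7)\<^sup>2 + (C mod 7)\<^sup>2 = a\<^sup>2 + A\<^sup>2 + B\<^sup>2 + C\<^sup>2] (mod 7)"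
    by (intro cong_add cong_pow) simp_all
  then have "((a mod 7)\<^sup>2 + (A mod 7)\<^sup>2 + (B mod 7)\<^sup>2 + (C mod 7)\<^sup>2) mod 7 = 0"
    using assms(2) by (simp only: cong_def dvd_eq_mod_eq_0)
  ultimately have "\<exists>w\<in>corners. div7 (a mod 7) w (A mod 7, B mod 7, C mod 7)"
    using div7_residues unfolding corners_def by (simp only: list.set)
  then show ?thesis by (simp only: div7_mod)
qed

text \<open>As 9 is prime to 5, the recurrence gains a factor 5 at each index, so 5^j divides y k
  whenever j \<le> k. Boundedness then makes all late terms vanish, and the recurrence read
  backwards makes the earlier ones vanish. This is how a rotation with denominator 5 is prevented
  from keeping a vector off its axis integral forever.\<close>

lemma bounded_recurrence_zero:
  fixes y :: "nat \<Rightarrow> int"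
  assumes rec: "\<And>k. 5 * y (k + 2) = - 9 * y (k + 1) - 5 * y k" and bound: "\<And>k. \<bar>y k\<bar> \<le> K"
  shows "y 0 = 0"
proof -
  have dvd: "5 ^ j dvd y k" if "j \<le> k" for j k
    using that
  proof (induction j arbitrary: k)
    case (Suc j)
    then obtain i where k: "k = i + 1" "j \<le> i" by (metis Suc_eq_plus1 Suc_le_D Suc_le_mono)
    have "5 ^ j dvd y i" "5 ^ j dvd y (i + 2)" using Suc.IH k(2) by simp_all
    then have "5 * 5 ^ j dvd 5 * (- y (i + 2) - y i)"
      by (intro mult_dvd_mono dvd_diff) simp_all
    also have "5 * (- y (i + 2) - y i) = 9 * y (i + 1)" using rec[of i] by simp
    finally have "5 ^ Suc j dvd 9 * y k" by (simp add: k(1))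
    moreover have "coprime (5 ^ Suc j :: int) 9"
    proof -
      have "coprime (5 :: int) 9" by (simp add: coprime_iff_gcd_eq_1 gcd_non_0_int)
      then show ?thesis by (simp only: coprime_power_left_iff simp_thms)
    qed
    ultimately show ?case by (simp only: coprime_dvd_mult_right_iff)
  qed simp
  define B where "B = nat K + 1"
  have "K < 5 ^ B"
  proof -
    have "B < 5 ^ B" using less_exp[of B] power_mono[of 2 "5 :: nat" B] by linarith
    then have "int B < int (5 ^ B)" by (simp only: of_nat_less_iff)
    then have "int B < 5 ^ B" by simp
    then show ?thesis unfolding B_def by linarith
  qed
  have zero: "y k = 0" if "k \<ge> B" for k
  proof (rule ccontr)
    assume "y k \<noteq> 0"
    then have "5 ^ B \<le> \<bar>y k\<bar>" using dvd[OF that] zdvd_imp_le[of "5 ^ B" "\<bar>y k\<bar>"] by simp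
    then show False using bound[of k] \<open>K < 5 ^ B\<close> by linarith
  qed
  \<comment> \<open>For i > B the truncated subtraction gives the same index as i = B.\<close>
  have "y (B - i) = 0" for i
  proof (induction i rule: less_induct)
    case (less i)
    show ?case
    proof (cases "i = 0 \<or> i > B")
      case True
      then show ?thesis using zero[of B] less[of B] by (cases "i = 0") auto
    next
      case False
      define k where "k = B - i"
      have "y (k + 1) = 0" using less[of "i - 1"] False unfolding k_def by (simp add: Suc_diff_le)
      moreover have "y (k + 2) = 0"
      proof (cases "i = 1")
        case True
        then show ?thesis using zero[of "k + 2"] False unfolding k_def by simp
      next
        case i: False
        then have "k + 2 = B - (i - 2)" using False unfolding k_def by auto
        then show ?thesis using less[of "i - 2"] False i by simp
      qed
      ultimately show ?thesis using rec[of k] unfolding k_def by simp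
    qed
  qed
  from this[of B] show ?thesis by simp
qed

section \<open>Rotations of the cube acting on vectors\<close>

fun norm2 :: "vec \<Rightarrow> int" where "norm2 (A, B, C) = A\<^sup>2 + B\<^sup>2 + C\<^sup>2"
fun dot :: "vec \<Rightarrow> vec \<Rightarrow> int" where "dot (a, b, c) (x, y, z) = a * x + b * y + c * z"
fun neg :: "vec \<Rightarrow> vec" where "neg (x, y, z) = (- x, - y, - z)"
text \<open>Together with \<open>rot\<close>, the quarter turn about the first axis, this turn about
  a diagonal generates the 24 rotations of the cube.\<close>

fun cyc :: "vec \<Rightarrow> vec" where "cyc (x, y, z) = (y, z, x)"
fun rot :: "vec \<Rightarrow> vec" where "rot (x, y, z) = (x, - z, y)"

lemma norm2_cyc [simp]: "norm2 (cyc v) = norm2 v" by (cases v) auto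
lemma norm2_rot [simp]: "norm2 (rot v) = norm2 v" by (cases v) auto
lemma norm2_neg [simp]: "norm2 (neg v) = norm2 v" by (cases v) auto
lemma neg_cyc: "neg (cyc v) = cyc (neg v)" by (cases v) auto
lemma neg_rot: "neg (rot v) = rot (neg v)" by (cases v) auto
lemma neg_neg [simp]: "neg (neg v) = v" by (cases v) auto

text \<open>A rotation acts as an automorphism of the quaternions and so respects left divisors. The
  map \<open>neg\<close> is different: it is conjugation, and \<open>div5 a e (neg v)\<close> says
  that a + v is right divisible by 1 - 2e.\<close>

lemma div5_cyc: "div5 a (cyc e) (cyc v) = div5 a e v"
  by (cases e, cases v) (auto simp: algebra_simps)
lemma div7_cyc: "div7 a (cyc w) (cyc v) = div7 a w v"
  by (cases w, cases v) (auto simp: algebra_simps)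

lemma dvd_sign_iff: "x = - y \<Longrightarrow> d dvd x \<longleftrightarrow> d dvd (y :: int)" by simp

lemma div5_rot: "div5 a (rot e) (rot v) = div5 a e v"
proof -
  obtain e1 e2 e3 A B C where [simp]: "e = (e1, e2, e3)" "v = (A, B, C)" by (metis prod_cases3)
  have "5 dvd - C - 2 * a * - e3 - 2 * (e2 * A - e1 * B) \<longleftrightarrow> 5 dvd C - 2 * a * e3 - 2 * (e1 * B - e2 * A)"
    by (rule dvd_sign_iff) (simp add: algebra_simps)
  then show ?thesis by (auto simp: algebra_simps)
qed

lemma div7_rot: "div7 a (rot w) (rot v) = div7 a w v"
proof -
  obtain w1 w2 w3 A B C where [simp]: "w = (w1, w2, w3)" "v = (A, B, C)" by (metis prod_cases3)
  have "7 dvd 2 * - C - a * - w3 - (w2 * A - w1 * B) \<longleftrightarrow> 7 dvd 2 * C - a * w3 - (w1 * B - w2 * A)"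
    by (rule dvd_sign_iff) (simp add: algebra_simps)
  then show ?thesis by (auto simp: algebra_simps)
qed

lemma all_axesI:
  assumes "P (1, 0, 0)" and cyc: "\<And>e. e \<in> axes \<Longrightarrow> P e \<Longrightarrow> P (cyc e)" and rot: "\<And>e. e \<in> axes \<Longrightarrow> P e \<Longrightarrow> P (rot e)"
    and "e \<in> axes"
  shows "P e"
proof -
  have z: "P (0, 0, 1)" using cyc[of "(1, 0, 0)"] assms(1) by (simp add: axes_def)
  have y: "P (0, 1, 0)" using cyc[of "(0, 0, 1)"] z by (simp add: axes_def)
  have y': "P (0, -1, 0)" using rot[of "(0, 0, 1)"] z by (simp add: axes_def)
  have x': "P (-1, 0, 0)" using cyc[of "(0, -1, 0)"] y' by (simp add: axes_def)
  have z': "P (0, 0, -1)" using cyc[of "(-1, 0, 0)"] x' by (simp add: axes_def)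
  show ?thesis using assms(1) x' y y' z z' assms(4) unfolding axes_def by blast
qed

lemma corners_cyc: "w \<in> corners \<Longrightarrow> \<exists>w'\<in>corners. w = cyc w'"
  unfolding corners_def by auto
lemma corners_rot: "w \<in> corners \<Longrightarrow> \<exists>w'\<in>corners. w = rot w'"
  unfolding corners_def by auto
lemma axes_cyc: "e \<in> axes \<Longrightarrow> \<exists>e'\<in>axes. e = cyc e'"
  unfolding axes_def by auto
lemma axes_rot: "e \<in> axes \<Longrightarrow> \<exists>e'\<in>axes. e = rot e'"
  unfolding axes_def by auto
lemma dot_cyc [simp]: "dot (cyc e) (cyc w) = dot e w" by (cases e, cases w) auto
lemma dot_rot [simp]: "dot (rot e) (rot w) = dot e w" by (cases e, cases w) auto
lemma cyc_inv: "\<exists>u. v = cyc u" by (cases v) (metis cyc.simps)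
lemma rot_inv: "\<exists>u. v = rot u" by (cases v) (metis rot.simps minus_minus)

text \<open>An integral solution of the 1-3-5 system corresponds to a vector \<open>v\<close> of norm \<open>35m - a\<^sup>2\<close>
  for which the quaternion \<open>a + v\<close> is left divisible by \<open>1 - 3i - 5j = (1 + 2i)(- 1 - i - j + 2k)\<close>,
  that is, by \<open>1 + 2i\<close> and by \<open>2 - i + j - k\<close>.\<close>
locale unsolvable =
  fixes a m :: int
  assumes not5: "\<not> 5 dvd a" and not7: "\<not> 7 dvd a"
    and unsolvable: "\<And>x y z t :: int. a = x + 3 * y + 5 * z \<Longrightarrow> m \<noteq> x\<^sup>2 + y\<^sup>2 + z\<^sup>2 + t\<^sup>2"
begin

definition rep :: "vec \<Rightarrow> bool" where "rep v \<longleftrightarrow> norm2 v = 35 * m - a\<^sup>2"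

lemma rep_cyc [simp]: "rep (cyc v) = rep v" and rep_rot [simp]: "rep (rot v) = rep v"
  and rep_neg [simp]: "rep (neg v) = rep v"
  by (simp_all add: rep_def)

lemma dvd_35I: "5 dvd x \<Longrightarrow> 7 dvd x \<Longrightarrow> 35 dvd (x :: int)"
  by presburger

text \<open>Multiplying a + v from the left by the conjugate 1 + 3i + 5j gives four coordinates
  divisible by 35; the quotients are x, y, z, t. In a + v = (1 - 3i - 5j) (x + y i + z j + t k),
  real parts give the linear equation and norms the quadratic one.\<close>

lemma no_divisor_135:
  assumes "rep v" "div5 a (1, 0, 0) v"
  shows "\<not> div7 a (-1, 1, -1) v"
proof
  assume d7: "div7 a (-1, 1, -1) v"
  obtain A B C where v: "v = (A, B, C)" by (metis prod_cases3)
  have "5 dvd A - 2 * a" "5 dvd C - 2 * B" using assms(2) unfolding v by simp_all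
  then obtain k l where kl: "A - 2 * a = 5 * k" "C - 2 * B = 5 * l" by (metis dvdE)
  have A5: "A = 2 * a + 5 * k" "C = 2 * B + 5 * l" using kl by simp_all
  have "7 dvd 2 * a + (B - A - C)" "7 dvd 2 * A + a - (C + B)"
    using d7 unfolding v by (simp_all add: algebra_simps)
  then obtain p q where pq: "2 * a + (B - A - C) = 7 * p" "2 * A + a - (C + B) = 7 * q" by (metis dvdE)
  \<comment> \<open>Modulo 7 the divisor 2 - i + j - k determines B and C from a and A;
    \<open>b\<close> and \<open>c\<close> are the quotients left over, so that the later
    divisibilities become identities.\<close>
  define c where "c = 2 * a - 4 * p - 4 * q - C"
  define b where "b = c + p - a"
  have C: "C = 4 * A - 2 * a + 7 * c" using pq unfolding c_def by simp
  have B: "B = 5 * A + 3 * a + 7 * b" using pq C unfolding b_def by simp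
  have "5 dvd a - 3 * A - 5 * B" by (rule dvdI[of _ _ "- a - 3 * k - B"]) (simp add: A5 algebra_simps)
  moreover have "7 dvd a - 3 * A - 5 * B" by (rule dvdI[of _ _ "- 4 * A - 2 * a - 5 * b"]) (simp add: B algebra_simps)
  ultimately have 1: "35 dvd a - 3 * A - 5 * B" by (rule dvd_35I)
  have "5 dvd A + 3 * a + 5 * C" by (rule dvdI[of _ _ "a + k + C"]) (simp add: A5 algebra_simps)
  moreover have "7 dvd A + 3 * a + 5 * C" by (rule dvdI[of _ _ "3 * A - a + 5 * c"]) (simp add: C algebra_simps)
  ultimately have 2: "35 dvd A + 3 * a + 5 * C" by (rule dvd_35I)
  have "5 dvd B + 5 * a - 3 * C" by (rule dvdI[of _ _ "a - B - 3 * l"]) (simp add: A5 algebra_simps)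
  moreover have "7 dvd B + 5 * a - 3 * C" by (rule dvdI[of _ _ "- A + 2 * a + b - 3 * c"]) (simp add: B C algebra_simps)
  ultimately have 3: "35 dvd B + 5 * a - 3 * C" by (rule dvd_35I)
  have "5 dvd C + 3 * B - 5 * A" by (rule dvdI[of _ _ "B + l - A"]) (simp add: A5 algebra_simps)
  moreover have "7 dvd C + 3 * B - 5 * A" by (rule dvdI[of _ _ "2 * A + a + c + 3 * b"]) (simp add: B C algebra_simps)
  ultimately have 4: "35 dvd C + 3 * B - 5 * A" by (rule dvd_35I)
  from 1 2 3 4 obtain x y z t where xyzt: "a - 3 * A - 5 * B = 35 * x" "A + 3 * a + 5 * C = 35 * y"
    "B + 5 * a - 3 * C = 35 * z" "C + 3 * B - 5 * A = 35 * t" by (metis dvdE)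
  have "a = x + 3 * y + 5 * z" using xyzt by linarith
  moreover have "m = x\<^sup>2 + y\<^sup>2 + z\<^sup>2 + t\<^sup>2"
  proof -
    have "35 * 35 * (x\<^sup>2 + y\<^sup>2 + z\<^sup>2 + t\<^sup>2) = (35 * x)\<^sup>2 + (35 * y)\<^sup>2 + (35 * z)\<^sup>2 + (35 * t)\<^sup>2"
      by (simp add: power_mult_distrib algebra_simps)
    also have "\<dots> = 35 * (a\<^sup>2 + (A\<^sup>2 + B\<^sup>2 + C\<^sup>2))"
      unfolding xyzt[symmetric] by (simp add: power2_eq_square algebra_simps)
    also have "A\<^sup>2 + B\<^sup>2 + C\<^sup>2 = 35 * m - a\<^sup>2" using assms(1) unfolding rep_def v by simp
    finally show ?thesis by simp
  qed
  ultimately show False using unsolvable by blast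
qed

text \<open>One pair of sign -1 represents all: the powers of \<open>rot\<close> fix (1, 0, 0) and
  carry (-1, 1, -1) to the four corners opposite to it, and \<open>cyc\<close> and
  \<open>rot\<close> carry (1, 0, 0) to every axis. The map \<open>f\<close> is the identity or
  \<open>neg\<close>, which commute with rotations, so left and right divisors of norm 7 are treated
  alike.\<close>

lemma octahedral_extension:
  assumes f: "\<And>v. f (cyc v) = cyc (f v)" "\<And>v. f (rot v) = rot (f v)"
    and base: "\<And>v. rep v \<Longrightarrow> div5 a (1, 0, 0) v \<Longrightarrow> \<not> div7 a (-1, 1, -1) (f v)"
    and v: "rep v" "e \<in> axes" "w \<in> corners" "div5 a e v" "div7 a w (f v)"
  shows "dot e w \<noteq> -1"
proof -
  define P where "P e \<longleftrightarrow> (\<forall>w\<in>corners. \<forall>v. rep v \<longrightarrow> dot e w = -1 \<longrightarrow> div5 a e v \<longrightarrow> \<not> div7 a w (f v))" for e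
  have "P e"
  proof (rule all_axesI[OF _ _ _ v(2)])
    define Q where "Q w \<longleftrightarrow> (\<forall>v. rep v \<longrightarrow> div5 a (1, 0, 0) v \<longrightarrow> \<not> div7 a w (f v))" for w
    have Q_rot: "Q (rot w)" if "Q w" for w
      unfolding Q_def
    proof (intro allI impI)
      fix v assume v: "rep v" "div5 a (1, 0, 0) v"
      obtain u where u: "v = rot u" using rot_inv by blast
      have "rep u" "div5 a (1, 0, 0) u" using v div5_rot[of a "(1, 0, 0)" u] unfolding u by simp_all
      then show "\<not> div7 a (rot w) (f v)" using that unfolding Q_def u f div7_rot by blast
    qed
    have q1: "Q (-1, 1, -1)" unfolding Q_def using base by blast
    have q2: "Q (-1, 1, 1)" using Q_rot[OF q1] by simp
    have q3: "Q (-1, -1, 1)" using Q_rot[OF q2] by simp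
    have q4: "Q (-1, -1, -1)" using Q_rot[OF q3] by simp
    show "P (1, 0, 0)" unfolding P_def corners_def using q1 q2 q3 q4 unfolding Q_def by simp
  next
    fix e assume "P e"
    show "P (cyc e)" unfolding P_def
    proof (intro ballI allI impI)
      fix w v assume *: "w \<in> corners" "rep v" "dot (cyc e) w = -1" "div5 a (cyc e) v"
      obtain w' where w': "w' \<in> corners" "w = cyc w'" using corners_cyc[OF *(1)] by blast
      obtain u where u: "v = cyc u" using cyc_inv by blast
      have "rep u" "dot e w' = -1" "div5 a e u" using *(2-4) unfolding u w'(2) div5_cyc by simp_all
      then show "\<not> div7 a w (f v)" using \<open>P e\<close> w'(1) unfolding P_def u w'(2) f div7_cyc by blast
    qed
    show "P (rot e)" unfolding P_def
    proof (intro ballI allI impI)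
      fix w v assume *: "w \<in> corners" "rep v" "dot (rot e) w = -1" "div5 a (rot e) v"
      obtain w' where w': "w' \<in> corners" "w = rot w'" using corners_rot[OF *(1)] by blast
      obtain u where u: "v = rot u" using rot_inv by blast
      have "rep u" "dot e w' = -1" "div5 a e u" using *(2-4) unfolding u w'(2) div5_rot by simp_all
      then show "\<not> div7 a w (f v)" using \<open>P e\<close> w'(1) unfolding P_def u w'(2) f div7_rot by blast
    qed
  qed
  then show ?thesis using v unfolding P_def by blast
qed

lemma not_opposite:
  assumes "rep v" "e \<in> axes" "w \<in> corners" "div5 a e v" "div7 a w v"
  shows "dot e w \<noteq> -1"
  by (rule octahedral_extension[of "\<lambda>v. v"]) (use assms no_divisor_135 in auto)

text \<open>Here \<open>v\<close> is moved to its neighbour \<open>(2 - w) v (2 - w)\<^sup>-\<^sup>1\<close>, which is integral because \<open>a + v\<close>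
  is right divisible by \<open>2 - w\<close>.\<close>
lemma no_mixed_divisor_135:
  assumes "rep v" "div5 a (1, 0, 0) v"
  shows "\<not> div7 a (-1, 1, -1) (neg v)"
proof
  assume d7: "div7 a (-1, 1, -1) (neg v)"
  obtain A B C where v: "v = (A, B, C)" by (metis prod_cases3)
  have "5 dvd A - 2 * a" "5 dvd C - 2 * B" using assms(2) unfolding v by simp_all
  then obtain k l where kl: "A - 2 * a = 5 * k" "C - 2 * B = 5 * l" by (metis dvdE)
  have A5: "A = 2 * a + 5 * k" "C = 2 * B + 5 * l" using kl by simp_all
  have "7 dvd 2 * a + (A - B + C)" "7 dvd - 2 * A + a + (C + B)"
    using d7 unfolding v by (simp_all add: algebra_simps)
  then obtain p q where pq: "2 * a + (A - B + C) = 7 * p" "- 2 * A + a + (C + B) = 7 * q" by (metis dvdE)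
  define c where "c = - 2 * a + 4 * p + 4 * q - C"
  define b where "b = a + c - p"
  have C: "C = 4 * A + 2 * a + 7 * c" using pq unfolding c_def by simp
  have B: "B = 5 * A - 3 * a + 7 * b" using pq C unfolding b_def by simp
  define X where "X = - 5 * A + 2 * a - 6 * b - 2 * c"
  define Y where "Y = - A - 3 * a + 3 * b - 6 * c"
  define Z where "Z = 4 * A + 2 * b + 3 * c"
  \<comment> \<open>The coefficients form 7 times the matrix of conjugation by 2 - w = 2 + i - j +
    k.\<close>
  have xyz: "3 * A - 6 * B - 2 * C = 7 * X" "2 * A + 3 * B - 6 * C = 7 * Y" "6 * A + 2 * B + 3 * C = 7 * Z"
    by (simp_all add: B C X_def Y_def Z_def algebra_simps)
  have "49 * norm2 (X, Y, Z) = (7 * X)\<^sup>2 + (7 * Y)\<^sup>2 + (7 * Z)\<^sup>2" by (simp add: power_mult_distrib)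
  also have "\<dots> = 49 * norm2 v" unfolding xyz[symmetric] v by (simp add: power2_eq_square algebra_simps)
  finally have "rep (X, Y, Z)" using assms(1) unfolding rep_def by simp
  \<comment> \<open>The left divisor 1 + 2i becomes 1 - 2i because (1 + 2i) (2 - w) (1 + 2i) = 5 (-2
    + i - j + k). The left divisor of norm 7 becomes 2 - w itself, so the neighbour has the excluded
    sign -1.\<close>
  moreover have "div5 a (-1, 0, 0) (X, Y, Z)"
  proof -
    define k' where "k' = 3 * (4 * a + 3 * k - 2 * B - 2 * l) - 4 * (X + 2 * a)"
    define l' where "l' = 3 * (2 * A - 2 * B - 9 * l) - 4 * (Z + 2 * Y)"
    have "X = 5 * k' - 2 * a" "Z = 5 * l' - 2 * Y" using A5 xyz unfolding k'_def l'_def by simp_all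
    then have h: "a - 2 * X = 5 * (a - 2 * k')" "X + 2 * a = 5 * k'" "Y - 2 * Z = 5 * (Y - 2 * l')" "Z + 2 * Y = 5 * l'"
      by simp_all
    have "5 dvd a - 2 * X" "5 dvd X + 2 * a" "5 dvd Y - 2 * Z" "5 dvd Z + 2 * Y" unfolding h by simp_all
    then show ?thesis by simp
  qed
  moreover have "div7 a (1, -1, 1) (X, Y, Z)"
  proof -
    have d: "7 dvd 2 * a + (A - B + C)" "7 dvd - 2 * A + a + (C + B)" "7 dvd - 2 * B - a - (A - C)"
      "7 dvd - 2 * C + a - (B + A)" using d7 unfolding v by (simp_all add: algebra_simps)
    have "2 * a + (X - Y + Z) = 2 * a + (A - B + C)" "2 * X - a + (Z + Y) = - (- 2 * A + a + (C + B))"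
      "2 * Y + a - (X - Z) = - (- 2 * B - a - (A - C))" "2 * Z - a - (Y + X) = - (- 2 * C + a - (B + A))"
      using xyz by simp_all
    with d have "7 dvd 2 * a + (X - Y + Z)" "7 dvd 2 * X - a + (Z + Y)" "7 dvd 2 * Y + a - (X - Z)"
      "7 dvd 2 * Z - a - (Y + X)" by (simp_all only: dvd_minus_iff)
    then show ?thesis by (simp add: algebra_simps)
  qed
  moreover have "(-1, 0, 0) \<in> axes" "(1, -1, 1) \<in> corners" by (simp_all add: axes_def corners_def)
  ultimately show False using not_opposite by fastforce
qed

lemma not_opposite_mixed:
  assumes "rep v" "e \<in> axes" "w \<in> corners" "div5 a e v" "div7 a w (neg v)"
  shows "dot e w \<noteq> -1"
  by (rule octahedral_extension[of neg]) (use assms no_mixed_divisor_135 in \<open>auto simp: neg_cyc neg_rot\<close>)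

text \<open>Replacing v by its negative exchanges left and right divisors, so this fixes the sign
  for all four combinations of a left or right divisor of norm 5 with one of norm 7.\<close>

lemma dot_eq_1:
  assumes "rep v" "e \<in> axes" "w \<in> corners" "div5 a e v \<or> div5 a e (neg v)" "div7 a w v \<or> div7 a w (neg v)"
  shows "dot e w = 1"
proof -
  have "dot e w = 1 \<or> dot e w = -1" using assms(2,3) unfolding axes_def corners_def by auto
  moreover have "dot e w \<noteq> -1"
    using assms not_opposite[of v e w] not_opposite[of "neg v" e w]
      not_opposite_mixed[of v e w] not_opposite_mixed[of "neg v" e w] by auto
  ultimately show ?thesis by blast
qed

lemma div5_neg_distinct: "div5 a e v \<Longrightarrow> \<not> div5 a e (neg v)"
proof
  assume *: "div5 a e v" "div5 a e (neg v)"
  have "5 dvd a + 2 * dot e v" "5 dvd a - 2 * dot e v"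
    using * by (cases e, cases v, simp add: algebra_simps)+
  then have "5 dvd (a + 2 * dot e v) + (a - 2 * dot e v)" by (rule dvd_add)
  then have "5 dvd 2 * a" by simp
  then show False using not5 by presburger
qed

lemma div7_neg_distinct: "div7 a w v \<Longrightarrow> \<not> div7 a w (neg v)"
proof
  assume *: "div7 a w v" "div7 a w (neg v)"
  have "7 dvd 2 * a + dot w v" "7 dvd 2 * a - dot w v"
    using * by (cases w, cases v, simp add: algebra_simps)+
  then have "7 dvd (2 * a + dot w v) + (2 * a - dot w v)" by (rule dvd_add)
  then have "7 dvd 4 * a" by simp
  then show False using not7 by presburger
qed

lemma rep_exists:
  assumes "rep v"
  shows "\<exists>e\<in>axes. div5 a e v" "\<exists>w\<in>corners. div7 a w v"
proof -
  obtain A B C where v: "v = (A, B, C)" by (metis prod_cases3)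
  have "a\<^sup>2 + A\<^sup>2 + B\<^sup>2 + C\<^sup>2 = 35 * m" using assms unfolding rep_def v by simp
  then have "5 dvd a\<^sup>2 + A\<^sup>2 + B\<^sup>2 + C\<^sup>2" "7 dvd a\<^sup>2 + A\<^sup>2 + B\<^sup>2 + C\<^sup>2" by presburger+
  then show "\<exists>e\<in>axes. div5 a e v" "\<exists>w\<in>corners. div7 a w v"
    unfolding v using div5_exists[OF not5] div7_exists[OF not7] by blast+
qed

end

section \<open>The exceptional representations\<close>

text \<open>Stated through squares, so that signs disappear and invariance under rotations is
  immediate.\<close>

fun exceptional :: "vec \<Rightarrow> bool" where
  "exceptional (A, B, C) \<longleftrightarrow> (\<exists>b. A\<^sup>2 = 9 * b\<^sup>2 \<and> B\<^sup>2 = 9 * b\<^sup>2 \<and> C\<^sup>2 = b\<^sup>2 \<or>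
    A\<^sup>2 = 9 * b\<^sup>2 \<and> B\<^sup>2 = b\<^sup>2 \<and> C\<^sup>2 = 9 * b\<^sup>2 \<or> A\<^sup>2 = b\<^sup>2 \<and> B\<^sup>2 = 9 * b\<^sup>2 \<and> C\<^sup>2 = 9 * b\<^sup>2)"

lemma exceptional_cyc [simp]: "exceptional (cyc v) = exceptional v"
  by (cases v) (simp, blast)

lemma exceptional_rot [simp]: "exceptional (rot v) = exceptional v"
  by (cases v) (simp, blast)

text \<open>The new triple is \<open>shift\<close> of the old one with the division by 5 carried
  out, and the corner (1, 1, c) must survive the step. Both values of \<open>c\<close> are required:
  the lemma is applied to a vector with \<open>c\<close> and to its negative with
  \<open>- c\<close>.\<close>

lemma div7_step:
  assumes "c = 1 \<or> c = -1" "div7 a (1, 1, c) (A, B, 2 * B + 5 * l)"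
  shows "div7 a (1, 1, c) (- 2 * B - 3 * l, - A, - B - 4 * l)"
  using assms(1)
proof
  assume c: "c = 1"
  have "7 dvd 2 * A - a - (B + 5 * l)" "7 dvd 4 * B + 5 * l - a - A"
    using assms(2) unfolding c by (simp_all add: algebra_simps)
  then obtain p q where pq: "2 * A - a - (B + 5 * l) = 7 * p" "4 * B + 5 * l - a - A = 7 * q"
    by (metis dvdE)
  define r where "r = p + q"
  define s where "s = a + 3 * q - 3 * B + 3 * r - 2 * l"
  have A: "A = 2 * a - 3 * B + 7 * r" using pq unfolding r_def by simp
  have l: "l = 2 * a + 7 * s" using pq(2) A unfolding s_def by simp
  have "7 dvd 2 * a - 2 * B - 3 * l - A - B - 4 * l" by (rule dvdI[of _ _ "- l - r"]) (simp add: A)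
  moreover have "7 dvd - a - A - 3 * B - 2 * l" by (rule dvdI[of _ _ "- a - 2 * s - r"]) (simp add: A l)
  moreover have "7 dvd - 2 * A - a + B - l" by (rule dvdI[of _ _ "- a + B - 2 * r - s"]) (simp add: A l)
  moreover have "7 dvd - 4 * B - 11 * l - a + A" by (rule dvdI[of _ _ "- B - 3 * a - 11 * s + r"]) (simp add: A l)
  ultimately show ?thesis unfolding c by (simp add: algebra_simps)
next
  assume c: "c = -1"
  have "7 dvd 2 * A - a - (3 * B + 5 * l)" "7 dvd 4 * B + 5 * l - a + A"
    using assms(2) unfolding c by (simp_all add: algebra_simps)
  then obtain p q where pq: "2 * A - a - (3 * B + 5 * l) = 7 * p" "4 * B + 5 * l - a + A = 7 * q"
    by (metis dvdE)
  define r where "r = p + q"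
  define s where "s = 3 * q - 3 * a + 4 * A - 12 * r - 2 * l"
  have B: "B = 2 * a - 3 * A + 7 * r" using pq unfolding r_def by simp
  have l: "l = 5 * A + 7 * s" using pq(2) B unfolding s_def by simp
  have "7 dvd 2 * a - B + l - A" by (rule dvdI[of _ _ "A - r + s"]) (simp add: B l)
  moreover have "7 dvd - 3 * B - 2 * l - a + A" by (rule dvdI[of _ _ "- a - 3 * r - 2 * s"]) (simp add: B l)
  moreover have "7 dvd - 2 * A - a - 3 * B - 7 * l" by (rule dvdI[of _ _ "A - a - 3 * r - l"]) (simp add: B)
  moreover have "7 dvd - 4 * B - 11 * l + a + A" by (rule dvdI[of _ _ "- a - 6 * A - 4 * r - 11 * s"]) (simp add: B l)
  ultimately show ?thesis unfolding c by (simp add: algebra_simps)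
qed

section \<open>The rotation of infinite order\<close>

context unsolvable begin

text \<open>The standard position: a + v has the left divisors 1 + 2i and 2 + i + j + ck and the
  right divisors 1 - 2j and 2 - i - j + ck.\<close>

definition aligned :: "int \<Rightarrow> vec \<Rightarrow> bool" where
  "aligned c v \<longleftrightarrow> rep v \<and> div5 a (1, 0, 0) v \<and> div5 a (0, 1, 0) (neg v) \<and>
    div7 a (1, 1, c) v \<and> div7 a (1, 1, - c) (neg v)"

text \<open>The neighbour \<open>(1 + 2i)\<^sup>-\<^sup>1 v (1 + 2i)\<close> of \<open>v\<close>, rotated back into the standard position.\<close>
fun shift :: "vec \<Rightarrow> vec" where
  "shift (A, B, C) = (- (4 * B + 3 * C) div 5, - A, (3 * B - 4 * C) div 5)"

lemma aligned_divE:
  assumes "aligned c (A, B, C)"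
  obtains l where "C = 2 * B + 5 * l" "shift (A, B, C) = (- 2 * B - 3 * l, - A, - B - 4 * l)"
proof -
  have "5 dvd C - 2 * B" using assms unfolding aligned_def by simp
  then obtain l where "C - 2 * B = 5 * l" by (metis dvdE)
  then have l: "C = 2 * B + 5 * l" by simp
  have eq: "- (4 * B + 3 * C) = 5 * (- 2 * B - 3 * l)" "3 * B - 4 * C = 5 * (- B - 4 * l)"
    unfolding l by (simp_all add: algebra_simps)
  have "shift (A, B, C) = (- 2 * B - 3 * l, - A, - B - 4 * l)"
  proof -
    have "- (4 * B + 3 * C) div 5 = - 2 * B - 3 * l" "(3 * B - 4 * C) div 5 = - B - 4 * l"
      unfolding eq by (rule nonzero_mult_div_cancel_left, simp)+
    then show ?thesis by simp
  qed
  with l show ?thesis using that by blast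
qed

text \<open>Conjugation moves the divisor 1 + 2i from the left to the right, and turning the vector
  back gives the right divisor 1 - 2j. The new left divisor of norm 5 is not computed: its direction
  has scalar product 1 with both (1, 1, 1) and (1, 1, -1), so it is (1, 0, 0) or (0, 1, 0), and the
  latter is already taken by the negative. Hence the next shift is integral again.\<close>

lemma aligned_shift:
  assumes c: "c = 1 \<or> c = -1" and v: "aligned c v"
  shows "aligned c (shift v)"
proof -
  obtain A B C where ABC: "v = (A, B, C)" by (metis prod_cases3)
  obtain l where l: "C = 2 * B + 5 * l" "shift v = (- 2 * B - 3 * l, - A, - B - 4 * l)"
    using aligned_divE v unfolding ABC by metis
  have "norm2 (shift v) = norm2 v" unfolding l(2) unfolding ABC l(1) by (simp add: power2_eq_square algebra_simps)
  then have rep: "rep (shift v)" using v unfolding aligned_def rep_def by simp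
  have 71: "div7 a (1, 1, c) (shift v)"
    unfolding l(2) using v unfolding aligned_def ABC l(1) by (intro div7_step[OF c]) blast
  have "div7 a (1, 1, - c) (- A, - B, 2 * (- B) + 5 * (- l))"
    using v unfolding aligned_def ABC l(1) by (simp add: algebra_simps)
  then have "div7 a (1, 1, - c) (- 2 * (- B) - 3 * (- l), - (- A), - (- B) - 4 * (- l))"
    by (rule div7_step[rotated]) (use c in auto)
  then have 72: "div7 a (1, 1, - c) (neg (shift v))" unfolding l(2) by (simp add: algebra_simps)
  have 52: "div5 a (0, 1, 0) (neg (shift v))"
  proof -
    have "5 dvd a + 2 * A" "5 dvd A - 2 * a" using v unfolding aligned_def ABC by simp_all
    moreover have "2 * B + 3 * l - 2 * (B + 4 * l) = 5 * (- l)" "B + 4 * l + 2 * (2 * B + 3 * l) = 5 * (B + 2 * l)" by simp_all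
    then have "5 dvd 2 * B + 3 * l - 2 * (B + 4 * l)" "5 dvd B + 4 * l + 2 * (2 * B + 3 * l)" by (metis dvd_triv_left)+
    ultimately show ?thesis unfolding l(2) by (simp add: algebra_simps)
  qed
  obtain e where e: "e \<in> axes" "div5 a e (shift v)" using rep_exists(1)[OF rep] by blast
  have "(1, 1, c) \<in> corners" "(1, 1, - c) \<in> corners" using c by (auto simp: corners_def)
  then have "dot e (1, 1, c) = 1" "dot e (1, 1, - c) = 1" using dot_eq_1[OF rep e(1)] e(2) 71 72 by blast+
  then have "e = (1, 0, 0) \<or> e = (0, 1, 0)" using e(1) c unfolding axes_def by auto
  moreover have "e \<noteq> (0, 1, 0)" using div5_neg_distinct[OF e(2)] 52 by blast
  ultimately show ?thesis unfolding aligned_def using rep e(2) 52 71 72 by simp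
qed

text \<open>The rotation \<open>shift\<close> has trace -4/5 and axis (-3, 3, 1), hence
  characteristic polynomial (X - 1) (X^2 + 9/5 X + 1). The forms A + B and B - 3C vanish on the axis
  and so obey the recurrence of the quadratic factor.\<close>

lemma aligned_recurrence:
  assumes c: "c = 1 \<or> c = -1" and v: "aligned c (A, B, C)"
    and "shift (A, B, C) = (A1, B1, C1)" "shift (A1, B1, C1) = (A2, B2, C2)"
  shows "5 * (A2 + B2) = - 9 * (A1 + B1) - 5 * (A + B)" "5 * (B2 - 3 * C2) = - 9 * (B1 - 3 * C1) - 5 * (B - 3 * C)"
proof -
  obtain l where l: "C = 2 * B + 5 * l" "A1 = - 2 * B - 3 * l" "B1 = - A" "C1 = - B - 4 * l"
    using aligned_divE[OF v] assms(3) by (metis prod.inject)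
  have "aligned c (A1, B1, C1)" using aligned_shift[OF c v] assms(3) by simp
  then obtain k where k: "C1 = 2 * B1 + 5 * k" "A2 = - 2 * B1 - 3 * k" "B2 = - A1" "C2 = - B1 - 4 * k"
    using aligned_divE assms(4) by (metis prod.inject)
  have "5 * k = - B - 4 * l + 2 * A" using k(1) l by simp
  then show "5 * (A2 + B2) = - 9 * (A1 + B1) - 5 * (A + B)" "5 * (B2 - 3 * C2) = - 9 * (B1 - 3 * C1) - 5 * (B - 3 * C)"
    unfolding k(2-4) l(1) unfolding l(2-4) by simp_all
qed

text \<open>All iterates are integral and have the same norm, so both linear forms give bounded
  integer sequences and vanish; their common zeros are the axis.\<close>

lemma aligned_exceptional:
  assumes c: "c = 1 \<or> c = -1" and v: "aligned c (A, B, C)"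
  shows "A = - 3 * C \<and> B = 3 * C"
proof -
  define f where "f k = (shift ^^ k) (A, B, C)" for k
  define X Y Z where "X k = fst (f k)" and "Y k = fst (snd (f k))" and "Z k = snd (snd (f k))" for k
  have f: "f k = (X k, Y k, Z k)" for k by (simp add: X_def Y_def Z_def)
  have al: "aligned c (X k, Y k, Z k)" for k
  proof (induction k)
    case 0
    then show ?case using v unfolding f[symmetric] by (simp add: f_def)
  next
    case (Suc k)
    then show ?case using aligned_shift[OF c Suc] unfolding f[symmetric] by (simp add: f_def)
  qed
  have sh: "shift (X k, Y k, Z k) = (X (k + 1), Y (k + 1), Z (k + 1))" for k
    unfolding f[symmetric] by (simp add: f_def)
  define K where "K = 35 * m - a\<^sup>2"
  have bound: "\<bar>X k\<bar> \<le> K" "\<bar>Y k\<bar> \<le> K" "\<bar>Z k\<bar> \<le> K" for k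
  proof -
    have le: "\<bar>u\<bar> \<le> u\<^sup>2" for u :: int
    proof (cases "u = 0")
      case False
      then have "\<bar>u\<bar> * 1 \<le> \<bar>u\<bar> * \<bar>u\<bar>" by (intro mult_left_mono) auto
      then show ?thesis by (simp add: power2_eq_square abs_mult[symmetric])
    qed simp
    have "(X k)\<^sup>2 + (Y k)\<^sup>2 + (Z k)\<^sup>2 = K" using al[of k] unfolding aligned_def rep_def K_def by simp
    then show "\<bar>X k\<bar> \<le> K" "\<bar>Y k\<bar> \<le> K" "\<bar>Z k\<bar> \<le> K"
      using le[of "X k"] le[of "Y k"] le[of "Z k"] zero_le_power2[of "X k"] zero_le_power2[of "Y k"] zero_le_power2[of "Z k"]
      by linarith+
  qed
  have "X 0 + Y 0 = 0"
  proof (rule bounded_recurrence_zero[of "\<lambda>k. X k + Y k" "2 * K"])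
    show "5 * (X (k + 2) + Y (k + 2)) = - 9 * (X (k + 1) + Y (k + 1)) - 5 * (X k + Y k)" for k
      using aligned_recurrence(1)[OF c al sh sh, of k] by simp
    show "\<bar>X k + Y k\<bar> \<le> 2 * K" for k using bound[of k] by linarith
  qed
  moreover have "Y 0 - 3 * Z 0 = 0"
  proof (rule bounded_recurrence_zero[of "\<lambda>k. Y k - 3 * Z k" "4 * K"])
    show "5 * (Y (k + 2) - 3 * Z (k + 2)) = - 9 * (Y (k + 1) - 3 * Z (k + 1)) - 5 * (Y k - 3 * Z k)" for k
      using aligned_recurrence(2)[OF c al sh sh, of k] by simp
    show "\<bar>Y k - 3 * Z k\<bar> \<le> 4 * K" for k using bound[of k] by linarith
  qed
  moreover have "X 0 = A" "Y 0 = B" "Z 0 = C" by (simp_all add: X_def Y_def Z_def f_def)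
  ultimately show ?thesis by simp
qed

text \<open>Rotations reduce the directions to (1, 0, 0) and (0, 1, 0). The corners of sign 1 with
  both are (1, 1, 1) and (1, 1, -1); v and its negative cannot share one, so they take one each,
  which is the aligned position.\<close>

lemma perpendicular_exceptional:
  assumes "e \<in> axes" "f \<in> axes" "dot e f = 0" "rep v" "div5 a e v" "div5 a f (neg v)"
  shows "exceptional v"
proof -
  define P where "P e \<longleftrightarrow> (\<forall>f\<in>axes. dot e f = 0 \<longrightarrow> (\<forall>v. rep v \<longrightarrow> div5 a e v \<longrightarrow> div5 a f (neg v) \<longrightarrow> exceptional v))" for e
  have "P e"
  proof (rule all_axesI[OF _ _ _ assms(1)])
    define Q where "Q f \<longleftrightarrow> (\<forall>v. rep v \<longrightarrow> div5 a (1, 0, 0) v \<longrightarrow> div5 a f (neg v) \<longrightarrow> exceptional v)" for f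
    have Q_rot: "Q (rot f)" if "Q f" for f
      unfolding Q_def
    proof (intro allI impI)
      fix v assume v: "rep v" "div5 a (1, 0, 0) v" "div5 a (rot f) (neg v)"
      obtain u where u: "v = rot u" using rot_inv by blast
      have "rep u" "div5 a (1, 0, 0) u" using v(1,2) div5_rot[of a "(1, 0, 0)" u] unfolding u by simp_all
      moreover have "div5 a f (neg u)" using v(3) unfolding u neg_rot div5_rot .
      ultimately show "exceptional v" using that unfolding Q_def u exceptional_rot by blast
    qed
    have q1: "Q (0, 1, 0)" unfolding Q_def
    proof (intro allI impI)
      fix v assume v: "rep v" "div5 a (1, 0, 0) v" "div5 a (0, 1, 0) (neg v)"
      have corner: "w = (1, 1, 1) \<or> w = (1, 1, -1)" if "w \<in> corners" "div7 a w v \<or> div7 a w (neg v)" for w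
      proof -
        have "dot (1, 0, 0) w = 1" "dot (0, 1, 0) w = 1"
          using dot_eq_1[OF v(1) _ that(1) _ that(2)] v(2,3) by (auto simp: axes_def)
        then show ?thesis using that(1) unfolding corners_def by auto
      qed
      obtain w where w: "w \<in> corners" "div7 a w v" using rep_exists(2)[OF v(1)] by blast
      obtain w' where w': "w' \<in> corners" "div7 a w' (neg v)" using rep_exists(2)[of "neg v"] v(1) by auto
      have "w \<noteq> w'" using div7_neg_distinct[OF w(2)] w'(2) by blast
      then have "\<exists>c. (c = 1 \<or> c = -1) \<and> w = (1, 1, c) \<and> w' = (1, 1, - c)" using corner[of w] corner[of w'] w w' by auto
      then obtain c where c: "c = 1 \<or> c = -1" "w = (1, 1, c)" "w' = (1, 1, - c)" by blast
      obtain A B C where ABC: "v = (A, B, C)" by (metis prod_cases3)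
      have "aligned c (A, B, C)" using v w(2) w'(2) unfolding aligned_def c(2,3) ABC by blast
      then have "A = - 3 * C \<and> B = 3 * C" by (rule aligned_exceptional[OF c(1)])
      then show "exceptional v" unfolding ABC by (auto simp: power_mult_distrib)
    qed
    have q2: "Q (0, 0, 1)" using Q_rot[OF q1] by simp
    have q3: "Q (0, -1, 0)" using Q_rot[OF q2] by simp
    have q4: "Q (0, 0, -1)" using Q_rot[OF q3] by simp
    show "P (1, 0, 0)" unfolding P_def axes_def using q1 q2 q3 q4 unfolding Q_def by auto
  next
    fix e assume "P e"
    show "P (cyc e)" unfolding P_def
    proof (intro ballI allI impI)
      fix f v assume *: "f \<in> axes" "dot (cyc e) f = 0" "rep v" "div5 a (cyc e) v" "div5 a f (neg v)"
      obtain f' where f': "f' \<in> axes" "f = cyc f'" using axes_cyc[OF *(1)] by blast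
      obtain u where u: "v = cyc u" using cyc_inv by blast
      have "dot e f' = 0" "rep u" "div5 a e u" "div5 a f' (neg u)"
        using *(2-5) unfolding u f'(2) neg_cyc div5_cyc by simp_all
      then have "exceptional u" using \<open>P e\<close> f'(1) unfolding P_def by blast
      then show "exceptional v" unfolding u by simp
    qed
    show "P (rot e)" unfolding P_def
    proof (intro ballI allI impI)
      fix f v assume *: "f \<in> axes" "dot (rot e) f = 0" "rep v" "div5 a (rot e) v" "div5 a f (neg v)"
      obtain f' where f': "f' \<in> axes" "f = rot f'" using axes_rot[OF *(1)] by blast
      obtain u where u: "v = rot u" using rot_inv by blast
      have "dot e f' = 0" "rep u" "div5 a e u" "div5 a f' (neg u)"
        using *(2-5) unfolding u f'(2) neg_rot div5_rot by simp_all
      then have "exceptional u" using \<open>P e\<close> f'(1) unfolding P_def by blast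
      then show "exceptional v" unfolding u by simp
    qed
  qed
  then show ?thesis using assms(2-6) unfolding P_def by blast
qed

text \<open>The left divisors of v and of its negative have directions that are distinct by
  \<open>div5_neg_distinct\<close>, and not opposite since both have scalar product 1 with
  \<open>w\<close>. Hence they are perpendicular.\<close>

lemma rep_exceptional:
  assumes "rep v"
  shows "exceptional v"
proof -
  obtain e where e: "e \<in> axes" "div5 a e v" using rep_exists(1)[OF assms] by blast
  obtain f where f: "f \<in> axes" "div5 a f (neg v)" using rep_exists(1)[of "neg v"] assms by auto
  obtain w where w: "w \<in> corners" "div7 a w v" using rep_exists(2)[OF assms] by blast
  have "e \<noteq> f" using div5_neg_distinct[OF e(2)] f(2) by blast
  moreover have "dot e w = 1" "dot f w = 1" using dot_eq_1[OF assms _ w(1)] e f w(2) by blast+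
  then have "f \<noteq> neg e" by (cases e, cases w) auto
  ultimately have "dot e f = 0" using e(1) f(1) unfolding axes_def by auto
  then show ?thesis using perpendicular_exceptional e f assms by blast
qed

text \<open>If every representation of \<open>N = 19 b\<^sup>2\<close> were exceptional, pick an odd prime \<open>p\<close> dividing \<open>b\<close> and
  reflect the exceptional vectors in a vector \<open>u\<close> of norm \<open>2p\<close>.\<close>
lemma no_rep:
  assumes "rep v" and odd: "\<And>b. 35 * m - a\<^sup>2 = 19 * b\<^sup>2 \<Longrightarrow> odd b \<and> \<bar>b\<bar> \<noteq> 1"
  shows False
proof -
  obtain A B C where v: "v = (A, B, C)" by (metis prod_cases3)
  obtain b where "A\<^sup>2 + B\<^sup>2 + C\<^sup>2 = 19 * b\<^sup>2" using rep_exceptional[OF assms(1)] unfolding v by auto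
  then have N: "35 * m - a\<^sup>2 = 19 * b\<^sup>2" using assms(1) unfolding rep_def v by simp
  have b: "odd b" "\<bar>b\<bar> \<noteq> 1" using odd[OF N] by auto
  then have "nat \<bar>b\<bar> \<noteq> 1" by linarith
  then obtain p where p: "prime p" "p dvd nat \<bar>b\<bar>" using prime_factor_nat by blast
  then have pb: "int p dvd b" by (simp add: dvd_nat_abs_iff)
  then obtain t where t: "b = int p * t" by blast
  have "odd p" using b(1) t by auto
  then have p2: "p > 2" using prime_ge_2_nat[OF p(1)] by (cases "p = 2") auto
  \<comment> \<open>The norm is 2p instead of p because 2p is 2 or 6 mod 8 for every odd p, hence
    always a sum of three squares.\<close>
  have "(2 * p) mod 8 = 2 \<or> (2 * p) mod 8 = 6" using \<open>odd p\<close> by presburger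
  then obtain u1 u2 u3 where u: "int (2 * p) = u1\<^sup>2 + u2\<^sup>2 + u3\<^sup>2" using sum_three_squares[of "2 * p"] by blast
  have b0: "b \<noteq> 0" using b by auto
  have key: "int p dvd (x * u1 + y * u2 + z * u3) * u1 \<and> int p dvd (x * u1 + y * u2 + z * u3) * u2 \<and>
      int p dvd (x * u1 + y * u2 + z * u3) * u3"
    if xyz: "x\<^sup>2 + y\<^sup>2 + z\<^sup>2 = 19" for x y z :: int
  proof -
    define d where "d = x * u1 + y * u2 + z * u3"
    \<comment> \<open>As u has norm 2p and b = p t, this is the first coordinate of b (x, y, z)
      reflected in the plane orthogonal to u. Being exceptional forces all three coordinates to be
      multiples of b.\<close>
    define X where "X = t * (int p * x - d * u1)"
    define Y where "Y = t * (int p * y - d * u2)"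
    define Z where "Z = t * (int p * z - d * u3)"
    have "X\<^sup>2 + Y\<^sup>2 + Z\<^sup>2 = t\<^sup>2 * ((int p)\<^sup>2 * (x\<^sup>2 + y\<^sup>2 + z\<^sup>2) - 2 * int p * d * (x * u1 + y * u2 + z * u3)
        + d\<^sup>2 * (u1\<^sup>2 + u2\<^sup>2 + u3\<^sup>2))"
      unfolding X_def Y_def Z_def by (simp add: power2_eq_square algebra_simps)
    also have "\<dots> = 19 * b\<^sup>2"
      unfolding d_def[symmetric] u[symmetric] xyz t by (simp add: power2_eq_square algebra_simps)
    finally have XYZ: "X\<^sup>2 + Y\<^sup>2 + Z\<^sup>2 = 19 * b\<^sup>2" .
    then have "rep (X, Y, Z)" unfolding rep_def using N by simp
    then have "exceptional (X, Y, Z)" by (rule rep_exceptional)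
    then obtain b' where b': "X\<^sup>2 = 9 * b'\<^sup>2 \<and> Y\<^sup>2 = 9 * b'\<^sup>2 \<and> Z\<^sup>2 = b'\<^sup>2 \<or>
      X\<^sup>2 = 9 * b'\<^sup>2 \<and> Y\<^sup>2 = b'\<^sup>2 \<and> Z\<^sup>2 = 9 * b'\<^sup>2 \<or> X\<^sup>2 = b'\<^sup>2 \<and> Y\<^sup>2 = 9 * b'\<^sup>2 \<and> Z\<^sup>2 = 9 * b'\<^sup>2" by auto
    then have "b'\<^sup>2 = b\<^sup>2" using XYZ by auto
    then have "b\<^sup>2 dvd X\<^sup>2" "b\<^sup>2 dvd Y\<^sup>2" "b\<^sup>2 dvd Z\<^sup>2"
      using b' by (metis dvd_refl dvd_triv_right)+
    then have "b dvd X" "b dvd Y" "b dvd Z" using pow_divides_pow_iff[of 2] by simp_all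
    then have "t * int p dvd t * (int p * x - d * u1)" "t * int p dvd t * (int p * y - d * u2)" "t * int p dvd t * (int p * z - d * u3)"
      unfolding X_def Y_def Z_def t by (simp_all only: mult.commute)
    moreover have "t \<noteq> 0" using b0 t by auto
    ultimately have "int p dvd int p * x - d * u1" "int p dvd int p * y - d * u2" "int p dvd int p * z - d * u3"
      by (simp_all only: dvd_mult_cancel_left) auto
    then have "int p dvd d * u1" "int p dvd d * u2" "int p dvd d * u3"
      by (metis dvd_triv_left dvd_diff_right_iff dvd_diff_left_iff)+
    then show ?thesis unfolding d_def by blast
  qed
  have pp: "prime (int p)" using p(1) by simp
  have "\<not> (int p dvd u1 \<and> int p dvd u2 \<and> int p dvd u3)"
  proof
    assume "int p dvd u1 \<and> int p dvd u2 \<and> int p dvd u3"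
    then have "int p * int p dvd u1\<^sup>2 + u2\<^sup>2 + u3\<^sup>2" by (simp add: power2_eq_square dvd_add mult_dvd_mono)
    then have "int p * int p dvd 2 * int p" using u by simp
    then have "int p dvd 2" using p2 by simp
    then show False using zdvd_imp_le[of "int p" 2] p2 by auto
  qed
  then have dvd: "int p dvd x * u1 + y * u2 + z * u3" if "x\<^sup>2 + y\<^sup>2 + z\<^sup>2 = 19" for x y z
    using key[OF that] prime_dvd_mult_iff[OF pp] by blast
  have half: "int p dvd w" if "int p dvd x" "int p dvd y" "x - y = 2 * w" for x y w
  proof -
    have "int p dvd 2 * w" using dvd_diff[OF that(1,2)] that(3) by simp
    moreover have "\<not> int p dvd 2" using zdvd_imp_le[of "int p" 2] p2 by auto
    ultimately show ?thesis using prime_dvd_mult_iff[OF pp] by blast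
  qed
  \<comment> \<open>The vectors (3, 3, 1) and (3, 3, -1) of norm 19 differ only in the last
    coordinate, which isolates 2 * u3.\<close>
  have "int p dvd u3" using dvd[of 3 3 1] dvd[of 3 3 "-1"] half[of "3 * u1 + 3 * u2 + 1 * u3" "3 * u1 + 3 * u2 + -1 * u3" u3] by simp
  moreover have "int p dvd u2" using dvd[of 3 1 3] dvd[of 3 "-1" 3] half[of "3 * u1 + 1 * u2 + 3 * u3" "3 * u1 + -1 * u2 + 3 * u3" u2] by simp
  moreover have "int p dvd u1" using dvd[of 1 3 3] dvd[of "-1" 3 3] half[of "1 * u1 + 3 * u2 + 3 * u3" "-1 * u1 + 3 * u2 + 3 * u3" u1] by simp
  ultimately show False using \<open>\<not> (int p dvd u1 \<and> int p dvd u2 \<and> int p dvd u3)\<close> by blast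
qed

end

section \<open>Choice of n\<close>

text \<open>Among three consecutive integers of the right parity, 5 divides at most one and 7 at
  most one, so one is left.\<close>

lemma exists_coprime_35_in_window:
  fixes k r :: int
  assumes "r = 0 \<or> r = 1"
  shows "\<exists>n. k \<le> n \<and> n \<le> k + 5 \<and> n mod 2 = r \<and> \<not> 5 dvd n \<and> \<not> 7 dvd n"
proof -
  define l where "l = (if k mod 2 = r then k else k + 1)"
  have l: "k \<le> l" "l \<le> k + 1" "l mod 2 = r" using assms unfolding l_def by presburger+
  have parity: "(l + 2) mod 2 = r" "(l + 4) mod 2 = r" using l(3) by presburger+
  have 5: "\<not> (5 dvd l \<and> 5 dvd l + 2)" "\<not> (5 dvd l \<and> 5 dvd l + 4)" "\<not> (5 dvd l + 2 \<and> 5 dvd l + 4)" by presburger+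
  have 7: "\<not> (7 dvd l \<and> 7 dvd l + 2)" "\<not> (7 dvd l \<and> 7 dvd l + 4)" "\<not> (7 dvd l + 2 \<and> 7 dvd l + 4)" by presburger+
  consider "\<not> 5 dvd l \<and> \<not> 7 dvd l" | "\<not> 5 dvd l + 2 \<and> \<not> 7 dvd l + 2" | "\<not> 5 dvd l + 4 \<and> \<not> 7 dvd l + 4"
    using 5 7 by blast
  then show ?thesis
  proof cases
    case 1
    then show ?thesis using l by (intro exI[of _ l]) auto
  next
    case 2
    then show ?thesis using l parity by (intro exI[of _ "l + 2"]) linarith
  next
    case 3
    then show ?thesis using l parity by (intro exI[of _ "l + 4"]) linarith
  qed
qed

lemma fourth_power_mod_16:
  fixes n :: int
  shows "even n \<Longrightarrow> n ^ 4 mod 16 = 0" "odd n \<Longrightarrow> n ^ 4 mod 16 = 1"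
proof -
  assume "even n"
  then obtain k where "n = 2 * k" by blast
  then show "n ^ 4 mod 16 = 0" by (simp add: power_mult_distrib)
next
  assume "odd n"
  have "n mod 16 = 1 \<or> n mod 16 = 3 \<or> n mod 16 = 5 \<or> n mod 16 = 7 \<or> n mod 16 = 9 \<or> n mod 16 = 11
    \<or> n mod 16 = 13 \<or> n mod 16 = 15" using \<open>odd n\<close> by presburger
  then have "(n mod 16) ^ 4 mod 16 = 1" by (elim disjE) simp_all
  then show "n ^ 4 mod 16 = 1" by (simp add: power_mod)
qed

text \<open>Modulo 8, \<open>K\<close> is 3m - 1 for odd \<open>n\<close> and 3m for even
  \<open>n\<close>. The prescribed parity avoids 7 and 4, and for m = 8 mod 16 it gives K = 8 mod
  16, whose quarter is 2 mod 4. The classes that remain also exclude 19 b^2 with b even. The margin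
  19 excludes b = 1 and b = -1, since 19 = 9 + 9 + 1 has no representation of another shape.\<close>

lemma integral_solution:
  fixes m n :: int
  assumes n: "\<not> 5 dvd n" "\<not> 7 dvd n" and N: "n ^ 4 + 19 < 35 * m"
    and m: "m mod 8 = 4 \<or> m mod 8 = 5 \<Longrightarrow> odd n"
      "\<not> (m mod 8 = 4 \<or> m mod 8 = 5) \<Longrightarrow> even n" "\<not> 16 dvd m"
  shows "\<exists>x y z t :: int. m = x\<^sup>2 + y\<^sup>2 + z\<^sup>2 + t\<^sup>2 \<and> n\<^sup>2 = x + 3 * y + 5 * z"
proof (rule ccontr)
  assume no: "\<not> ?thesis"
  define K where "K = 35 * m - n ^ 4"
  have "prime (5 :: int)" "prime (7 :: int)" by simp_all
  then have "\<not> 5 dvd n\<^sup>2" "\<not> 7 dvd n\<^sup>2" using n by (simp_all add: prime_dvd_power_iff)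
  then interpret unsolvable "n\<^sup>2" m using no by unfold_locales auto
  have K19: "K > 19" using N unfolding K_def by linarith
  have sq: "(n\<^sup>2)\<^sup>2 = n ^ 4" by simp
  have K_mod: "K mod 8 = 1 \<or> K mod 8 = 2 \<or> K mod 8 = 3 \<or> K mod 8 = 5 \<or> K mod 8 = 6 \<or> K mod 16 = 8"
  proof (cases "m mod 8 = 4 \<or> m mod 8 = 5")
    case True
    then have "n ^ 4 mod 16 = 1" using m(1) fourth_power_mod_16(2) by blast
    then obtain q where q: "n ^ 4 = 16 * q + 1" by (metis mult_div_mod_eq)
    have "K = (35 * (m mod 8) - 1) + (35 * (m div 8) - 2 * q) * 8"
    proof -
      have "35 * m = 35 * (8 * (m div 8) + m mod 8)" by simp
      then show ?thesis unfolding K_def q by (simp only: algebra_simps)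
    qed
    then have "K mod 8 = (35 * (m mod 8) - 1) mod 8" by (simp only: mod_mult_self1)
    then show ?thesis using True by auto
  next
    case False
    then have "n ^ 4 mod 16 = 0" using m(2) fourth_power_mod_16(1) by blast
    then obtain q where q: "n ^ 4 = 16 * q" by (metis mult_div_mod_eq add_0_right)
    show ?thesis
    proof (cases "m mod 8 = 0")
      case True
      then have "m mod 16 = 8" using m(3) by presburger
      \<comment> \<open>The 17 comes from 35 * 8 = 17 * 16 + 8.\<close>
      then have "K = 8 + (35 * (m div 16) + 17 - q) * 16"
      proof -
        have "m = 16 * (m div 16) + 8" using mult_div_mod_eq[of 16 m] \<open>m mod 16 = 8\<close> by simp
        then have "35 * m = 35 * (16 * (m div 16) + 8)" by simp
        then show ?thesis unfolding K_def q by simp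
      qed
      then have "K mod 16 = 8 mod 16" by (simp only: mod_mult_self1)
      then show ?thesis by simp
    next
      case nz: False
      have "K = 35 * (m mod 8) + (35 * (m div 8) - 2 * q) * 8"
      proof -
        have "35 * m = 35 * (8 * (m div 8) + m mod 8)" by simp
        then show ?thesis unfolding K_def q by (simp only: algebra_simps)
      qed
      then have "K mod 8 = 35 * (m mod 8) mod 8" by (simp only: mod_mult_self1)
      moreover have "m mod 8 = 1 \<or> m mod 8 = 2 \<or> m mod 8 = 3 \<or> m mod 8 = 6 \<or> m mod 8 = 7"
      proof -
        have "0 \<le> m mod 8" "m mod 8 < 8" by simp_all
        then show ?thesis using False nz by arith
      qed
      ultimately show ?thesis by auto
    qed
  qed
  have "\<exists>A B C. K = A\<^sup>2 + B\<^sup>2 + C\<^sup>2"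
  proof (cases "K mod 16 = 8")
    case False
    define k where "k = nat K"
    have "int k = K" using K19 unfolding k_def by simp
    then have "K mod 8 = int (k mod 8)" by (metis of_nat_mod of_nat_numeral)
    then have "k mod 8 = 1 \<or> k mod 8 = 2 \<or> k mod 8 = 3 \<or> k mod 8 = 5 \<or> k mod 8 = 6"
      using K_mod False by auto
    then show ?thesis using sum_three_squares[of k] \<open>int k = K\<close> by metis
  next
    case True
    define k where "k = nat (K div 4)"
    define j where "j = K div 16"
    have j: "K = 16 * j + 8" using mult_div_mod_eq[of 16 K] True unfolding j_def by simp
    then have k: "int k = 4 * j + 2" using K19 unfolding k_def by simp
    have "(4 * j + 2) mod 8 = 2 \<or> (4 * j + 2) mod 8 = 6" by presburger
    then have "int (k mod 8) = 2 \<or> int (k mod 8) = 6" unfolding k[symmetric] by (simp add: zmod_int)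
    then have "k mod 8 = 2 \<or> k mod 8 = 6" by auto
    then obtain A B C where "int k = A\<^sup>2 + B\<^sup>2 + C\<^sup>2" using sum_three_squares[of k] by blast
    moreover have "K = 4 * int k" using k j by simp
    ultimately have "K = (2 * A)\<^sup>2 + (2 * B)\<^sup>2 + (2 * C)\<^sup>2" by (simp add: power_mult_distrib)
    then show ?thesis by blast
  qed
  then obtain A B C where "K = A\<^sup>2 + B\<^sup>2 + C\<^sup>2" by blast
  then have "rep (A, B, C)" unfolding rep_def K_def sq by simp
  moreover have "odd b \<and> \<bar>b\<bar> \<noteq> 1" if b: "35 * m - (n\<^sup>2)\<^sup>2 = 19 * b\<^sup>2" for b
  proof
    have Kb: "K = 19 * b\<^sup>2" using b unfolding K_def sq .
    show "odd b"
    proof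
      assume "even b"
      then obtain c where "b = 2 * c" by blast
      then have Kc: "K = 76 * c\<^sup>2" using Kb by (simp add: power_mult_distrib)
      have "\<exists>f. c\<^sup>2 = 4 * f \<or> c\<^sup>2 = 4 * f + 1"
      proof (cases "even c")
        case True
        then obtain d where "c = 2 * d" by blast
        then have "c\<^sup>2 = 4 * d\<^sup>2" by (simp add: power_mult_distrib)
        then show ?thesis by blast
      next
        case False
        then obtain d where "c = 2 * d + 1" by (rule oddE)
        then have "c\<^sup>2 = 4 * (d\<^sup>2 + d) + 1" by (simp add: power2_eq_square algebra_simps)
        then show ?thesis by blast
      qed
      then obtain f where "c\<^sup>2 = 4 * f \<or> c\<^sup>2 = 4 * f + 1" by blast
      then consider "K = 304 * f" | "K = 304 * f + 76" unfolding Kc by auto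
      then show False
      proof cases
        case 1
        then have "K = 0 + (38 * f) * 8" "K = 0 + (19 * f) * 16" by simp_all
        then have "K mod 8 = 0 mod 8" "K mod 16 = 0 mod 16" by (metis mod_mult_self1)+
        then show False using K_mod by simp
      next
        case 2
        then have "K = 4 + (38 * f + 9) * 8" "K = 12 + (19 * f + 4) * 16" by simp_all
        then have "K mod 8 = 4 mod 8" "K mod 16 = 12 mod 16" by (metis mod_mult_self1)+
        then show False using K_mod by simp
      qed
    qed
    show "\<bar>b\<bar> \<noteq> 1"
    proof
      assume "\<bar>b\<bar> = 1"
      then have "b\<^sup>2 = 1" by (metis one_power2 power2_abs)
      then show False using Kb K19 by simp
    qed
  qed
  ultimately show False by (rule no_rep)
qed

text \<open>If x were negative, a would be below b u + c v, against Cauchy-Schwarz. The bound 34 =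
  3^2 + 5^2 is the largest of the sums for the coefficient pairs (3, 5), (1, 5), (1, 3) that remain
  when one coordinate is singled out; that coordinate itself plays the part of w.\<close>

lemma nonneg_coordinate:
  fixes a x u v w :: int
  assumes "0 \<le> a" "a = x + (b * u + c * v)" "b\<^sup>2 + c\<^sup>2 \<le> 34" "34 * (u\<^sup>2 + v\<^sup>2 + w\<^sup>2) \<le> a\<^sup>2"
  shows "0 \<le> x"
proof (rule ccontr)
  assume "\<not> 0 \<le> x"
  then have "a < b * u + c * v" using assms(2) by simp
  then have "a\<^sup>2 < (b * u + c * v)\<^sup>2" using assms(1) by (intro power_strict_mono) auto
  also have "\<dots> = (b\<^sup>2 + c\<^sup>2) * (u\<^sup>2 + v\<^sup>2) - (b * v - c * u)\<^sup>2" by (simp add: power2_eq_square algebra_simps)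
  also have "\<dots> \<le> (b\<^sup>2 + c\<^sup>2) * (u\<^sup>2 + v\<^sup>2)" by simp
  also have "\<dots> \<le> 34 * (u\<^sup>2 + v\<^sup>2)" using assms(3) by (intro mult_right_mono) auto
  also have "\<dots> \<le> 34 * (u\<^sup>2 + v\<^sup>2 + w\<^sup>2)" by simp
  finally show False using assms(4) by simp
qed

lemma nonnegative_solution:
  fixes m n :: int
  assumes "34 * m \<le> n ^ 4"
    and "m = x\<^sup>2 + y\<^sup>2 + z\<^sup>2 + t\<^sup>2" "n\<^sup>2 = x + 3 * y + 5 * z"
  shows "\<exists>x y z t :: nat. m = int x ^ 2 + int y ^ 2 + int z ^ 2 + int t ^ 2 \<and> n ^ 2 = int x + 3 * int y + 5 * int z"
proof -
  have bound: "34 * (x\<^sup>2 + y\<^sup>2 + z\<^sup>2) \<le> (n\<^sup>2)\<^sup>2"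
  proof -
    have "x\<^sup>2 + y\<^sup>2 + z\<^sup>2 \<le> m" using assms(2) zero_le_power2[of t] by linarith
    then have "34 * (x\<^sup>2 + y\<^sup>2 + z\<^sup>2) \<le> 34 * m" by (rule mult_left_mono) simp
    also note assms(1)
    finally show ?thesis by simp
  qed
  have a: "0 \<le> n\<^sup>2" by simp
  have "n\<^sup>2 = x + (3 * y + 5 * z)" "34 * (y\<^sup>2 + z\<^sup>2 + x\<^sup>2) \<le> (n\<^sup>2)\<^sup>2" using assms(3) bound by (simp_all add: add_ac)
  from nonneg_coordinate[OF a this(1) _ this(2)] have "0 \<le> x" by simp
  moreover have "n\<^sup>2 = 3 * y + (1 * x + 5 * z)" "34 * (x\<^sup>2 + z\<^sup>2 + y\<^sup>2) \<le> (n\<^sup>2)\<^sup>2" using assms(3) bound by (simp_all add: add_ac)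
  from nonneg_coordinate[OF a this(1) _ this(2)] have "0 \<le> y" by simp
  moreover have "n\<^sup>2 = 5 * z + (1 * x + 3 * y)" "34 * (x\<^sup>2 + y\<^sup>2 + z\<^sup>2) \<le> (n\<^sup>2)\<^sup>2" using assms(3) bound by (simp_all add: add_ac)
  from nonneg_coordinate[OF a this(1) _ this(2)] have "0 \<le> z" by simp
  ultimately show ?thesis
    using assms(2,3) by (intro exI[of _ "nat x"] exI[of _ "nat y"] exI[of _ "nat z"] exI[of _ "nat \<bar>t\<bar>"]) simp
qed

theorem theorem17:
  fixes m :: int
  assumes "\<not> 16 dvd m"
    and "m \<ge> 217942742279"
  shows "\<exists>n :: int.
           real_of_int n \<in> {root 4 (34 * real_of_int m) .. root 4 (35 * real_of_int m)} \<and>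
           (\<exists>x y z t :: nat.
              m = int x ^ 2 + int y ^ 2 + int z ^ 2 + int t ^ 2 \<and>
              n ^ 2 = int x + 3 * int y + 5 * int z)"
proof -
  define u where "u = root 4 (34 * real_of_int m)"
  have m: "real_of_int m \<ge> 217942742279" using assms(2) by linarith
  have u4: "u ^ 4 = 34 * real_of_int m" unfolding u_def using m by (intro real_root_pow_pos2) auto
  \<comment> \<open>The number 34 * 217942742279 lies between 1649^4 and 1650^4.\<close>
  have u: "u \<ge> 1649"
  proof (rule power_le_imp_le_base)
    show "(1649 :: real) ^ Suc 3 \<le> u ^ Suc 3" using m u4 by simp
    show "0 \<le> u" unfolding u_def using m by simp
  qed
  define r :: int where "r = (if m mod 8 = 4 \<or> m mod 8 = 5 then 1 else 0)"
  have r01: "r = 0 \<or> r = 1" unfolding r_def by simp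
  obtain n where n: "\<lceil>u\<rceil> \<le> n" "n \<le> \<lceil>u\<rceil> + 5" "n mod 2 = r" "\<not> 5 dvd n" "\<not> 7 dvd n"
    using exists_coprime_35_in_window[of r "\<lceil>u\<rceil>"] r01 by blast
  have lower: "u \<le> n" using n(1) by linarith
  \<comment> \<open>Rounding up costs less than 1 and the window at most 5; for u \<ge> 1649 the
    excess 6 is at most a factor 1655 / 1649.\<close>
  have "n \<le> u + 6" using n(2) by linarith
  also have "\<dots> \<le> u * (1655 / 1649)" using u by simp
  finally have "real_of_int n ^ 4 \<le> (u * (1655 / 1649)) ^ 4" using lower u by (intro power_mono) auto
  also have "\<dots> = (34 * (1655 / 1649) ^ 4) * real_of_int m" unfolding power_mult_distrib u4 by simp
  \<comment> \<open>The constant on the left is just below 34.5. Stopping at 69 / 2 instead of 35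
    leaves m / 2 to absorb the summand 19.\<close>
  also have "\<dots> \<le> (69 / 2) * real_of_int m" using m by (intro mult_right_mono) (simp_all add: power_divide)
  finally have upper: "real_of_int n ^ 4 \<le> (69 / 2) * real_of_int m" .
  have "real_of_int (n ^ 4 + 19) < real_of_int (35 * m)" using upper m by simp
  then have N: "n ^ 4 + 19 < 35 * m" by (simp only: of_int_less_iff)
  have "u ^ 4 \<le> real_of_int n ^ 4" using lower u by (intro power_mono) auto
  then have "real_of_int (34 * m) \<le> real_of_int (n ^ 4)" unfolding u4 by simp
  then have m34: "34 * m \<le> n ^ 4" by (simp only: of_int_le_iff)
  have "real_of_int n = root 4 (real_of_int n ^ 4)" using lower u by (simp add: real_root_power_cancel)
  also have "\<dots> \<le> root 4 (35 * real_of_int m)" using upper m by (intro real_root_le_mono) auto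
  finally have "real_of_int n \<in> {root 4 (34 * real_of_int m) .. root 4 (35 * real_of_int m)}"
    using lower unfolding u_def by simp
  moreover have "\<exists>x y z t :: int. m = x\<^sup>2 + y\<^sup>2 + z\<^sup>2 + t\<^sup>2 \<and> n\<^sup>2 = x + 3 * y + 5 * z"
  proof (rule integral_solution[OF n(4,5) N _ _ assms(1)])
    show "m mod 8 = 4 \<or> m mod 8 = 5 \<Longrightarrow> odd n" using n(3) unfolding r_def by presburger
    show "\<not> (m mod 8 = 4 \<or> m mod 8 = 5) \<Longrightarrow> even n" using n(3) unfolding r_def by presburger
  qed
  then have "\<exists>x y z t :: nat. m = int x ^ 2 + int y ^ 2 + int z ^ 2 + int t ^ 2 \<and> n ^ 2 = int x + 3 * int y + 5 * int z"
    using nonnegative_solution[OF m34] by blast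
  ultimately show ?thesis by blast
qed

end
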